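(* Let $M>0$ and let $\rho_i,\sigma_i,q_i$ ($i=1,2$) satisfy the standing assumptions in the context. Consider the spectral problem of finding $\lambda$ and $(u,v)\neq(0,0)$ with $$(\sigma_1u'')''-(q_1u')'=\lambda\rho_1u\ \text{ on }\Omega_1=(-1,0),\qquad (\sigma_2v'')''-(q_2v')'=\lambda\rho_2v\ \text{ on }\Omega_2=(0,1),$$ $$u(-1)=u''(-1)=v(1)=v''(1)=0,$$ $$u(0)=v(0),\quad u'(0)=v'(0),\quad \sigma_1(0)u''(0)=\sigma_2(0)v''(0),$$ $$\mathcal{T}^1u(0)-\mathcal{T}^2v(0)=-M\lambda u(0).$$ Then: (a) The eigenvalues $(\lambda_n)_{n\ge1}$ of this problem are real, algebraically simple, and form an infinite increasing sequence $$0<\lambda_1<\lambda_2<\dots<\lambda_n<\cdots,\qquad \lambda_n\to\infty .$$ (b) The corresponding eigenfunctions $(\phi_n)_{n\ge1}$, where $\phi_n=u_n$ on $[-1,0]$ and $\phi_n=v_n$ on $[0,1]$ for an eigenpair $(u_n,v_n)$ associated with $\lambda_n$, satisfy $$\phi_n'(-1)\,\mathcal{T}^1\phi_n(-1)<0\quad\text{and}\quad \phi_n'(1)\,\mathcal{T}^2\phi_n(1)<0\qquad\text{for all } n\ge1.$$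
   Context: Notation: $\Omega_1=(-1,0)$, $\Omega_2=(0,1)$, and $\mathcal{T}^if=(\sigma_if'')'-q_if'$ for $i=1,2$. $H^k$ denotes the standard Sobolev space. Standing assumptions: for $i=1,2$, $\rho_i\in C(\overline{\Omega_i})$, $\sigma_i\in H^2(\Omega_i)$, $q_i\in H^1(\Omega_i)$ are real-valued, and there exist constants $\rho_0,\sigma_0>0$ such that $\rho_i\ge\rho_0$, $\sigma_i\ge\sigma_0$, $q_i\ge0$ on $\Omega_i$. Solutions are understood as $(u,v)\in H^4(\Omega_1)\times H^4(\Omega_2)$; values at endpoints are the traces (continuous extensions). Eigenvalues and their multiplicities are those of the operator $\mathcal{A}$ in the Hilbert space $\mathcal{H}=L^2(-1,0)\times L^2(0,1)\times\mathbb{R}$ (complexified when discussing non-real spectrum) with inner product $$\langle(u_1,v_1,z_1),(u_2,v_2,z_2)\rangle_{\mathcal{H}}=\int_{\Omega_1}u_1u_2\rho_1\,dx+\int_{\Omega_2}v_1v_2\rho_2\,dx+Mz_1z_2,$$ given by $$\mathcal{A}(u,v,z)=\Big(\tfrac1{\rho_1}\big((\sigma_1u'')''-(q_1u')'\big),\ \tfrac1{\rho_2}\big((\sigma_2v'')''-(q_2v')'\big),\ -\tfrac1M\big(\mathcal{T}^1u(0)-\mathcal{T}^2v(0)\big)\Big)$$ on the domain of all $(u,v,z)\in H^4(\Omega_1)\times H^4(\Omega_2)\times\mathbb{R}$ with $u(-1)=u''(-1)=v(1)=v''(1)=0$, $u(0)=v(0)=z$, $u'(0)=v'(0)$, $\sigma_1(0)u''(0)=\sigma_2(0)v''(0)$.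 Eigenfunctions of the spectral problem correspond to eigenvectors $(u,v,u(0))$ of $\mathcal{A}$. An eigenvalue $\lambda$ is algebraically simple if $\bigcup_{k\ge1}\ker(\mathcal{A}-\lambda I)^k$ is one-dimensional. In (b) eigenfunctions are taken real-valued. *)

theory Defs
  imports "HOL-Analysis.Analysis"
begin

text \<open>
  Elements of \<open>L\<^sup>2(a,b)\<close> and of the Sobolev spaces \<open>H\<^sup>k(a,b)\<close> are represented by functions
  \<open>f :: real \<Rightarrow> 'a\<close>, of which only the class modulo equality almost everywhere on \<open>{a<..<b}\<close>
  matters: every notion below is invariant under changing \<open>f\<close> on a null set or outside of
  \<open>{a<..<b}\<close>. The scalars \<open>'a\<close> will be \<open>real\<close> or \<open>complex\<close>; coefficients are always real, and act
  by scalar multiplication \<open>*\<^sub>R\<close>.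
\<close>

definition L2_on :: "real \<Rightarrow> real \<Rightarrow> (real \<Rightarrow> 'a::euclidean_space) \<Rightarrow> bool" where
  "L2_on a b f \<longleftrightarrow>
     f \<in> borel_measurable (lebesgue_on {a<..<b}) \<and>
     integrable (lebesgue_on {a<..<b}) (\<lambda>x. (norm (f x))\<^sup>2)"

definition locally_integrable_on :: "real \<Rightarrow> real \<Rightarrow> (real \<Rightarrow> 'a::euclidean_space) \<Rightarrow> bool" where
  "locally_integrable_on a b f \<longleftrightarrow>
     (\<forall>c d. a < c \<and> d < b \<longrightarrow> integrable (lebesgue_on {c..d}) f)"

definition ae_eq_on :: "real \<Rightarrow> real \<Rightarrow> (real \<Rightarrow> 'a) \<Rightarrow> (real \<Rightarrow> 'a) \<Rightarrow> bool" where
  "ae_eq_on a b f g \<longleftrightarrow> (AE x in lebesgue_on {a<..<b}. f x = g x)"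

definition test_function :: "real \<Rightarrow> real \<Rightarrow> (real \<Rightarrow> real) \<Rightarrow> bool" where
  "test_function a b \<phi> \<longleftrightarrow>
     (\<forall>n x. (deriv ^^ n) \<phi> differentiable (at x)) \<and>
     (\<exists>c d. a < c \<and> d < b \<and> (\<forall>x. x \<notin> {c..d} \<longrightarrow> \<phi> x = 0))"

definition is_weak_deriv ::
    "nat \<Rightarrow> real \<Rightarrow> real \<Rightarrow> (real \<Rightarrow> 'a::euclidean_space) \<Rightarrow> (real \<Rightarrow> 'a) \<Rightarrow> bool" where
  "is_weak_deriv n a b f g \<longleftrightarrow>
     locally_integrable_on a b f \<and> locally_integrable_on a b g \<and>
     (\<forall>\<phi>. test_function a b \<phi> \<longrightarrow>
        (LINT x|lebesgue_on {a<..<b}. (deriv ^^ n) \<phi> x *\<^sub>R f x) =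
        (-1) ^ n *\<^sub>R (LINT x|lebesgue_on {a<..<b}. \<phi> x *\<^sub>R g x))"

text \<open>The weak derivative is unique almost everywhere; \<open>wderiv\<close> picks a representative.\<close>

definition wderiv ::
    "nat \<Rightarrow> real \<Rightarrow> real \<Rightarrow> (real \<Rightarrow> 'a::euclidean_space) \<Rightarrow> real \<Rightarrow> 'a" where
  "wderiv n a b f = (SOME g. is_weak_deriv n a b f g)"

definition sobolev :: "nat \<Rightarrow> real \<Rightarrow> real \<Rightarrow> (real \<Rightarrow> 'a::euclidean_space) \<Rightarrow> bool" where
  "sobolev k a b f \<longleftrightarrow> L2_on a b f \<and> (\<forall>j\<le>k. \<exists>g. L2_on a b g \<and> is_weak_deriv j a b f g)"

text \<open>
  The value at \<open>x \<in> {a..b}\<close> of the continuous extension to \<open>{a..b}\<close> of the class of \<open>f\<close>;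
  meaningful if that class has a representative continuous up to the boundary, in particular if
  \<open>f \<in> H\<^sup>1(a,b)\<close>.
\<close>

definition trace_at :: "real \<Rightarrow> real \<Rightarrow> (real \<Rightarrow> 'a::euclidean_space) \<Rightarrow> real \<Rightarrow> 'a" where
  "trace_at a b f x = (THE y. \<exists>g. continuous_on {a..b} g \<and> ae_eq_on a b f g \<and> y = g x)"

text \<open>\<open>(\<sigma> f'')'' - (q f')'\<close> and \<open>\<T> f = (\<sigma> f'')' - q f'\<close>.\<close>

definition beam_op ::
    "real \<Rightarrow> real \<Rightarrow> (real \<Rightarrow> real) \<Rightarrow> (real \<Rightarrow> real) \<Rightarrow> (real \<Rightarrow> 'a::euclidean_space) \<Rightarrow> real \<Rightarrow> 'a" where
  "beam_op a b \<sigma> q f = (\<lambda>x.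
     wderiv 2 a b (\<lambda>t. \<sigma> t *\<^sub>R wderiv 2 a b f t) x - wderiv 1 a b (\<lambda>t. q t *\<^sub>R wderiv 1 a b f t) x)"

definition T_op ::
    "real \<Rightarrow> real \<Rightarrow> (real \<Rightarrow> real) \<Rightarrow> (real \<Rightarrow> real) \<Rightarrow> (real \<Rightarrow> 'a::euclidean_space) \<Rightarrow> real \<Rightarrow> 'a" where
  "T_op a b \<sigma> q f = (\<lambda>x.
     wderiv 1 a b (\<lambda>t. \<sigma> t *\<^sub>R wderiv 2 a b f t) x - q x *\<^sub>R wderiv 1 a b f x)"

definition boundary_conditions ::
    "(real \<Rightarrow> real) \<Rightarrow> (real \<Rightarrow> real) \<Rightarrow>
     (real \<Rightarrow> 'a::euclidean_space) \<Rightarrow> (real \<Rightarrow> 'a) \<Rightarrow> bool" where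
  "boundary_conditions \<sigma>1 \<sigma>2 u v \<longleftrightarrow>
     trace_at (-1) 0 u (-1) = 0 \<and> trace_at (-1) 0 (wderiv 2 (-1) 0 u) (-1) = 0 \<and>
     trace_at 0 1 v 1 = 0 \<and> trace_at 0 1 (wderiv 2 0 1 v) 1 = 0 \<and>
     trace_at (-1) 0 u 0 = trace_at 0 1 v 0 \<and>
     trace_at (-1) 0 (wderiv 1 (-1) 0 u) 0 = trace_at 0 1 (wderiv 1 0 1 v) 0 \<and>
     trace_at (-1) 0 \<sigma>1 0 *\<^sub>R trace_at (-1) 0 (wderiv 2 (-1) 0 u) 0 =
       trace_at 0 1 \<sigma>2 0 *\<^sub>R trace_at 0 1 (wderiv 2 0 1 v) 0"

definition eigenpair ::
    "real \<Rightarrow> (real \<Rightarrow> real) \<Rightarrow> (real \<Rightarrow> real) \<Rightarrow> (real \<Rightarrow> real) \<Rightarrow> (real \<Rightarrow> real) \<Rightarrow>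
     (real \<Rightarrow> real) \<Rightarrow> (real \<Rightarrow> real) \<Rightarrow>
     'a::{real_normed_field, euclidean_space} \<Rightarrow> (real \<Rightarrow> 'a) \<Rightarrow> (real \<Rightarrow> 'a) \<Rightarrow> bool" where
  "eigenpair M \<rho>1 \<rho>2 \<sigma>1 \<sigma>2 q1 q2 ev u v \<longleftrightarrow>
     sobolev 4 (-1) 0 u \<and> sobolev 4 0 1 v \<and>
     \<not> (ae_eq_on (-1) 0 u (\<lambda>x. 0) \<and> ae_eq_on 0 1 v (\<lambda>x. 0)) \<and>
     ae_eq_on (-1) 0 (beam_op (-1) 0 \<sigma>1 q1 u) (\<lambda>x. ev * (\<rho>1 x *\<^sub>R u x)) \<and>
     ae_eq_on 0 1 (beam_op 0 1 \<sigma>2 q2 v) (\<lambda>x. ev * (\<rho>2 x *\<^sub>R v x)) \<and>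
     boundary_conditions \<sigma>1 \<sigma>2 u v \<and>
     trace_at (-1) 0 (T_op (-1) 0 \<sigma>1 q1 u) 0 - trace_at 0 1 (T_op 0 1 \<sigma>2 q2 v) 0 =
       - (M *\<^sub>R (ev * trace_at (-1) 0 u 0))"

text \<open>
  The operator \<open>\<A>\<close> in \<open>\<H> = L\<^sup>2(-1,0) \<times> L\<^sup>2(0,1) \<times> 'a\<close>, acting on representatives:
  \<open>H_null\<close> are the representatives of \<open>0 \<in> \<H>\<close> and \<open>A_dom\<close> those of elements of the domain.
\<close>

type_synonym 'a state = "(real \<Rightarrow> 'a) \<times> (real \<Rightarrow> 'a) \<times> 'a"

definition H_null :: "'a::euclidean_space state set" where
  "H_null = {(u, v, z). ae_eq_on (-1) 0 u (\<lambda>x. 0) \<and> ae_eq_on 0 1 v (\<lambda>x. 0) \<and> z = 0}"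

definition A_dom :: "(real \<Rightarrow> real) \<Rightarrow> (real \<Rightarrow> real) \<Rightarrow> 'a::euclidean_space state set" where
  "A_dom \<sigma>1 \<sigma>2 = {(u, v, z). sobolev 4 (-1) 0 u \<and> sobolev 4 0 1 v \<and>
     boundary_conditions \<sigma>1 \<sigma>2 u v \<and> trace_at (-1) 0 u 0 = z \<and> trace_at 0 1 v 0 = z}"

definition A_op ::
    "real \<Rightarrow> (real \<Rightarrow> real) \<Rightarrow> (real \<Rightarrow> real) \<Rightarrow> (real \<Rightarrow> real) \<Rightarrow> (real \<Rightarrow> real) \<Rightarrow>
     (real \<Rightarrow> real) \<Rightarrow> (real \<Rightarrow> real) \<Rightarrow> 'a::euclidean_space state \<Rightarrow> 'a state" where
  "A_op M \<rho>1 \<rho>2 \<sigma>1 \<sigma>2 q1 q2 = (\<lambda>(u, v, z).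
     (\<lambda>x. (1 / \<rho>1 x) *\<^sub>R beam_op (-1) 0 \<sigma>1 q1 u x,
      \<lambda>x. (1 / \<rho>2 x) *\<^sub>R beam_op 0 1 \<sigma>2 q2 v x,
      - ((1 / M) *\<^sub>R (trace_at (-1) 0 (T_op (-1) 0 \<sigma>1 q1 u) 0 -
                     trace_at 0 1 (T_op 0 1 \<sigma>2 q2 v) 0))))"

text \<open>\<open>w - c \<cdot> w'\<close> in \<open>\<H>\<close>\<close>

definition state_minus_mult ::
    "'a::{real_normed_field, euclidean_space} state \<Rightarrow> 'a \<Rightarrow> 'a state \<Rightarrow> 'a state" where
  "state_minus_mult = (\<lambda>(u, v, z) c (u', v', z').
     (\<lambda>x. u x - c * u' x, \<lambda>x. v x - c * v' x, z - c * z'))"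

text \<open>\<open>ker (\<A> - ev I)\<^sup>k\<close>, with the natural domains of the powers.\<close>

primrec A_ker_pow ::
    "real \<Rightarrow> (real \<Rightarrow> real) \<Rightarrow> (real \<Rightarrow> real) \<Rightarrow> (real \<Rightarrow> real) \<Rightarrow> (real \<Rightarrow> real) \<Rightarrow>
     (real \<Rightarrow> real) \<Rightarrow> (real \<Rightarrow> real) \<Rightarrow> 'a::{real_normed_field, euclidean_space} \<Rightarrow>
     nat \<Rightarrow> 'a state set" where
  "A_ker_pow M \<rho>1 \<rho>2 \<sigma>1 \<sigma>2 q1 q2 ev 0 = H_null"
| "A_ker_pow M \<rho>1 \<rho>2 \<sigma>1 \<sigma>2 q1 q2 ev (Suc k) =
     {w \<in> A_dom \<sigma>1 \<sigma>2.
        state_minus_mult (A_op M \<rho>1 \<rho>2 \<sigma>1 \<sigma>2 q1 q2 w) ev w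
          \<in> A_ker_pow M \<rho>1 \<rho>2 \<sigma>1 \<sigma>2 q1 q2 ev k}"

definition A_gen_eigenspace ::
    "real \<Rightarrow> (real \<Rightarrow> real) \<Rightarrow> (real \<Rightarrow> real) \<Rightarrow> (real \<Rightarrow> real) \<Rightarrow> (real \<Rightarrow> real) \<Rightarrow>
     (real \<Rightarrow> real) \<Rightarrow> (real \<Rightarrow> real) \<Rightarrow> 'a::{real_normed_field, euclidean_space} \<Rightarrow>
     'a state set" where
  "A_gen_eigenspace M \<rho>1 \<rho>2 \<sigma>1 \<sigma>2 q1 q2 ev =
     (\<Union>k\<in>{1..}. A_ker_pow M \<rho>1 \<rho>2 \<sigma>1 \<sigma>2 q1 q2 ev k)"

text \<open>One-dimensionality of the generalized eigenspace, modulo \<open>H_null\<close>.\<close>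

definition algebraically_simple ::
    "real \<Rightarrow> (real \<Rightarrow> real) \<Rightarrow> (real \<Rightarrow> real) \<Rightarrow> (real \<Rightarrow> real) \<Rightarrow> (real \<Rightarrow> real) \<Rightarrow>
     (real \<Rightarrow> real) \<Rightarrow> (real \<Rightarrow> real) \<Rightarrow> 'a::{real_normed_field, euclidean_space} \<Rightarrow> bool" where
  "algebraically_simple M \<rho>1 \<rho>2 \<sigma>1 \<sigma>2 q1 q2 ev \<longleftrightarrow>
     (\<exists>w \<in> A_gen_eigenspace M \<rho>1 \<rho>2 \<sigma>1 \<sigma>2 q1 q2 ev. w \<notin> H_null \<and>
        (\<forall>w' \<in> A_gen_eigenspace M \<rho>1 \<rho>2 \<sigma>1 \<sigma>2 q1 q2 ev.
           \<exists>c. state_minus_mult w' c w \<in> H_null))"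

lemma ae_eq_on_iff_negligible:
  "ae_eq_on a b f g \<longleftrightarrow> negligible {x \<in> {a<..<b}. f x \<noteq> g x}"
proof -
  have "ae_eq_on a b f g \<longleftrightarrow> (AE x in lebesgue. x \<in> {a<..<b} \<longrightarrow> f x = g x)"
    unfolding ae_eq_on_def by (subst AE_restrict_space_iff) auto
  also have "\<dots> \<longleftrightarrow> {x \<in> {a<..<b}. f x \<noteq> g x} \<in> null_sets lebesgue"
    by (subst completion.AE_iff_null_sets) (auto intro!: arg_cong[where f = "\<lambda>S. S \<in> null_sets lebesgue"])
  finally show ?thesis by (simp add: negligible_iff_null_sets)
qed

lemma ae_eq_on_continuous_imp_eq:
  fixes f g :: "real \<Rightarrow> 'a::euclidean_space"
  assumes "a < b" "continuous_on {a..b} f" "continuous_on {a..b} g" "ae_eq_on a b f g" "x \<in> {a..b}"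
  shows "f x = g x"
proof -
  have cont: "continuous_on {a..b} (\<lambda>x. f x - g x)" using assms by (intro continuous_intros)
  let ?S = "{x \<in> {a<..<b}. f x \<noteq> g x}"
  have "open ({a<..<b} \<inter> (\<lambda>x. f x - g x) -` (- {0}))"
    by (rule continuous_open_preimage[OF continuous_on_subset[OF cont]]) auto
  also have "{a<..<b} \<inter> (\<lambda>x. f x - g x) -` (- {0}) = ?S" by auto
  finally have "?S = {}"
    using assms(4) open_not_negligible unfolding ae_eq_on_iff_negligible by blast
  then have "\<And>y. y \<in> {a<..<b} \<Longrightarrow> f y - g y = 0" by auto
  moreover have "x \<in> closure {a<..<b}" "continuous_on (closure {a<..<b}) (\<lambda>x. f x - g x)"
    using assms cont by auto
  ultimately have "f x - g x = 0"
    by (metis (mono_tags, lifting) continuous_constant_on_closure)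
  then show ?thesis by simp
qed

lemma trace_at_eqI:
  fixes f g :: "real \<Rightarrow> 'a::euclidean_space"
  assumes "a < b" "continuous_on {a..b} g" "ae_eq_on a b f g" "x \<in> {a..b}"
  shows "trace_at a b f x = g x"
  unfolding trace_at_def
proof (rule the_equality)
  fix y assume "\<exists>h. continuous_on {a..b} h \<and> ae_eq_on a b f h \<and> y = h x"
  then obtain h where h: "continuous_on {a..b} h" "ae_eq_on a b f h" "y = h x" by blast
  have "ae_eq_on a b h g" using h(2) assms(3) unfolding ae_eq_on_def by eventually_elim auto
  then show "y = g x" using ae_eq_on_continuous_imp_eq[OF assms(1) h(1) assms(2) _ assms(4)] h by simp
qed (use assms in blast)

text \<open>
  Eigenpairs of the spectral problem correspond to eigenvectors \<open>(u, v, u(0))\<close> of \<open>\<A>\<close>.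
\<close>

lemma eigenpair_iff_eigenvector:
  fixes ev :: "'a::{real_normed_field, euclidean_space}"
  assumes "M > 0" "\<And>x. x \<in> {-1<..<0} \<Longrightarrow> \<rho>1 x > 0" "\<And>x. x \<in> {0<..<1} \<Longrightarrow> \<rho>2 x > 0"
  shows "(eigenpair M \<rho>1 \<rho>2 \<sigma>1 \<sigma>2 q1 q2 ev u v \<and> z = trace_at (-1) 0 u 0) \<longleftrightarrow>
    (u, v, z) \<in> A_ker_pow M \<rho>1 \<rho>2 \<sigma>1 \<sigma>2 q1 q2 ev 1 \<and> (u, v, z) \<notin> H_null"
proof -
  have 1: "ae_eq_on (-1) 0 f (\<lambda>x. ev * (\<rho>1 x *\<^sub>R u x)) \<longleftrightarrow>
      ae_eq_on (-1) 0 (\<lambda>x. (1 / \<rho>1 x) *\<^sub>R f x - ev * u x) (\<lambda>x. 0)" for f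
  proof -
    have "f x = ev * (\<rho>1 x *\<^sub>R u x) \<longleftrightarrow> (1 / \<rho>1 x) *\<^sub>R f x - ev * u x = 0"
      if "x \<in> {-1<..<0}" for x
      using assms(2)[OF that] by (auto simp: field_simps dest: arg_cong[where f = "\<lambda>y. \<rho>1 x *\<^sub>R y"])
    then show ?thesis unfolding ae_eq_on_def by (intro AE_cong) auto
  qed
  have 2: "ae_eq_on 0 1 f (\<lambda>x. ev * (\<rho>2 x *\<^sub>R v x)) \<longleftrightarrow>
      ae_eq_on 0 1 (\<lambda>x. (1 / \<rho>2 x) *\<^sub>R f x - ev * v x) (\<lambda>x. 0)" for f
  proof -
    have "f x = ev * (\<rho>2 x *\<^sub>R v x) \<longleftrightarrow> (1 / \<rho>2 x) *\<^sub>R f x - ev * v x = 0"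
      if "x \<in> {0<..<1}" for x
      using assms(3)[OF that] by (auto simp: field_simps dest: arg_cong[where f = "\<lambda>y. \<rho>2 x *\<^sub>R y"])
    then show ?thesis unfolding ae_eq_on_def by (intro AE_cong) auto
  qed
  have 3: "t = - (M *\<^sub>R (ev * z)) \<longleftrightarrow> - ((1 / M) *\<^sub>R t) - ev * z = 0" for t :: 'a
  proof -
    have "t = - (M *\<^sub>R (ev * z)) \<longleftrightarrow> (1 / M) *\<^sub>R t = (1 / M) *\<^sub>R - (M *\<^sub>R (ev * z))"
      using assms(1) by (subst real_vector.scale_cancel_left) auto
    also have "\<dots> \<longleftrightarrow> (1 / M) *\<^sub>R t = - (ev * z)"
      using assms(1) by simp
    also have "\<dots> \<longleftrightarrow> - ((1 / M) *\<^sub>R t) - ev * z = 0"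
      by (metis add.inverse_inverse eq_iff_diff_eq_0)
    finally show ?thesis .
  qed
  have 4: "trace_at (-1) 0 u 0 = 0" if "ae_eq_on (-1) 0 u (\<lambda>x. 0)"
    using trace_at_eqI[OF _ _ that, of 0] by simp
  show ?thesis (is "?L \<longleftrightarrow> ?R")
  proof
    assume ?L
    then show ?R
      unfolding eigenpair_def H_null_def A_dom_def A_op_def state_minus_mult_def
        One_nat_def A_ker_pow.simps mem_Collect_eq prod.case 1 2
      by (metis 3 boundary_conditions_def)
  next
    assume ?R
    then show ?L
      unfolding eigenpair_def H_null_def A_dom_def A_op_def state_minus_mult_def
        One_nat_def A_ker_pow.simps mem_Collect_eq prod.case 1 2
      by (metis 3 4)
  qed
qed

end

theory Submission
  imports Defs "HOL-Complex_Analysis.Great_Picard"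
begin

text \<open>
  Put \<open>\<theta> = u'\<close>, \<open>m = \<sigma> u''\<close> and \<open>T = m' - q u'\<close>. On each of the two intervals the equation
  \<open>(\<sigma> u'')'' - (q u')' = \<lambda> \<rho> u\<close> is the first-order system
  \<open>u' = \<theta>\<close>, \<open>\<theta>' = m / \<sigma>\<close>, \<open>m' = T + q \<theta>\<close>, \<open>T' = \<lambda> \<rho> u\<close>. Its coefficients \<open>1 / \<sigma>\<close>, \<open>q\<close>, \<open>\<rho>\<close> are
  continuous up to the boundary, so the weak problem is equivalent to a classical boundary value
  problem on \<open>[-1, 1]\<close> in which \<open>u\<close>, \<open>\<theta>\<close>, \<open>m\<close> are continuous across \<open>0\<close> and only \<open>T\<close> jumps there
  (\<open>weak_to_bvp\<close>, \<open>bvp_to_eigenpair\<close>). The translation needs the du Bois-Reymond lemma and the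
  product rule for one continuously differentiable and one absolutely continuous factor.

  \<^bold>\<open>Signs and simplicity.\<close> All coefficients of the system are nonnegative, so nonnegative data at
  \<open>-1\<close> stay nonnegative up to \<open>1\<close>; the jump at \<open>0\<close> has the favourable sign. As \<open>u\<close> and \<open>m\<close> vanish at
  \<open>-1\<close>, a solution with \<open>\<theta>(-1) T(-1) \<ge> 0\<close> is, up to sign, nonnegative and nondecreasing with
  \<open>u(1) = 0\<close>, hence zero (\<open>bvp_sign_left\<close>). Reflection gives the other end. Two eigenfunctions for the
  same eigenvalue have a nontrivial combination with \<open>\<theta>(-1) = 0\<close>, which must therefore vanish
  (\<open>bvp_simple\<close>).

  \<^bold>\<open>Reality and absence of Jordan chains.\<close> Green's identity (\<open>bvp_green\<close>) says that the problem is
  symmetric for the inner product \<open>\<integral> \<rho> f g + M f(0) g(0)\<close>. Applied to real and imaginary parts it gives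
  real eigenvalues; applied to an eigenfunction and the next element of a chain it shows that there
  is no such element.

  \<^bold>\<open>Infinitely many eigenvalues.\<close> The operator \<open>K\<close> that solves the problem for a given load is
  symmetric and positive. It exists because the problem without load has only the zero solution,
  which makes the shooting determinant nonzero (\<open>bvp_exists\<close>). The energy bounds \<open>K f\<close> in Lipschitz norm
  by the mass norm of \<open>f\<close>, so \<open>K\<close> is compact by the theorem of Arzela and Ascoli. The maximum of its
  Rayleigh quotient over a closed invariant subspace is attained (\<open>eigenvector_exists\<close>). If there were
  only finitely many eigenvalues, \<open>K\<close> would vanish on the orthogonal complement of the eigenfunctions,
  and every continuous function would on \<open>[-1, 0]\<close> be a finite combination of differentiable ones;
  \<open>\<bar>x + 1/2\<bar>\<close> is not (\<open>infinite_eigenvalues\<close>). By compactness again the eigenvalues have no finite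
  accumulation point, so they can be listed in increasing order.
\<close>

section \<open>Smooth bump functions\<close>

text \<open>
  The functions \<open>exp (- 1 / t) / t ^ i\<close>, extended by \<open>0\<close>. Together they are closed under
  differentiation up to linear combinations, from which smoothness follows without computing the
  higher derivatives.
\<close>

definition flat :: "nat \<Rightarrow> real \<Rightarrow> real" where
  "flat i t = (if t > 0 then exp (- 1 / t) / t ^ i else 0)"

lemma tendsto_flat_0: "((\<lambda>t::real. exp (- 1 / t) / t ^ k) \<longlongrightarrow> 0) (at_right 0)"
proof -
  have "((\<lambda>x::real. x ^ k / exp x) \<longlongrightarrow> 0) at_top"
    by (rule tendsto_power_div_exp_0)
  then have "((\<lambda>x::real. inverse x ^ k / exp (inverse x)) \<longlongrightarrow> 0) (at_right 0)"
    by (rule filterlim_compose) (rule filterlim_inverse_at_top_right)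
  then show ?thesis
    by (rule Lim_transform_eventually)
      (auto simp: eventually_at_filter field_simps exp_minus power_inverse inverse_eq_divide)
qed

lemma flat_deriv:
  "(flat i has_real_derivative (flat (i + 2) t - real i * flat (i + 1) t)) (at t)"
proof (cases "t > 0")
  case True
  have "((\<lambda>t. exp (- 1 / t) / t ^ i) has_real_derivative
      (exp (-1/t) * (1 / t\<^sup>2) * t ^ i - exp (-1/t) * (real i * t ^ (i - 1))) / (t ^ i * t ^ i)) (at t)"
    by (rule derivative_eq_intros refl | use True in \<open>simp add: power2_eq_square\<close>)+
  also have "(exp (-1/t) * (1 / t\<^sup>2) * t ^ i - exp (-1/t) * (real i * t ^ (i - 1))) / (t ^ i * t ^ i)
     = flat (i + 2) t - real i * flat (i + 1) t"
    using True by (cases i) (simp_all add: flat_def field_simps power2_eq_square)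
  finally show ?thesis
    by (rule has_field_derivative_transform_within_open[of _ _ _ "{0<..}"])
      (use True in \<open>auto simp: flat_def\<close>)
next
  case False
  show ?thesis
  proof (cases "t = 0")
    case True
    have "((\<lambda>h. flat i h / h) \<longlongrightarrow> 0) (at_right 0)"
      by (rule Lim_transform_eventually[OF tendsto_flat_0[of "Suc i"]])
        (auto simp: eventually_at_filter flat_def field_simps)
    moreover have "((\<lambda>h. flat i h / h) \<longlongrightarrow> 0) (at_left 0)"
      by (rule Lim_transform_eventually[OF tendsto_const])
        (auto simp: eventually_at_filter flat_def)
    ultimately have "((\<lambda>h. flat i h / h) \<longlongrightarrow> 0) (at 0)"
      using filterlim_split_at by blast
    then have "(flat i has_real_derivative 0) (at 0)"
      by (simp add: DERIV_def flat_def)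
    then show ?thesis using True by (simp add: flat_def)
  next
    case t: False
    have "((\<lambda>t. 0) has_real_derivative 0) (at t)" by simp
    then have "(flat i has_real_derivative 0) (at t)"
      by (rule has_field_derivative_transform_within_open[of _ _ _ "{..<0}"])
        (use t False in \<open>auto simp: flat_def\<close>)
    then show ?thesis using False by (simp add: flat_def)
  qed
qed

text \<open>
  The span of the products that arise by differentiating \<open>flat 0 (k (x - c)) flat 0 (k (d - x))\<close>.
  Every member is differentiable with a derivative in the span again, so every member is smooth.
\<close>

inductive_set bump_span :: "real \<Rightarrow> real \<Rightarrow> real \<Rightarrow> (real \<Rightarrow> real) set" for k c d where
  base: "(\<lambda>x. flat i (k * (x - c)) * flat j (k * (d - x))) \<in> bump_span k c d"
| add: "f \<in> bump_span k c d \<Longrightarrow> g \<in> bump_span k c d \<Longrightarrow> (\<lambda>x. f x + g x) \<in> bump_span k c d"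
| mult: "f \<in> bump_span k c d \<Longrightarrow> (\<lambda>x. r * f x) \<in> bump_span k c d"

lemma bump_span_deriv:
  assumes "f \<in> bump_span k c d"
  shows "\<exists>f'\<in>bump_span k c d. \<forall>x. (f has_real_derivative f' x) (at x)"
  using assms
proof induction
  case (base i j)
  let ?b = "\<lambda>i j x. flat i (k * (x - c)) * flat j (k * (d - x))"
  have B: "?b i j \<in> bump_span k c d" for i j by (rule bump_span.base)
  let ?D = "\<lambda>x. (k * ?b (i+2) j x + (- k * real i) * ?b (i+1) j x)
              + ((- k) * ?b i (j+2) x + (k * real j) * ?b i (j+1) x)"
  have "?D \<in> bump_span k c d"
    by (intro bump_span.add bump_span.mult B)
  moreover have "(?b i j has_real_derivative ?D x) (at x)" for x
  proof -
    have 1: "((\<lambda>x. flat i (k * (x - c))) has_real_derivative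
        (flat (i + 2) (k * (x - c)) - real i * flat (i + 1) (k * (x - c))) * k) (at x)"
      by (rule DERIV_chain2[OF flat_deriv]) (auto intro!: derivative_eq_intros)
    have 2: "((\<lambda>x. flat j (k * (d - x))) has_real_derivative
        (flat (j + 2) (k * (d - x)) - real j * flat (j + 1) (k * (d - x))) * (- k)) (at x)"
      by (rule DERIV_chain2[OF flat_deriv]) (auto intro!: derivative_eq_intros)
    show ?thesis
      by (rule DERIV_cong[OF DERIV_mult[OF 1 2]]) (simp add: algebra_simps)
  qed
  ultimately show ?case by (intro bexI[of _ ?D] allI)
next
  case (add f g)
  then obtain f' g' where "f' \<in> bump_span k c d" "\<forall>x. (f has_real_derivative f' x) (at x)"
    "g' \<in> bump_span k c d" "\<forall>x. (g has_real_derivative g' x) (at x)" by blast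
  then show ?case
    by (intro bexI[of _ "\<lambda>x. f' x + g' x"]) (auto intro: bump_span.add DERIV_add)
next
  case (mult f r)
  then obtain f' where "f' \<in> bump_span k c d" "\<forall>x. (f has_real_derivative f' x) (at x)" by blast
  then show ?case
    by (intro bexI[of _ "\<lambda>x. r * f' x"]) (auto intro: bump_span.mult DERIV_cmult)
qed

lemma bump_span_smooth:
  assumes "f \<in> bump_span k c d"
  shows "(deriv ^^ n) f \<in> bump_span k c d"
proof (induction n)
  case (Suc n)
  obtain f' where f': "f' \<in> bump_span k c d" "\<forall>x. ((deriv ^^ n) f has_real_derivative f' x) (at x)"
    using bump_span_deriv[OF Suc] by blast
  then have "deriv ((deriv ^^ n) f) = f'" by (auto intro!: ext DERIV_imp_deriv)
  then show ?case using f'(1) by simp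
qed (use assms in simp)

lemma bump_span_differentiable: "f \<in> bump_span k c d \<Longrightarrow> f differentiable (at x)"
  using bump_span_deriv[of f k c d] by (auto simp: real_differentiable_def)

text \<open>
  The scaling by \<open>n + 1\<close> makes the plateau of the bump fill \<open>(c, d)\<close> as \<open>n\<close> grows, so that the bumps
  converge to the indicator function of \<open>(c, d)\<close>.
\<close>

definition bump :: "nat \<Rightarrow> real \<Rightarrow> real \<Rightarrow> real \<Rightarrow> real" where
  "bump n c d x = flat 0 (real (Suc n) * (x - c)) * flat 0 (real (Suc n) * (d - x))"

lemma test_function_bump:
  assumes "a < c" "d < b"
  shows "test_function a b (bump n c d)"
proof -
  have "bump n c d \<in> bump_span (Suc n) c d"
    using bump_span.base[of 0 "Suc n" c 0 d] unfolding bump_def[abs_def] .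
  moreover have "\<forall>x. x \<notin> {c..d} \<longrightarrow> bump n c d x = 0"
    by (auto simp: bump_def flat_def zero_less_mult_iff)
  ultimately show ?thesis
    unfolding test_function_def using assms bump_span_smooth bump_span_differentiable by meson
qed

lemma flat_0_bounds: "0 \<le> flat 0 t" "flat 0 t \<le> 1"
  by (auto simp: flat_def)

lemma bump_bounds: "0 \<le> bump n c d x" "bump n c d x \<le> 1"
  unfolding bump_def using flat_0_bounds by (auto intro!: mult_le_one)

lemma bump_pos: "c < x \<Longrightarrow> x < d \<Longrightarrow> 0 < bump n c d x"
  by (auto simp: bump_def flat_def)

lemma bump_eq_0: "x \<notin> {c<..<d} \<Longrightarrow> bump n c d x = 0"
  by (auto simp: bump_def flat_def zero_less_mult_iff)

lemma bump_tendsto_indicator: "(\<lambda>n. bump n c d x) \<longlonglongrightarrow> indicator {c<..<d} x"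
proof (cases "x \<in> {c<..<d}")
  case True
  have *: "(\<lambda>n. flat 0 (real (Suc n) * t)) \<longlonglongrightarrow> 1" if "t > 0" for t
  proof -
    have "(\<lambda>n. exp (- (1 / t) * inverse (real (Suc n)))) \<longlonglongrightarrow> exp (- (1 / t) * 0)"
      by (intro tendsto_intros LIMSEQ_inverse_real_of_nat)
    then show ?thesis
      using that by (simp add: flat_def zero_less_mult_iff field_simps del: of_nat_Suc)
  qed
  have "(\<lambda>n. bump n c d x) \<longlonglongrightarrow> 1 * 1"
    unfolding bump_def using True by (intro tendsto_mult *) auto
  then show ?thesis using True by simp
next
  case False
  then show ?thesis using bump_eq_0[OF False] by simp
qed

section \<open>Functions with vanishing integrals\<close>

lemma sigma_finite_lebesgue: "sigma_finite_measure lebesgue"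
proof
  obtain A :: "'a set set" where A: "countable A" "A \<subseteq> sets lborel" "\<Union>A = space lborel"
    "\<forall>a\<in>A. emeasure lborel a \<noteq> \<infinity>"
    using lborel.sigma_finite_countable by blast
  then show "\<exists>A. countable A \<and> A \<subseteq> sets lebesgue \<and> \<Union>A = space lebesgue \<and>
      (\<forall>a\<in>A. emeasure (lebesgue :: 'a::euclidean_space measure) a \<noteq> \<infinity>)"
    by (intro exI[of _ A]) auto
qed

text \<open>
  The half-lines generate the Borel sets and are closed under intersection, so the integral of the
  function over every Borel set vanishes; Lebesgue sets differ from Borel sets by null sets.
\<close>

lemma integral_zero_imp_ae_zero:
  fixes h :: "real \<Rightarrow> 'a::euclidean_space"
  assumes h: "h absolutely_integrable_on {a..b}"
    and zero: "\<And>d. a \<le> d \<Longrightarrow> d \<le> b \<Longrightarrow> integral {a..d} h = 0"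
  shows "negligible {x \<in> {a..b}. h x \<noteq> 0}"
proof -
  define f where "f = (\<lambda>x. if x \<in> {a..b} then h x else 0)"
  have f: "f absolutely_integrable_on UNIV"
    using h absolutely_integrable_restrict_UNIV[of "{a..b}" h] by (simp add: f_def)
  then have fi: "integrable lebesgue f"
    by (simp add: set_integrable_def)
  have si: "set_integrable lebesgue A f" if "A \<in> sets lebesgue" for A
    using set_integrable_subset[OF f that] by simp
  have I: "set_lebesgue_integral lebesgue {..d} f = 0" for d
  proof -
    have "set_lebesgue_integral lebesgue {..d} f = integral {..d} f"
      by (rule set_lebesgue_integral_eq_integral(2)) (rule si, simp)
    also have "\<dots> = integral ({..d} \<inter> {a..b}) h"
      unfolding f_def by (subst Int_commute, rule Henstock_Kurzweil_Integration.integral_restrict_Int)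
    also have "\<dots> = 0"
    proof (cases "d < a \<or> b < a")
      case True
      then have "{..d} \<inter> {a..b} = {}" by auto
      then show ?thesis by simp
    next
      case False
      then have "{..d} \<inter> {a..b} = {a..min d b}" by auto
      then show ?thesis using zero[of "min d b"] False by simp
    qed
    finally show ?thesis .
  qed
  have borel_zero: "set_lebesgue_integral lebesgue A f = 0" if "A \<in> sets borel" for A
  proof -
    have g: "sets (borel :: real measure) = sigma_sets UNIV (range (\<lambda>a. {..a}))"
      by (subst borel_eq_atMost) simp
    have leb: "A \<in> sets lebesgue" if "A \<in> sigma_sets UNIV (range (\<lambda>a::real. {..a}))" for A
      using that unfolding g[symmetric] by simp
    have total: "set_lebesgue_integral lebesgue UNIV f = 0"
    proof -
      have "set_lebesgue_integral lebesgue UNIV f = set_lebesgue_integral lebesgue {..b} f"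
        unfolding set_lebesgue_integral_def
        by (rule Bochner_Integration.integral_cong) (auto simp: f_def)
      then show ?thesis using I by simp
    qed
    have st: "Int_stable (range (\<lambda>a::real. {..a}))" by (auto simp: Int_stable_def)
    have pw: "range (\<lambda>a::real. {..a}) \<subseteq> Pow UNIV" by simp
    have "A \<in> sigma_sets UNIV (range (\<lambda>a::real. {..a}))" using that g by simp
    with st pw show ?thesis
    proof (induction rule: sigma_sets_induct_disjoint)
      case (basic A)
      then show ?case using I by auto
    next
      case empty
      then show ?case by (simp add: set_lebesgue_integral_def)
    next
      case (compl A)
      have "set_lebesgue_integral lebesgue (A \<union> (UNIV - A)) f =
          set_lebesgue_integral lebesgue A f + set_lebesgue_integral lebesgue (UNIV - A) f"
        by (rule set_integral_Un) (use leb[OF compl(1)] in \<open>auto intro!: si\<close>)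
      then show ?case using compl total by simp
    next
      case (union A)
      have "set_lebesgue_integral lebesgue (\<Union>i. A i) f = (\<Sum>i. set_lebesgue_integral lebesgue (A i) f)"
        by (rule lebesgue_integral_countable_add)
          (use union leb in \<open>auto intro!: si simp: disjoint_family_on_def image_subset_iff\<close>)
      then show ?case using union by simp
    qed
  qed
  have "AE x in lebesgue. f x = 0"
  proof (rule sigma_finite_measure.density_zero[OF sigma_finite_lebesgue fi])
    fix A :: "real set" assume "A \<in> sets lebesgue"
    then obtain S N N' where A: "A = S \<union> N" "N \<subseteq> N'" "N' \<in> null_sets lborel" "S \<in> sets lborel"
      by (auto elim: sets_completionE)
    have "AE x in lebesgue. x \<notin> N'"
      using A(3) by (intro AE_not_in) (simp add: null_sets_completionI)
    then have "set_lebesgue_integral lebesgue A f = set_lebesgue_integral lebesgue S f"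
      unfolding set_lebesgue_integral_def
    proof (intro integral_cong_AE)
      have "set_integrable lebesgue A f" "set_integrable lebesgue S f"
        using si \<open>A \<in> sets lebesgue\<close> A(4) by auto
      then show "(\<lambda>x. indicat_real A x *\<^sub>R f x) \<in> borel_measurable lebesgue"
        "(\<lambda>x. indicat_real S x *\<^sub>R f x) \<in> borel_measurable lebesgue"
        by (auto simp: set_integrable_def)
    qed (auto elim!: eventually_mono simp: A(1) indicator_def dest: subsetD[OF A(2)])
    then show "set_lebesgue_integral lebesgue A f = 0"
      using borel_zero[of S] A(4) by simp
  qed
  then have "{x. f x \<noteq> 0} \<in> null_sets lebesgue"
    by (simp add: completion.AE_iff_null_sets)
  moreover have "{x. f x \<noteq> 0} = {x \<in> {a..b}. h x \<noteq> 0}" by (auto simp: f_def)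
  ultimately show ?thesis by (simp add: negligible_iff_null_sets)
qed

section \<open>Calculus of test functions\<close>

definition smooth :: "(real \<Rightarrow> real) \<Rightarrow> bool" where
  "smooth f \<longleftrightarrow> (\<forall>n x. (deriv ^^ n) f differentiable (at x))"

lemma test_function_iff:
  "test_function a b \<phi> \<longleftrightarrow> smooth \<phi> \<and> (\<exists>c d. a < c \<and> d < b \<and> (\<forall>x. x \<notin> {c..d} \<longrightarrow> \<phi> x = 0))"
  by (simp add: test_function_def smooth_def)

lemma smooth_has_deriv: "smooth f \<Longrightarrow> (f has_real_derivative deriv f x) (at x)"
  unfolding smooth_def by (metis DERIV_deriv_iff_real_differentiable funpow_0)

lemma smooth_deriv: "smooth f \<Longrightarrow> smooth (deriv f)"
  unfolding smooth_def by (metis comp_apply funpow_Suc_right)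

lemma smoothI: "(\<And>x. (F has_real_derivative f x) (at x)) \<Longrightarrow> smooth f \<Longrightarrow> smooth F"
proof -
  assume F: "\<And>x. (F has_real_derivative f x) (at x)" and f: "smooth f"
  have [simp]: "deriv F = f" using F by (auto intro!: ext DERIV_imp_deriv)
  show "smooth F"
    unfolding smooth_def
  proof (intro allI)
    fix n x
    show "(deriv ^^ n) F differentiable (at x)"
    proof (cases n)
      case 0
      then show ?thesis using F by (auto simp: real_differentiable_def)
    next
      case (Suc m)
      then have "(deriv ^^ n) F = (deriv ^^ m) f"
        by (simp add: funpow_Suc_right del: funpow.simps)
      then show ?thesis using f by (simp add: smooth_def)
    qed
  qed
qed

lemma smooth_continuous: "smooth f \<Longrightarrow> continuous_on S f"
  using smooth_has_deriv DERIV_continuous_on has_field_derivative_at_within by metis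

lemma deriv_pow_combination:
  assumes "smooth f" "smooth g"
  shows "(deriv ^^ n) (\<lambda>x. f x - r * g x) = (\<lambda>x. (deriv ^^ n) f x - r * (deriv ^^ n) g x)"
proof (induction n)
  case (Suc n)
  have "deriv (\<lambda>x. (deriv ^^ n) f x - r * (deriv ^^ n) g x) x =
      deriv ((deriv ^^ n) f) x - r * deriv ((deriv ^^ n) g) x" for x
    by (rule DERIV_imp_deriv)
      (use assms in \<open>auto intro!: DERIV_diff DERIV_cmult simp: smooth_def DERIV_deriv_iff_real_differentiable\<close>)
  then show ?case using Suc by auto
qed simp

lemma smooth_combination:
  assumes "smooth f" "smooth g"
  shows "smooth (\<lambda>x. f x - r * g x)"
  unfolding smooth_def deriv_pow_combination[OF assms]
  using assms by (auto simp: smooth_def intro!: derivative_intros)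

lemma test_function_deriv:
  assumes "test_function a b \<phi>"
  shows "test_function a b (deriv \<phi>)"
proof -
  obtain c d where cd: "a < c" "d < b" "\<And>x. x \<notin> {c..d} \<Longrightarrow> \<phi> x = 0"
    using assms by (auto simp: test_function_iff)
  have "deriv \<phi> x = 0" if "x \<notin> {c..d}" for x
  proof (rule DERIV_imp_deriv)
    have "((\<lambda>x. 0) has_real_derivative 0) (at x)" by simp
    then show "(\<phi> has_real_derivative 0) (at x)"
      by (rule has_field_derivative_transform_within_open[of _ _ _ "- {c..d}"])
        (use that cd(3) in \<open>auto intro: open_Compl\<close>)
  qed
  then show ?thesis
    using assms cd smooth_deriv by (auto simp: test_function_iff)
qed

lemma test_function_combination:
  assumes "test_function a b \<phi>" "test_function a b \<psi>"
  shows "test_function a b (\<lambda>x. \<phi> x - r * \<psi> x)"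
proof -
  obtain c d c' d' where cd: "a < c" "d < b" "\<And>x. x \<notin> {c..d} \<Longrightarrow> \<phi> x = 0"
    "a < c'" "d' < b" "\<And>x. x \<notin> {c'..d'} \<Longrightarrow> \<psi> x = 0"
    using assms by (auto simp: test_function_iff)
  have "\<phi> x - r * \<psi> x = 0" if "x \<notin> {min c c'..max d d'}" for x
  proof -
    have "x \<notin> {c..d}" "x \<notin> {c'..d'}" using that by auto
    then show ?thesis using cd(3,6) by simp
  qed
  moreover have "a < min c c'" "max d d' < b"
    using cd by auto
  ultimately have "a < min c c'" "max d d' < b"
    "\<forall>x. x \<notin> {min c c'..max d d'} \<longrightarrow> \<phi> x - r * \<psi> x = 0"
    by blast+
  then show ?thesis
    using assms smooth_combination unfolding test_function_iff by blast
qed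

section \<open>The fundamental lemma and the du Bois-Reymond lemma\<close>

lemma absolutely_integrable_bilinear_continuous:
  fixes prod :: "'a::euclidean_space \<Rightarrow> 'b::euclidean_space \<Rightarrow> 'c::euclidean_space"
  assumes "bounded_bilinear prod" "continuous_on {a..b} f" "g absolutely_integrable_on {a..b}"
  shows "(\<lambda>x::real. prod (f x) (g x)) absolutely_integrable_on {a..b}"
proof (rule absolutely_integrable_bounded_measurable_product[where h = prod and f = f and g = g])
  show "bilinear prod" using assms(1) by (simp add: bilinear_conv_bounded_bilinear)
  show "f \<in> borel_measurable (lebesgue_on {a..b})"
    using assms(2) by (simp add: continuous_imp_measurable_on_sets_lebesgue)
  show "bounded (f ` {a..b})"
    using assms(2) by (intro compact_imp_bounded compact_continuous_image) auto
qed (use assms(3) in auto)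

text \<open>
  Integrals against test functions only see a compact subinterval. This turns Lebesgue integrals
  over the open interval, where a locally integrable function need not be integrable, into gauge
  integrals over \<open>{c..d}\<close>.
\<close>

lemma lint_supported:
  fixes h :: "real \<Rightarrow> 'a::euclidean_space"
  assumes "\<And>x. x \<notin> {c..d} \<Longrightarrow> h x = 0" "a < c" "d < b" "h absolutely_integrable_on {c..d}"
  shows "(LINT x|lebesgue_on {a<..<b}. h x) = integral {c..d} h"
    and "integrable (lebesgue_on {a<..<b}) h"
proof -
  have "h absolutely_integrable_on {a<..<b} \<longleftrightarrow> h absolutely_integrable_on {c..d}"
  proof (rule absolutely_integrable_spike_set_eq)
    have "{x \<in> {a<..<b} - {c..d}. h x \<noteq> 0} = {}" using assms(1) by auto
    then show "negligible {x \<in> {a<..<b} - {c..d}. h x \<noteq> 0}" by (metis negligible_empty)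
    have "{x \<in> {c..d} - {a<..<b}. h x \<noteq> 0} = {}" using assms by auto
    then show "negligible {x \<in> {c..d} - {a<..<b}. h x \<noteq> 0}" by (metis negligible_empty)
  qed
  then have ai: "h absolutely_integrable_on {a<..<b}" using assms by simp
  then show "integrable (lebesgue_on {a<..<b}) h"
    by (simp add: absolutely_integrable_imp_integrable)
  then have "(LINT x|lebesgue_on {a<..<b}. h x) = integral {a<..<b} h"
    by (simp add: lebesgue_integral_eq_integral)
  also have "\<dots> = integral {c..d} h"
  proof (rule integral_spike_set)
    have "{x \<in> {a<..<b} - {c..d}. h x \<noteq> 0} = {}" using assms(1) by auto
    then show "negligible {x \<in> {a<..<b} - {c..d}. h x \<noteq> 0}" by (metis negligible_empty)
    have "{x \<in> {c..d} - {a<..<b}. h x \<noteq> 0} = {}" using assms by auto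
    then show "negligible {x \<in> {c..d} - {a<..<b}. h x \<noteq> 0}" by (metis negligible_empty)
  qed
  finally show "(LINT x|lebesgue_on {a<..<b}. h x) = integral {c..d} h" .
qed

lemma locally_integrable_on_Icc:
  "locally_integrable_on a b f \<Longrightarrow> a < c \<Longrightarrow> d < b \<Longrightarrow> f absolutely_integrable_on {c..d}"
  by (simp add: locally_integrable_on_def absolutely_integrable_on_def integrable_on_lebesgue_on
      integrable_restrict_space set_integrable_def)

lemma lint_test:
  fixes h :: "real \<Rightarrow> 'a::euclidean_space"
  assumes "continuous_on {c..d} \<phi>" "\<And>x. x \<notin> {c..d} \<Longrightarrow> \<phi> x = 0" "a < c" "d < b"
    "h absolutely_integrable_on {c..d}"
  shows "(LINT x|lebesgue_on {a<..<b}. \<phi> x *\<^sub>R h x) = integral {c..d} (\<lambda>x. \<phi> x *\<^sub>R h x)"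
    and "integrable (lebesgue_on {a<..<b}) (\<lambda>x. \<phi> x *\<^sub>R h x)"
  by (rule lint_supported;
      use assms in \<open>auto intro: absolutely_integrable_bilinear_continuous[OF bounded_bilinear_scaleR]\<close>)+

lemma test_function_integrable:
  assumes "test_function a b \<phi>" "locally_integrable_on a b h"
  shows "integrable (lebesgue_on {a<..<b}) (\<lambda>x. \<phi> x *\<^sub>R h x)"
proof -
  obtain c d where cd: "a < c" "d < b" "\<And>x. x \<notin> {c..d} \<Longrightarrow> \<phi> x = 0"
    using assms by (auto simp: test_function_iff)
  show ?thesis
    by (rule lint_test(2)) (use cd assms in \<open>auto simp: test_function_iff
      intro: smooth_continuous locally_integrable_on_Icc\<close>)
qed

lemma bump_eq_0_outside: "x \<notin> {c..d} \<Longrightarrow> bump n c d x = 0"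
  by (rule bump_eq_0) auto

text \<open>
  The bumps for \<open>(c, d)\<close> are bounded by \<open>1\<close> and converge to its indicator function, so dominated
  convergence makes all integrals over \<open>{c..d}\<close> vanish. Countably many of these intervals, those with
  rational ends, cover \<open>(a, b)\<close>.
\<close>

lemma fundamental_lemma:
  fixes h :: "real \<Rightarrow> 'a::euclidean_space"
  assumes h: "locally_integrable_on a b h"
    and zero: "\<And>\<phi>. test_function a b \<phi> \<Longrightarrow> (LINT x|lebesgue_on {a<..<b}. \<phi> x *\<^sub>R h x) = 0"
  shows "ae_eq_on a b h (\<lambda>x. 0)"
proof -
  have I: "integral {c..d} h = 0" if "a < c" "c \<le> d" "d < b" for c d
  proof -
    have hI: "h absolutely_integrable_on {c..d}"
      using locally_integrable_on_Icc[OF h] that by auto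
    have ci: "continuous_on {c..d} (bump n c d)" for n
      using test_function_bump[of a c d b n] that by (auto simp: test_function_iff smooth_continuous)
    have e: "integral {c..d} (\<lambda>x. bump n c d x *\<^sub>R h x) = 0" for n
      using zero[OF test_function_bump[of a c d b n]] lint_test(1)[OF ci bump_eq_0_outside _ _ hI, of a b n] that
      by simp
    have "(\<lambda>n. integral {c..d} (\<lambda>x. bump n c d x *\<^sub>R h x)) \<longlonglongrightarrow>
        integral {c..d} (\<lambda>x. indicat_real {c<..<d} x *\<^sub>R h x)"
    proof (rule dominated_convergence(2))
      show "(\<lambda>x. bump n c d x *\<^sub>R h x) integrable_on {c..d}" for n
        using absolutely_integrable_bilinear_continuous[OF bounded_bilinear_scaleR ci hI]
        by (simp add: absolutely_integrable_on_def)
      show "(\<lambda>x. norm (h x)) integrable_on {c..d}"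
        using hI by (simp add: absolutely_integrable_on_def)
      show "norm (bump n c d x *\<^sub>R h x) \<le> norm (h x)" for n x
        using bump_bounds[of n c d x] by (simp add: mult_left_le_one_le)
      show "(\<lambda>n. bump n c d x *\<^sub>R h x) \<longlonglongrightarrow> indicat_real {c<..<d} x *\<^sub>R h x" for x
        by (intro tendsto_intros bump_tendsto_indicator)
    qed
    then have "integral {c..d} (\<lambda>x. indicat_real {c<..<d} x *\<^sub>R h x) = 0"
      unfolding e by (simp add: LIMSEQ_const_iff)
    moreover have "integral {c..d} (\<lambda>x. indicat_real {c<..<d} x *\<^sub>R h x) = integral {c..d} h"
      by (rule integral_spike[of "{c,d}"]) auto
    ultimately show ?thesis by simp
  qed
  have N: "negligible {x \<in> {c..d}. h x \<noteq> 0}" if "a < c" "d < b" for c d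
    by (rule integral_zero_imp_ae_zero) (use that I locally_integrable_on_Icc[OF h] in auto)
  let ?\<F> = "\<Union>c\<in>\<rat>. \<Union>d\<in>\<rat>. (if a < c \<and> d < b then {{x \<in> {c..d}. h x \<noteq> 0}} else {})"
  have "negligible (\<Union>?\<F>)"
  proof (rule negligible_countable_Union)
    show "countable ?\<F>" by (intro countable_UN countable_rat) auto
    show "negligible S" if "S \<in> ?\<F>" for S
      using that N by (auto split: if_splits simp del: atLeastAtMost_iff)
  qed
  moreover have "{x \<in> {a<..<b}. h x \<noteq> 0} \<subseteq> \<Union>?\<F>"
  proof
    fix x assume x: "x \<in> {x \<in> {a<..<b}. h x \<noteq> 0}"
    then obtain c d where "c \<in> \<rat>" "a < c" "c < x" "d \<in> \<rat>" "x < d" "d < b"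
      using Rats_dense_in_real[of a x] Rats_dense_in_real[of x b] by auto
    moreover from this have "{x \<in> {c..d}. h x \<noteq> 0} \<in> ?\<F>"
      by (intro UN_I[of c] UN_I[of d]) (auto simp del: atLeastAtMost_iff)
    ultimately show "x \<in> \<Union>?\<F>" using x
      by (intro UnionI[of "{x \<in> {c..d}. h x \<noteq> 0}"]) auto
  qed
  ultimately show ?thesis
    unfolding ae_eq_on_iff_negligible using negligible_subset by blast
qed

text \<open>
  Fix one bump \<open>\<eta>\<close> with integral \<open>I \<noteq> 0\<close>. A test function \<open>\<psi>\<close> minus the multiple of \<open>\<eta>\<close> with the
  same integral has a test function as antiderivative, so \<open>f\<close> is orthogonal to it. Hence
  \<open>\<integral> \<psi> f = k \<integral> \<psi>\<close> with \<open>k\<close> the weighted mean of \<open>f\<close>, and the fundamental lemma applies to \<open>f - k\<close>.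
\<close>

lemma du_Bois_Reymond:
  fixes f :: "real \<Rightarrow> 'a::euclidean_space"
  assumes ab: "a < b" and f: "locally_integrable_on a b f"
    and zero: "\<And>\<phi>. test_function a b \<phi> \<Longrightarrow> (LINT x|lebesgue_on {a<..<b}. deriv \<phi> x *\<^sub>R f x) = 0"
  obtains k where "ae_eq_on a b f (\<lambda>x. k)"
proof -
  obtain c0 d0 where cd0: "a < c0" "c0 < d0" "d0 < b" using ab dense by meson
  define \<eta> where "\<eta> = bump 0 c0 d0"
  have \<eta>: "test_function a b \<eta>" "continuous_on S \<eta>" for S
    using test_function_bump[of a c0 d0 b] cd0 by (auto simp: \<eta>_def test_function_iff smooth_continuous)
  define I where "I = integral {a..b} \<eta>"
  have "I \<noteq> 0"
  proof
    assume "I = 0"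
    then have "\<eta> ((c0+d0)/2) = 0"
      using integral_eq_0_iff[of a b \<eta>] cd0 \<eta>(2)[of "{a..b}"] bump_bounds(1)
      by (auto simp: I_def \<eta>_def)
    then show False using bump_pos[of c0 "(c0+d0)/2" d0 0] cd0 by (simp add: \<eta>_def)
  qed
  define k where "k = (1 / I) *\<^sub>R (LINT x|lebesgue_on {a<..<b}. \<eta> x *\<^sub>R f x)"
  have loc_const: "locally_integrable_on a b (\<lambda>x. k)"
    by (simp add: locally_integrable_on_def finite_measure.integrable_const finite_measure_lebesgue_on)
  have loc: "locally_integrable_on a b (\<lambda>x. f x - k)"
    using f loc_const by (auto simp: locally_integrable_on_def)
  have "ae_eq_on a b (\<lambda>x. f x - k) (\<lambda>x. 0)"
  proof (rule fundamental_lemma[OF loc])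
    fix \<psi> assume \<psi>: "test_function a b \<psi>"
    define J where "J = integral {a..b} \<psi>"
    define r where "r = J / I"
    define \<omega> where "\<omega> = (\<lambda>x. \<psi> x - r * \<eta> x)"
    have \<omega>: "test_function a b \<omega>" unfolding \<omega>_def using test_function_combination[OF \<psi> \<eta>(1)] .
    then obtain c d where cd: "a < c" "d < b" "\<And>x. x \<notin> {c..d} \<Longrightarrow> \<omega> x = 0"
      by (auto simp: test_function_iff)
    have cont: "continuous_on S \<omega>" "continuous_on S \<psi>" for S
      using \<omega> \<psi> by (auto simp: test_function_iff smooth_continuous)
    have int\<omega>: "integral {a..b} \<omega> = 0"
      unfolding \<omega>_def using \<open>I \<noteq> 0\<close> \<eta> cont
      by (subst integral_diff) (auto intro!: integrable_continuous_real continuous_intros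
        simp: r_def I_def[symmetric] J_def[symmetric])
    obtain F where F: "\<And>x. (F has_vector_derivative \<omega> x) (at x)"
      using einterval_antiderivative[of "-\<infinity>" "\<infinity>" \<omega>] cont[of UNIV]
      by (auto simp: continuous_on_eq_continuous_at)
    define \<phi> where "\<phi> = (\<lambda>x. F x - F a)"
    have \<phi>d: "(\<phi> has_real_derivative \<omega> x) (at x)" for x
      unfolding \<phi>_def using F[of x]
      by (auto intro!: derivative_eq_intros simp: has_real_derivative_iff_has_vector_derivative)
    have ftc: "integral {s..t} \<omega> = F t - F s" if "s \<le> t" for s t
      by (rule integral_unique, rule fundamental_theorem_of_calculus[OF that])
        (auto intro: has_vector_derivative_at_within F)
    \<comment> \<open>Left of \<open>c\<close> nothing has been accumulated; right of \<open>d\<close> the total integral of \<open>\<omega>\<close>, which is \<open>0\<close>.\<close>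
    have \<phi>0: "\<phi> x = 0" if "x \<notin> {c..d}" for x
    proof (cases "x < c")
      case True
      have "integral {min x a..max x a} \<omega> = integral {min x a..max x a} (\<lambda>x. 0)"
        by (rule integral_cong) (use True cd(1) in \<open>auto intro!: cd(3)\<close>)
      then show ?thesis using ftc[of "min x a" "max x a"] by (auto simp: \<phi>_def min_def max_def split: if_splits)
    next
      case False
      then have "d < x" using that by auto
      have "integral {min x b..max x b} \<omega> = integral {min x b..max x b} (\<lambda>x. 0)"
        by (rule integral_cong) (use \<open>d < x\<close> cd(2) in \<open>auto intro!: cd(3)\<close>)
      then have "F x = F b" using ftc[of "min x b" "max x b"] by (auto simp: min_def max_def split: if_splits)
      also have "F b = F a" using ftc[of a b] int\<omega> ab by simp
      finally show ?thesis by (simp add: \<phi>_def)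
    qed
    have "test_function a b \<phi>"
      using smoothI[OF \<phi>d] \<omega> cd(1,2) \<phi>0 by (auto simp: test_function_iff)
    moreover have "deriv \<phi> = \<omega>" using \<phi>d by (auto intro!: ext DERIV_imp_deriv)
    ultimately have 0: "(LINT x|lebesgue_on {a<..<b}. \<omega> x *\<^sub>R f x) = 0" using zero by metis
    note i = test_function_integrable
    have split: "(LINT x|lebesgue_on {a<..<b}. \<omega> x *\<^sub>R f x) =
      (LINT x|lebesgue_on {a<..<b}. \<psi> x *\<^sub>R f x) - r *\<^sub>R (LINT x|lebesgue_on {a<..<b}. \<eta> x *\<^sub>R f x)"
      using i[OF \<psi> f] i[OF \<eta>(1) f] by (simp add: \<omega>_def algebra_simps flip: scaleR_scaleR)
    have "(LINT x|lebesgue_on {a<..<b}. \<psi> x *\<^sub>R k) = J *\<^sub>R k"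
    proof -
      obtain c d where cd: "a < c" "d < b" "\<And>x. x \<notin> {c..d} \<Longrightarrow> \<psi> x = 0"
        using \<psi> by (auto simp: test_function_iff)
      have "(LINT x|lebesgue_on {a<..<b}. \<psi> x) = integral {a<..<b} \<psi>"
        by (rule lebesgue_integral_eq_integral)
          (use i[OF \<psi>, of "\<lambda>x. 1::real"] in \<open>auto simp: locally_integrable_on_def finite_measure.integrable_const finite_measure_lebesgue_on\<close>)
      also have "\<dots> = J" by (simp add: J_def integral_open_interval_real)
      finally show ?thesis
        using i[OF \<psi>, of "\<lambda>x. 1::real"]
        by (subst integral_scaleR_left) (auto simp: locally_integrable_on_def finite_measure.integrable_const finite_measure_lebesgue_on)
    qed
    then show "(LINT x|lebesgue_on {a<..<b}. \<psi> x *\<^sub>R (f x - k)) = 0"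
      using i[OF \<psi> f] i[OF \<psi> loc_const] 0 split \<open>I \<noteq> 0\<close>
      by (simp add: scaleR_diff_right k_def r_def)
  qed
  then have "ae_eq_on a b f (\<lambda>x. k)" by (simp add: ae_eq_on_def)
  then show thesis by (rule that)
qed

section \<open>Absolutely continuous functions\<close>

definition has_deriv_on :: "real \<Rightarrow> real \<Rightarrow> (real \<Rightarrow> 'a::euclidean_space) \<Rightarrow> (real \<Rightarrow> 'a) \<Rightarrow> bool" where
  "has_deriv_on a b f f' \<longleftrightarrow> (\<forall>x\<in>{a..b}. (f has_vector_derivative f' x) (at x within {a..b}))"

text \<open>
  \<open>F\<close> is an indefinite integral of \<open>f\<close>. This characterization of absolute continuity is what the
  du Bois-Reymond lemma yields.
\<close>

definition ac_on :: "real \<Rightarrow> real \<Rightarrow> (real \<Rightarrow> 'a::euclidean_space) \<Rightarrow> (real \<Rightarrow> 'a) \<Rightarrow> bool" where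
  "ac_on a b F f \<longleftrightarrow> f absolutely_integrable_on {a..b} \<and> (\<forall>x\<in>{a..b}. F x = F a + integral {a..x} f)"

lemma has_deriv_on_continuous: "has_deriv_on a b f f' \<Longrightarrow> continuous_on {a..b} f"
  unfolding has_deriv_on_def continuous_on_eq_continuous_within
  using has_vector_derivative_continuous by blast

lemma ac_on_integrable: "ac_on a b F f \<Longrightarrow> f absolutely_integrable_on {a..b}"
  by (simp add: ac_on_def)

lemma ac_onD: "ac_on a b F f \<Longrightarrow> x \<in> {a..b} \<Longrightarrow> F x = F a + integral {a..x} f"
  unfolding ac_on_def by blast

lemma ac_on_integrable_sub:
  assumes "ac_on a b F f" "{c..d} \<subseteq> {a..b}" shows "f integrable_on {c..d}"
proof -
  have "f integrable_on {a..b}" using assms(1) by (simp add: ac_on_def absolutely_integrable_on_def)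
  then show ?thesis using assms(2) by (rule integrable_on_subinterval)
qed

lemma ac_on_continuous:
  assumes "ac_on a b F f" shows "continuous_on {a..b} F"
proof -
  have "continuous_on {a..b} (\<lambda>x. F a + integral {a..x} f)"
    using assms by (intro continuous_intros indefinite_integral_continuous_1)
      (auto simp: ac_on_def absolutely_integrable_on_def)
  then show ?thesis by (rule continuous_on_eq) (simp add: ac_onD[OF assms, symmetric])
qed

lemma ac_on_C1:
  assumes "has_deriv_on a b F f" "continuous_on {a..b} f"
  shows "ac_on a b F f"
  unfolding ac_on_def
proof (intro conjI ballI)
  show "f absolutely_integrable_on {a..b}" by (rule absolutely_integrable_continuous_real) fact
  fix x assume x: "x \<in> {a..b}"
  have "(f has_integral (F x - F a)) {a..x}"
  proof (rule fundamental_theorem_of_calculus)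
    fix y assume "y \<in> {a..x}"
    then have "y \<in> {a..b}" using x by auto
    then have "(F has_vector_derivative f y) (at y within {a..b})"
      using assms(1) by (simp add: has_deriv_on_def)
    then show "(F has_vector_derivative f y) (at y within {a..x})"
      by (rule has_vector_derivative_within_subset) (use x in auto)
  qed (use x in auto)
  then show "F x = F a + integral {a..x} f" by (simp add: integral_unique)
qed

lemma ac_on_deriv:
  assumes "ac_on a b F f" "continuous_on {a..b} f"
  shows "has_deriv_on a b F f"
  unfolding has_deriv_on_def
proof
  fix x assume x: "x \<in> {a..b}"
  have "((\<lambda>x. F a + integral {a..x} f) has_vector_derivative 0 + f x) (at x within {a..b})"
    using integral_has_vector_derivative[OF assms(2) x] by (intro derivative_intros)
  then have "((\<lambda>x. F a + integral {a..x} f) has_vector_derivative f x) (at x within {a..b})" by simp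
  then show "(F has_vector_derivative f x) (at x within {a..b})"
    by (rule has_vector_derivative_transform[OF x, rotated]) (erule ac_onD[OF assms(1)])
qed

lemma ac_on_diff_integral:
  assumes "ac_on a b F f" "x \<in> {a..b}" "y \<in> {a..b}" "x \<le> y"
  shows "F y - F x = integral {x..y} f"
proof -
  have "f integrable_on {a..y}"
    using assms by (intro ac_on_integrable_sub) auto
  then have "integral {a..x} f + integral {x..y} f = integral {a..y} f"
    using assms by (intro Henstock_Kurzweil_Integration.integral_combine) auto
  then show ?thesis
    unfolding ac_onD[OF assms(1,2)] ac_onD[OF assms(1,3)] by (simp add: algebra_simps)
qed

lemma ac_on_cong:
  assumes "ac_on a b F f" "\<And>x. x \<in> {a..b} \<Longrightarrow> F x = G x" "ae_eq_on a b f g"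
  shows "ac_on a b G g"
proof (cases "a \<le> b")
  case True
  have N: "negligible ({x \<in> {a<..<b}. f x \<noteq> g x} \<union> {a, b})"
    using assms(3) by (simp add: ae_eq_on_iff_negligible negligible_Un)
  have gi: "g absolutely_integrable_on {a..b}"
    by (rule absolutely_integrable_spike[OF ac_on_integrable[OF assms(1)] N]) auto
  have "integral {a..x} g = integral {a..x} f" if "x \<in> {a..b}" for x
    by (rule integral_spike[OF N]) (use that in auto)
  then have "G x = G a + integral {a..x} g" if "x \<in> {a..b}" for x
    using ac_onD[OF assms(1) that] assms(2)[OF that] assms(2)[of a] True that by simp
  then show ?thesis using gi unfolding ac_on_def by blast
qed (auto simp: ac_on_def)

lemma ac_on_linear:
  assumes "ac_on a b F f" "bounded_linear h"
  shows "ac_on a b (\<lambda>x. h (F x)) (\<lambda>x. h (f x))"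
proof -
  interpret bounded_linear h by fact
  show ?thesis
    unfolding ac_on_def
  proof (intro conjI ballI)
    show "(\<lambda>x. h (f x)) absolutely_integrable_on {a..b}"
      using absolutely_integrable_linear[OF ac_on_integrable[OF assms(1)] assms(2)] by (simp add: o_def)
    fix x assume x: "x \<in> {a..b}"
    have i: "f integrable_on {a..x}" using assms x by (intro ac_on_integrable_sub) auto
    show "h (F x) = h (F a) + integral {a..x} (\<lambda>x. h (f x))"
      using integral_linear[OF i assms(2)] unfolding ac_onD[OF assms(1) x] by (simp add: o_def add)
  qed
qed

lemma ac_on_add:
  assumes "ac_on a b F f" "ac_on a b G g"
  shows "ac_on a b (\<lambda>x. F x + G x) (\<lambda>x. f x + g x)"
proof -
  have i: "f integrable_on {a..x}" "g integrable_on {a..x}" if "x \<in> {a..b}" for x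
    using assms[THEN ac_on_integrable_sub] that by auto
  show ?thesis unfolding ac_on_def
  proof (intro conjI ballI)
    show "(\<lambda>x. f x + g x) absolutely_integrable_on {a..b}"
      using assms[THEN ac_on_integrable] by (rule set_integral_add)
    fix x assume x: "x \<in> {a..b}"
    show "F x + G x = F a + G a + integral {a..x} (\<lambda>x. f x + g x)"
      unfolding ac_onD[OF assms(1) x] ac_onD[OF assms(2) x]
      using i[OF x] by (simp add: integral_add)
  qed
qed

lemma ac_on_diff:
  assumes "ac_on a b F f" "ac_on a b G g"
  shows "ac_on a b (\<lambda>x. F x - G x) (\<lambda>x. f x - g x)"
  using ac_on_add[OF assms(1) ac_on_linear[OF assms(2) bounded_linear_minus[OF bounded_linear_ident]]]
  by simp

text \<open>
  The product rule with one factor \<open>P\<close> of class \<open>C\<^sup>1\<close> and one absolutely continuous factor \<open>G\<close>. The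
  difference \<open>H\<close> of both sides satisfies \<open>\<bar>H y - H x\<bar> \<le> C \<bar>y - x\<bar> \<bar>N y - N x\<bar>\<close>, where \<open>N\<close> is the indefinite
  integral of \<open>\<bar>g\<bar>\<close>. As \<open>N\<close> is continuous, \<open>H\<close> has derivative \<open>0\<close> everywhere, although \<open>G\<close> itself need
  not be differentiable at any given point.
\<close>

lemma ac_on_prod:
  fixes prod :: "'a::euclidean_space \<Rightarrow> 'b::euclidean_space \<Rightarrow> 'c::euclidean_space"
  assumes bl: "bounded_bilinear prod"
    and d: "has_deriv_on a b P p" and p: "continuous_on {a..b} p" and G: "ac_on a b G g"
  shows "ac_on a b (\<lambda>x. prod (P x) (G x)) (\<lambda>x. prod (p x) (G x) + prod (P x) (g x))"
proof -
  interpret bounded_bilinear prod by fact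
  let ?h = "\<lambda>x. prod (p x) (G x) + prod (P x) (g x)"
  have cP: "continuous_on {a..b} P" by (rule has_deriv_on_continuous[OF d])
  have cG: "continuous_on {a..b} G" by (rule ac_on_continuous[OF G])
  have gi: "g absolutely_integrable_on {a..b}" using G by (simp add: ac_on_def)
  have i1: "(\<lambda>x. prod (p x) (G x)) absolutely_integrable_on {a..b}"
    by (intro absolutely_integrable_continuous_real continuous_on p cG)
  have i2: "(\<lambda>x. prod (P x) (g x)) absolutely_integrable_on {a..b}"
    by (rule absolutely_integrable_bilinear_continuous[OF bl cP gi])
  have hi: "?h absolutely_integrable_on {a..b}" by (rule set_integral_add(1)[OF i1 i2])
  define H where "H = (\<lambda>x. prod (P x) (G x) - integral {a..x} ?h)"
  define N where "N = (\<lambda>x. integral {a..x} (\<lambda>t. norm (g t)))"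
  have ni: "(\<lambda>t. norm (g t)) integrable_on {a..b}"
    using gi by (simp add: absolutely_integrable_on_def)
  have cN: "continuous_on {a..b} N" unfolding N_def by (rule indefinite_integral_continuous_1[OF ni])
  obtain K where K: "K \<ge> 0" "\<And>x y. norm (prod x y) \<le> norm x * norm y * K"
    using nonneg_bounded by blast
  have "bounded (p ` {a..b})"
    using p by (intro compact_imp_bounded compact_continuous_image) auto
  then obtain L where "\<forall>y\<in>p ` {a..b}. norm y \<le> L" unfolding bounded_iff by blast
  then have L: "norm (p x) \<le> L" if "x \<in> {a..b}" for x using that by blast
  have est: "norm (H y - H x) \<le> 2 * K * L * (y - x) * (N y - N x)"
    if xy: "x \<in> {a..b}" "y \<in> {a..b}" "x \<le> y" for x y
  proof -
    have sub: "{x..y} \<subseteq> {a..b}" using xy by auto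
    have L0: "0 \<le> L" using L[OF xy(1)] norm_ge_zero order_trans by blast
    have ab: "s \<in> {a..b}" if "s \<in> {x..y}" for s using that sub by auto
    have ii: "g integrable_on {x..y}" "p integrable_on {x..y}" "(\<lambda>t. norm (g t)) integrable_on {x..y}"
      "(\<lambda>t. prod (p t) (G t)) integrable_on {x..y}" "(\<lambda>t. prod (P t) (g t)) integrable_on {x..y}"
      "?h integrable_on {x..y}"
      using gi integrable_continuous_real[OF p] ni i1 i2 hi sub
      by (auto simp: absolutely_integrable_on_def intro: integrable_on_subinterval)
    have hN: "N y - N x = integral {x..y} (\<lambda>t. norm (g t))"
    proof -
      have "(\<lambda>t. norm (g t)) integrable_on {a..y}" using ni xy by (auto intro: integrable_on_subinterval)
      then have "N x + integral {x..y} (\<lambda>t. norm (g t)) = N y"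
        unfolding N_def using xy by (intro Henstock_Kurzweil_Integration.integral_combine) auto
      then show ?thesis by simp
    qed
    have hH: "integral {a..y} ?h - integral {a..x} ?h = integral {x..y} ?h"
    proof -
      have "?h integrable_on {a..y}"
        using hi xy by (auto simp: absolutely_integrable_on_def intro: integrable_on_subinterval)
      then have "integral {a..x} ?h + integral {x..y} ?h = integral {a..y} ?h"
        using xy by (intro Henstock_Kurzweil_Integration.integral_combine) auto
      then show ?thesis by (simp add: algebra_simps)
    qed
    have Pd: "P t - P s = integral {s..t} p" if "s \<in> {a..b}" "t \<in> {a..b}" "s \<le> t" for s t
      by (rule ac_on_diff_integral[OF ac_on_C1[OF d p] that])
    have Gd: "G t - G s = integral {s..t} g" if "s \<in> {a..b}" "t \<in> {a..b}" "s \<le> t" for s t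
      by (rule ac_on_diff_integral[OF G that])
    have e1: "prod (P y) (G y - G x) = integral {x..y} (\<lambda>t. prod (P y) (g t))"
      unfolding Gd[OF xy]
      using integral_linear[OF ii(1) bounded_linear_right, of "P y"] by (simp add: o_def)
    have e2: "prod (P y - P x) (G x) = integral {x..y} (\<lambda>t. prod (p t) (G x))"
      unfolding Pd[OF xy]
      using integral_linear[OF ii(2) bounded_linear_left, of "G x"] by (simp add: o_def)
    have j1: "(\<lambda>t. prod (P y) (g t)) integrable_on {x..y}"
      using integrable_linear[OF ii(1) bounded_linear_right, of "P y"] by (simp add: o_def)
    have j2: "(\<lambda>t. prod (p t) (G x)) integrable_on {x..y}"
      using integrable_linear[OF ii(2) bounded_linear_left, of "G x"] by (simp add: o_def)
    \<comment> \<open>Writing both increments as integrals leaves under the integral sign only products of two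
      differences over \<open>{x..y}\<close> or of a difference with \<open>g\<close>.\<close>
    have "H y - H x = prod (P y) (G y - G x) + prod (P y - P x) (G x) - integral {x..y} ?h"
      unfolding H_def using hH by (simp add: algebra_simps diff_left diff_right)
    also have "\<dots> = integral {x..y} (\<lambda>t. prod (P y) (g t) + prod (p t) (G x) - ?h t)"
      unfolding e1 e2 by (subst integral_diff, use j1 j2 ii in \<open>auto intro!: integrable_add\<close>)
        (subst integral_add, use j1 j2 in auto)
    also have "\<dots> = integral {x..y} (\<lambda>t. prod (P y - P t) (g t) + prod (p t) (G x - G t))"
      by (rule integral_cong) (simp add: diff_left diff_right)
    also have "norm \<dots> \<le> integral {x..y} (\<lambda>t. (K * L * (y - x)) * norm (g t) + K * L * (N y - N x))"
    proof (rule integral_norm_bound_integral)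
      have "(\<lambda>t. prod (P y) (g t) + prod (p t) (G x) - ?h t) integrable_on {x..y}"
        using j1 j2 ii by (auto intro!: integrable_add integrable_diff)
      then show "(\<lambda>t. prod (P y - P t) (g t) + prod (p t) (G x - G t)) integrable_on {x..y}"
        by (rule integrable_eq) (simp add: diff_left diff_right)
      show "(\<lambda>t. K * L * (y - x) * norm (g t) + K * L * (N y - N x)) integrable_on {x..y}"
        using integrable_cmul[OF ii(3), of "K * L * (y - x)"] by (intro integrable_add integrable_const_ivl) simp_all
      fix t assume t: "t \<in> {x..y}"
      have 1: "norm (P y - P t) \<le> L * (y - x)"
      proof -
        have "P y - P t = integral {t..y} p" using Pd[OF ab[OF t] xy(2)] t by simp
        also have "norm \<dots> \<le> integral {t..y} (\<lambda>_. L)"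
        proof (rule integral_norm_bound_integral)
          show "p integrable_on {t..y}" using t by (intro integrable_on_subinterval[OF ii(2)]) auto
          show "norm (p s) \<le> L" if "s \<in> {t..y}" for s using that t xy L by simp
        qed auto
        also have "\<dots> = L * (y - t)" using t by simp
        also have "\<dots> \<le> L * (y - x)" using t L0 by (intro mult_left_mono) auto
        finally show ?thesis .
      qed
      have 2: "norm (G x - G t) \<le> N y - N x"
      proof -
        have "norm (G t - G x) \<le> integral {x..t} (\<lambda>t. norm (g t))"
          using t xy by (subst Gd) (auto intro!: integral_norm_bound_integral
            integrable_on_subinterval[OF ii(1)] integrable_on_subinterval[OF ii(3)])
        also have "\<dots> \<le> integral {x..y} (\<lambda>t. norm (g t))"
          using t ii by (intro integral_subset_le) (auto intro: integrable_on_subinterval[OF ii(3)])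
        finally show ?thesis using hN by (simp add: norm_minus_commute)
      qed
      have "norm (prod (P y - P t) (g t)) \<le> (L * (y - x)) * norm (g t) * K"
        using K(2)[of "P y - P t" "g t"] mult_right_mono[OF mult_right_mono[OF 1 norm_ge_zero] K(1)]
        by (rule order_trans)
      moreover have "norm (prod (p t) (G x - G t)) \<le> L * (N y - N x) * K"
        using K(2)[of "p t" "G x - G t"]
          mult_right_mono[OF mult_mono[OF L[OF ab[OF t]] 2 L0 norm_ge_zero] K(1)]
        by (rule order_trans)
      ultimately show "norm (prod (P y - P t) (g t) + prod (p t) (G x - G t))
          \<le> K * L * (y - x) * norm (g t) + K * L * (N y - N x)"
        by (intro norm_triangle_le) (simp add: algebra_simps)
    qed
    also have "\<dots> = 2 * K * L * (y - x) * (N y - N x)"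
          proof -
      have "(\<lambda>t. K * L * (y - x) * norm (g t)) integrable_on {x..y}"
        using integrable_cmul[OF ii(3), of "K * L * (y - x)"] by simp
      then show ?thesis
        using xy by (subst integral_add) (simp_all add: hN integrable_const_ivl mult_ac)
    qed
    finally show ?thesis .
  qed
  have mono: "N x \<le> N y" if "x \<in> {a..b}" "y \<in> {a..b}" "x \<le> y" for x y
    unfolding N_def using that
    by (intro integral_subset_le) (auto intro: integrable_on_subinterval[OF ni])
  have est': "norm (H y - H x) \<le> 2 * K * L * \<bar>N y - N x\<bar> * \<bar>y - x\<bar>"
    if xy: "x \<in> {a..b}" "y \<in> {a..b}" for x y
    using est[of x y] est[of y x] mono[of x y] mono[of y x] xy
  proof (cases "x \<le> y")
    case True
    then have "\<bar>N y - N x\<bar> = N y - N x" "\<bar>y - x\<bar> = y - x" using mono[OF xy] by auto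
    then show ?thesis using est[OF xy True] by (simp add: algebra_simps)
  next
    case False
    then have "\<bar>N y - N x\<bar> = N x - N y" "\<bar>y - x\<bar> = x - y" using mono[OF xy(2,1)] by auto
    then show ?thesis using est[OF xy(2,1)] False
      by (subst norm_minus_commute) (simp add: algebra_simps)
  qed
  have "(H has_derivative (\<lambda>h. 0)) (at x within {a..b})" if x: "x \<in> {a..b}" for x
    unfolding has_derivative_within_alt
  proof (intro conjI allI impI)
    fix e :: real assume e: "0 < e"
    have "continuous (at x within {a..b}) (\<lambda>y. 2 * K * L * \<bar>N y - N x\<bar>)"
      using cN x by (intro continuous_intros) (auto simp: continuous_on_eq_continuous_within)
    then obtain r where r: "r > 0" "\<And>y. y \<in> {a..b} \<Longrightarrow> dist y x < r \<Longrightarrow>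
        dist (2 * K * L * \<bar>N y - N x\<bar>) (2 * K * L * \<bar>N x - N x\<bar>) < e"
      using e unfolding continuous_within_eps_delta by blast
    show "\<exists>d>0. \<forall>y\<in>{a..b}. norm (y - x) < d \<longrightarrow> norm (H y - H x - 0) \<le> e * norm (y - x)"
    proof (intro exI[of _ r] conjI ballI impI r)
      fix y assume y: "y \<in> {a..b}" "norm (y - x) < r"
      have "2 * K * L * \<bar>N y - N x\<bar> \<le> e" using r(2)[OF y(1)] y(2) by (auto simp: dist_norm)
      then show "norm (H y - H x - 0) \<le> e * norm (y - x)"
        using est'[OF x y(1)] mult_right_mono[of "2 * K * L * \<bar>N y - N x\<bar>" e "\<bar>y - x\<bar>"] by auto
    qed
  qed auto
  then obtain c where c: "\<And>x. x \<in> {a..b} \<Longrightarrow> H x = c"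
    using has_derivative_zero_constant[of "{a..b}" H] by auto
  show ?thesis
    unfolding ac_on_def
  proof (intro conjI ballI)
    show "?h absolutely_integrable_on {a..b}" by (rule hi)
    fix x assume x: "x \<in> {a..b}"
    then have "H x = H a" using c by auto
    then show "prod (P x) (G x) = prod (P a) (G a) + integral {a..x} ?h" by (simp add: H_def algebra_simps)
  qed
qed

section \<open>Weak derivatives\<close>

lemma ae_eq_on_refl [simp]: "ae_eq_on a b f f" by (simp add: ae_eq_on_def)
lemma ae_eq_on_sym: assumes "ae_eq_on a b f g" shows "ae_eq_on a b g f"
  using assms unfolding ae_eq_on_def by eventually_elim simp
lemma ae_eq_on_trans [trans]:
  assumes "ae_eq_on a b f g" "ae_eq_on a b g h" shows "ae_eq_on a b f h"
  using assms unfolding ae_eq_on_def by eventually_elim simp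
lemma ae_eq_on_map:
  assumes "ae_eq_on a b f g" shows "ae_eq_on a b (\<lambda>x. H x (f x)) (\<lambda>x. H x (g x))"
  using assms unfolding ae_eq_on_def by eventually_elim simp
lemma ae_eq_on_map2:
  assumes "ae_eq_on a b f g" "ae_eq_on a b f' g'"
  shows "ae_eq_on a b (\<lambda>x. H x (f x) (f' x)) (\<lambda>x. H x (g x) (g' x))"
  using assms unfolding ae_eq_on_def by eventually_elim simp
lemma ae_eq_onI: "(\<And>x. x \<in> {a<..<b} \<Longrightarrow> f x = g x) \<Longrightarrow> ae_eq_on a b f g"
  unfolding ae_eq_on_def by (rule AE_I2) simp

lemma absolutely_integrable_on_iff_lebesgue_on:
  fixes f :: "real \<Rightarrow> 'a::euclidean_space"
  shows "f absolutely_integrable_on {c..d} \<longleftrightarrow> integrable (lebesgue_on {c..d}) f"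
  by (simp add: integrable_restrict_space set_integrable_def)

lemma absolutely_integrable_on_iff_lebesgue_on_open:
  fixes f :: "real \<Rightarrow> 'a::euclidean_space"
  shows "f absolutely_integrable_on {c..d} \<longleftrightarrow> integrable (lebesgue_on {c<..<d}) f"
  unfolding absolutely_integrable_on_Icc_iff_Ioo
  by (simp add: integrable_restrict_space set_integrable_def)

lemma absolutely_integrable_imp_locally:
  "f absolutely_integrable_on {a..b} \<Longrightarrow> locally_integrable_on a b f"
  unfolding locally_integrable_on_def
proof (intro allI impI)
  fix c d assume f: "f absolutely_integrable_on {a..b}" and cd: "a < c \<and> d < b"
  have "f absolutely_integrable_on {c..d}"
    by (rule absolutely_integrable_on_subinterval[OF f]) (use cd in auto)
  then show "integrable (lebesgue_on {c..d}) f" by (simp add: absolutely_integrable_on_iff_lebesgue_on)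
qed

lemma locally_integrable_on_cong:
  assumes "locally_integrable_on a b f" "ae_eq_on a b f g"
  shows "locally_integrable_on a b g"
  unfolding locally_integrable_on_def
proof (intro allI impI)
  fix c d assume cd: "a < c \<and> d < b"
  have "f absolutely_integrable_on {c..d}"
    using assms(1) cd by (simp add: locally_integrable_on_Icc)
  then have "g absolutely_integrable_on {c..d}"
    by (rule absolutely_integrable_spike[OF _ assms(2)[unfolded ae_eq_on_iff_negligible]]) (use cd in auto)
  then show "integrable (lebesgue_on {c..d}) g" by (simp add: absolutely_integrable_on_iff_lebesgue_on)
qed

lemma locally_integrable_on_diff:
  "locally_integrable_on a b f \<Longrightarrow> locally_integrable_on a b g \<Longrightarrow> locally_integrable_on a b (\<lambda>x. f x - g x)"
  by (simp add: locally_integrable_on_def)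

lemma lint_test_cong:
  fixes f g :: "real \<Rightarrow> 'a::euclidean_space"
  assumes "ae_eq_on a b f g" "test_function a b \<phi>" "locally_integrable_on a b f"
  shows "(LINT x|lebesgue_on {a<..<b}. \<phi> x *\<^sub>R f x) = (LINT x|lebesgue_on {a<..<b}. \<phi> x *\<^sub>R g x)"
proof (rule integral_cong_AE)
  show "(\<lambda>x. \<phi> x *\<^sub>R f x) \<in> borel_measurable (lebesgue_on {a<..<b})"
    "(\<lambda>x. \<phi> x *\<^sub>R g x) \<in> borel_measurable (lebesgue_on {a<..<b})"
    using test_function_integrable[OF assms(2,3)]
      test_function_integrable[OF assms(2) locally_integrable_on_cong[OF assms(3,1)]] by auto
  show "AE x in lebesgue_on {a<..<b}. \<phi> x *\<^sub>R f x = \<phi> x *\<^sub>R g x"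
    using assms(1) unfolding ae_eq_on_def by eventually_elim simp
qed

lemma test_function_deriv_pow: "test_function a b \<phi> \<Longrightarrow> test_function a b ((deriv ^^ n) \<phi>)"
  by (induction n) (auto intro: test_function_deriv)

lemma is_weak_derivD:
  "is_weak_deriv n a b f g \<Longrightarrow> test_function a b \<phi> \<Longrightarrow>
    (LINT x|lebesgue_on {a<..<b}. (deriv ^^ n) \<phi> x *\<^sub>R f x) =
    (-1) ^ n *\<^sub>R (LINT x|lebesgue_on {a<..<b}. \<phi> x *\<^sub>R g x)"
  by (simp add: is_weak_deriv_def)

lemma is_weak_deriv_cong:
  assumes "is_weak_deriv n a b f g" "ae_eq_on a b f f'" "ae_eq_on a b g g'"
  shows "is_weak_deriv n a b f' g'"
  using assms lint_test_cong[OF assms(2) test_function_deriv_pow] lint_test_cong[OF assms(3)]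
    locally_integrable_on_cong
  unfolding is_weak_deriv_def by metis

text \<open>
  Derivatives of test functions are test functions, so a weak derivative of order \<open>m + j\<close> of \<open>f\<close> is
  the same as one of order \<open>j\<close> of the \<open>m\<close>-th weak derivative. All questions about higher orders are
  reduced to the first order in this way.
\<close>

lemma is_weak_deriv_shift:
  assumes "is_weak_deriv m a b f g"
  shows "is_weak_deriv (m + j) a b f h \<longleftrightarrow> is_weak_deriv j a b g h"
proof -
  have f: "locally_integrable_on a b f" "locally_integrable_on a b g"
    using assms by (auto simp: is_weak_deriv_def)
  have "(LINT x|lebesgue_on {a<..<b}. (deriv ^^ (m + j)) \<phi> x *\<^sub>R f x) =
      (-1) ^ m *\<^sub>R (LINT x|lebesgue_on {a<..<b}. (deriv ^^ j) \<phi> x *\<^sub>R g x)" if "test_function a b \<phi>" for \<phi>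
    using assms test_function_deriv_pow[OF that, of j]
    by (simp add: is_weak_deriv_def funpow_add)
  moreover have "(-1) ^ m *\<^sub>R x = (-1) ^ (m + j) *\<^sub>R y \<longleftrightarrow> x = (-1) ^ j *\<^sub>R y" for x y :: 'a
    by (cases "even m"; cases "even j") (auto simp: minus_equation_iff)
  ultimately show ?thesis using f by (auto simp: is_weak_deriv_def)
qed

lemma is_weak_deriv_0: "locally_integrable_on a b f \<Longrightarrow> is_weak_deriv 0 a b f f"
  by (simp add: is_weak_deriv_def)

lemma is_weak_deriv_unique:
  assumes "is_weak_deriv n a b f g" "is_weak_deriv n a b f h"
  shows "ae_eq_on a b g h"
proof -
  have l: "locally_integrable_on a b g" "locally_integrable_on a b h"
    using assms by (auto simp: is_weak_deriv_def)
  have "ae_eq_on a b (\<lambda>x. g x - h x) (\<lambda>x. 0)"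
  proof (rule fundamental_lemma[OF locally_integrable_on_diff[OF l]])
    fix \<phi> assume \<phi>: "test_function a b \<phi>"
    have "(-1) ^ n *\<^sub>R (LINT x|lebesgue_on {a<..<b}. \<phi> x *\<^sub>R g x) =
        (-1) ^ n *\<^sub>R (LINT x|lebesgue_on {a<..<b}. \<phi> x *\<^sub>R h x)"
      using is_weak_derivD[OF assms(1) \<phi>] is_weak_derivD[OF assms(2) \<phi>] by simp
    then have "(LINT x|lebesgue_on {a<..<b}. \<phi> x *\<^sub>R g x) = (LINT x|lebesgue_on {a<..<b}. \<phi> x *\<^sub>R h x)"
      by simp
    then show "(LINT x|lebesgue_on {a<..<b}. \<phi> x *\<^sub>R (g x - h x)) = 0"
      using test_function_integrable[OF \<phi> l(1)] test_function_integrable[OF \<phi> l(2)]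
      by (simp add: scaleR_diff_right)
  qed
  then show ?thesis by (simp add: ae_eq_on_def)
qed

lemma wderiv_weak_deriv:
  assumes "is_weak_deriv n a b f g"
  shows "is_weak_deriv n a b f (wderiv n a b f)" "ae_eq_on a b (wderiv n a b f) g"
proof -
  show "is_weak_deriv n a b f (wderiv n a b f)"
    unfolding wderiv_def using assms by (rule someI[of "is_weak_deriv n a b f"])
  from this assms show "ae_eq_on a b (wderiv n a b f) g" by (rule is_weak_deriv_unique)
qed

lemma ac_on_weak_deriv:
  assumes "a < b" and ac: "ac_on a b F f"
  shows "is_weak_deriv 1 a b F f"
  unfolding is_weak_deriv_def
proof (intro conjI allI impI)
  have Fi: "F absolutely_integrable_on {a..b}"
    by (rule absolutely_integrable_continuous_real[OF ac_on_continuous[OF ac]])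
  have fi: "f absolutely_integrable_on {a..b}" by (rule ac_on_integrable[OF ac])
  show l: "locally_integrable_on a b F" "locally_integrable_on a b f"
    using Fi fi by (auto intro: absolutely_integrable_imp_locally)
  fix \<phi> assume \<phi>: "test_function a b \<phi>"
  then obtain c d where cd: "a < c" "d < b" "\<And>x. x \<notin> {c..d} \<Longrightarrow> \<phi> x = 0"
    by (auto simp: test_function_iff)
  have sm: "smooth \<phi>" "smooth (deriv \<phi>)"
    using \<phi> test_function_deriv[OF \<phi>] by (auto simp: test_function_iff)
  have d: "has_deriv_on a b \<phi> (deriv \<phi>)"
    unfolding has_deriv_on_def
    using smooth_has_deriv[OF sm(1)]
    by (auto simp: has_real_derivative_iff_has_vector_derivative intro: has_vector_derivative_at_within)
  note prod = ac_on_prod[OF bounded_bilinear_scaleR d smooth_continuous[OF sm(2)] ac]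
  have ends: "\<phi> a = 0" "\<phi> b = 0" using cd by auto
  have int: "integrable (lebesgue_on {a<..<b}) (\<lambda>x. deriv \<phi> x *\<^sub>R F x)"
      "integrable (lebesgue_on {a<..<b}) (\<lambda>x. \<phi> x *\<^sub>R f x)"
    using test_function_integrable[OF _ l(1)] test_function_integrable[OF _ l(2)] \<phi> test_function_deriv[OF \<phi>]
    by auto
  have "integral {a..b} (\<lambda>x. deriv \<phi> x *\<^sub>R F x + \<phi> x *\<^sub>R f x) = 0"
    using ac_onD[OF prod, of b] ends assms(1) by simp
  moreover have "(LINT x|lebesgue_on {a<..<b}. deriv \<phi> x *\<^sub>R F x + \<phi> x *\<^sub>R f x) =
      integral {a<..<b} (\<lambda>x. deriv \<phi> x *\<^sub>R F x + \<phi> x *\<^sub>R f x)"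
    by (rule lebesgue_integral_eq_integral) (use int in auto)
  ultimately have "(LINT x|lebesgue_on {a<..<b}. deriv \<phi> x *\<^sub>R F x + \<phi> x *\<^sub>R f x) = 0"
    by (simp add: integral_open_interval_real)
  then have "(LINT x|lebesgue_on {a<..<b}. deriv \<phi> x *\<^sub>R F x) + (LINT x|lebesgue_on {a<..<b}. \<phi> x *\<^sub>R f x) = 0"
    using int by simp
  then show "(LINT x|lebesgue_on {a<..<b}. (deriv ^^ 1) \<phi> x *\<^sub>R F x) =
      (-1) ^ 1 *\<^sub>R (LINT x|lebesgue_on {a<..<b}. \<phi> x *\<^sub>R f x)"
    by (simp add: eq_neg_iff_add_eq_0)
qed

text \<open>
  \<open>f\<close> and the indefinite integral of \<open>g\<close> have the same weak derivative, so they differ by a constant.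
\<close>

lemma weak_deriv_ac_rep:
  fixes f :: "real \<Rightarrow> 'a::euclidean_space"
  assumes ab: "a < b" and w: "is_weak_deriv 1 a b f g" and g: "g absolutely_integrable_on {a..b}"
  obtains F where "ac_on a b F g" "ae_eq_on a b f F"
proof -
  define F0 where "F0 = (\<lambda>x. integral {a..x} g)"
  have ac0: "ac_on a b F0 g" using g by (simp add: ac_on_def F0_def)
  have w0: "is_weak_deriv 1 a b F0 g" by (rule ac_on_weak_deriv[OF ab ac0])
  have l: "locally_integrable_on a b f" "locally_integrable_on a b F0"
    using w w0 by (auto simp: is_weak_deriv_def)
  obtain k where k: "ae_eq_on a b (\<lambda>x. f x - F0 x) (\<lambda>x. k)"
  proof (rule du_Bois_Reymond[OF ab locally_integrable_on_diff[OF l]])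
    fix \<phi> assume \<phi>: "test_function a b \<phi>"
    then show "(LINT x|lebesgue_on {a<..<b}. deriv \<phi> x *\<^sub>R (f x - F0 x)) = 0"
      using is_weak_derivD[OF w \<phi>] is_weak_derivD[OF w0 \<phi>]
        test_function_integrable[OF test_function_deriv[OF \<phi>] l(1)]
        test_function_integrable[OF test_function_deriv[OF \<phi>] l(2)]
      by (simp add: scaleR_diff_right)
  qed
  have "ac_on a b (\<lambda>x. F0 x + k) g"
    using g by (simp add: ac_on_def F0_def)
  moreover have "ae_eq_on a b f (\<lambda>x. F0 x + k)"
    using k unfolding ae_eq_on_def by eventually_elim (simp add: algebra_simps)
  ultimately show thesis by (rule that)
qed

section \<open>Square-integrable functions\<close>

lemma L2_on_measurable: "L2_on a b f \<Longrightarrow> f \<in> borel_measurable (lebesgue_on {a<..<b})"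
  by (simp add: L2_on_def)

lemma integrable_const_Ioo: "integrable (lebesgue_on {a<..<b::real}) (\<lambda>x. c :: 'a::euclidean_space)"
  by (simp add: finite_measure.integrable_const finite_measure_lebesgue_on)

lemma L2_on_absolutely_integrable:
  assumes "L2_on a b f" shows "f absolutely_integrable_on {a..b}"
proof -
  have "integrable (lebesgue_on {a<..<b}) f"
  proof (rule Bochner_Integration.integrable_bound)
    show "integrable (lebesgue_on {a<..<b}) (\<lambda>x. 1 + (norm (f x))\<^sup>2)"
      using assms integrable_const_Ioo[of a b "1::real"] by (simp add: L2_on_def)
    have "t \<le> 1 + t\<^sup>2" for t :: real
      using zero_le_power2[of "t - 1/2"] by (simp add: power2_eq_square algebra_simps)
    then show "AE x in lebesgue_on {a<..<b}. norm (f x) \<le> norm (1 + (norm (f x))\<^sup>2)" by simp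
  qed (use assms L2_on_measurable in auto)
  then show ?thesis by (simp add: absolutely_integrable_on_iff_lebesgue_on_open)
qed

lemma L2_on_add:
  assumes "L2_on a b f" "L2_on a b g" shows "L2_on a b (\<lambda>x. f x + g x)"
proof -
  have [measurable]: "f \<in> borel_measurable (lebesgue_on {a<..<b})" "g \<in> borel_measurable (lebesgue_on {a<..<b})"
    using assms by (auto intro: L2_on_measurable)
  have "integrable (lebesgue_on {a<..<b}) (\<lambda>x. (norm (f x + g x))\<^sup>2)"
  proof (rule Bochner_Integration.integrable_bound)
    show "integrable (lebesgue_on {a<..<b}) (\<lambda>x. 2 * (norm (f x))\<^sup>2 + 2 * (norm (g x))\<^sup>2)"
      using assms by (simp add: L2_on_def)
    have "(norm (y + z))\<^sup>2 \<le> 2 * (norm y)\<^sup>2 + 2 * (norm z)\<^sup>2" for y z :: 'a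
    proof -
      have "(norm (y + z))\<^sup>2 \<le> (norm y + norm z)\<^sup>2" by (intro power_mono norm_triangle_ineq) simp
      also have "\<dots> \<le> 2 * (norm y)\<^sup>2 + 2 * (norm z)\<^sup>2"
        using zero_le_power2[of "norm y - norm z"] by (simp add: power2_eq_square algebra_simps)
      finally show ?thesis .
    qed
    then show "AE x in lebesgue_on {a<..<b}. norm ((norm (f x + g x))\<^sup>2) \<le>
        norm (2 * (norm (f x))\<^sup>2 + 2 * (norm (g x))\<^sup>2)" by simp
  qed measurable
  then show ?thesis using assms by (auto simp: L2_on_def)
qed

lemma L2_on_bilinear:
  fixes prod :: "'a::euclidean_space \<Rightarrow> 'b::euclidean_space \<Rightarrow> 'c::euclidean_space"
  assumes bl: "bounded_bilinear prod" and p: "continuous_on {a..b} p" and f: "L2_on a b f"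
  shows "L2_on a b (\<lambda>x. prod (p x) (f x))"
proof -
  interpret bounded_bilinear prod by fact
  have pm: "p \<in> borel_measurable (lebesgue_on {a<..<b})"
  proof (rule continuous_imp_measurable_on_sets_lebesgue)
    show "continuous_on {a<..<b} p" by (rule continuous_on_subset[OF p]) auto
  qed simp
  have m: "(\<lambda>x. prod (p x) (f x)) \<in> borel_measurable (lebesgue_on {a<..<b})"
    by (rule borel_measurable_continuous_Pair[OF pm L2_on_measurable[OF f]])
      (intro continuous_on continuous_intros)
  obtain K where K: "K \<ge> 0" "\<And>x y. norm (prod x y) \<le> norm x * norm y * K"
    using nonneg_bounded by blast
  have "bounded (p ` {a..b})"
    using p by (intro compact_imp_bounded compact_continuous_image) auto
  then obtain L where "\<forall>y\<in>p ` {a..b}. norm y \<le> L" unfolding bounded_iff by blast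
  then have L: "norm (p x) \<le> \<bar>L\<bar>" if "x \<in> {a..b}" for x using that by (intro order_trans[OF _ abs_ge_self]) blast
  have "integrable (lebesgue_on {a<..<b}) (\<lambda>x. (norm (prod (p x) (f x)))\<^sup>2)"
  proof (rule Bochner_Integration.integrable_bound)
    show "integrable (lebesgue_on {a<..<b}) (\<lambda>x. (\<bar>L\<bar> * K)\<^sup>2 * (norm (f x))\<^sup>2)"
      using f by (simp add: L2_on_def)
    show "AE x in lebesgue_on {a<..<b}. norm ((norm (prod (p x) (f x)))\<^sup>2) \<le>
        norm ((\<bar>L\<bar> * K)\<^sup>2 * (norm (f x))\<^sup>2)"
    proof (rule AE_I2)
      fix x assume "x \<in> space (lebesgue_on {a<..<b})"
      then have "norm (p x) \<le> \<bar>L\<bar>" using L by simp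
      then have "norm (p x) * norm (f x) * K \<le> \<bar>L\<bar> * norm (f x) * K"
        by (intro mult_right_mono) (auto simp: K)
      then have "norm (prod (p x) (f x)) \<le> \<bar>L\<bar> * norm (f x) * K"
        using K(2) order_trans by blast
      then have "(norm (prod (p x) (f x)))\<^sup>2 \<le> (\<bar>L\<bar> * norm (f x) * K)\<^sup>2"
        by (intro power_mono) auto
      then show "norm ((norm (prod (p x) (f x)))\<^sup>2) \<le> norm ((\<bar>L\<bar> * K)\<^sup>2 * (norm (f x))\<^sup>2)"
        by (simp add: power_mult_distrib mult_ac)
    qed
  qed (use m in auto)
  then show ?thesis using m by (simp add: L2_on_def)
qed

lemma L2_on_continuous:
  fixes p :: "real \<Rightarrow> 'a::euclidean_space"
  assumes "continuous_on {a..b} p" shows "L2_on a b p"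
proof -
  have "L2_on a b (\<lambda>x. 1::real)"
    using integrable_const_Ioo[of a b "1::real"] by (simp add: L2_on_def)
  from L2_on_bilinear[OF bounded_bilinear.flip[OF bounded_bilinear_scaleR] assms this]
  show ?thesis by simp
qed

lemma L2_on_cong:
  assumes "L2_on a b f" "ae_eq_on a b f g" shows "L2_on a b g"
proof -
  have N: "negligible ({x \<in> {a<..<b}. f x \<noteq> g x} \<union> {a, b})"
    using assms(2) by (simp add: ae_eq_on_iff_negligible negligible_Un)
  have "g absolutely_integrable_on {a..b}"
    by (rule absolutely_integrable_spike[OF L2_on_absolutely_integrable[OF assms(1)] N]) auto
  then have m: "g \<in> borel_measurable (lebesgue_on {a<..<b})"
    by (auto simp: absolutely_integrable_on_iff_lebesgue_on_open)
  have "integrable (lebesgue_on {a<..<b}) (\<lambda>x. (norm (g x))\<^sup>2) \<longleftrightarrow>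
      integrable (lebesgue_on {a<..<b}) (\<lambda>x. (norm (f x))\<^sup>2)"
    using m L2_on_measurable[OF assms(1)] assms(2)
    by (intro integrable_cong_AE) (auto simp: ae_eq_on_def elim!: eventually_mono)
  then show ?thesis using assms(1) m by (simp add: L2_on_def)
qed

section \<open>Sobolev functions and their classical representatives\<close>

lemma sobolev_cong:
  assumes "sobolev k a b f" "ae_eq_on a b f g" shows "sobolev k a b g"
  using assms L2_on_cong[OF _ assms(2)] is_weak_deriv_cong[OF _ assms(2) ae_eq_on_refl]
  unfolding sobolev_def by blast

lemma sobolev_0_iff: "sobolev 0 a b f \<longleftrightarrow> L2_on a b f"
  unfolding sobolev_def
  using is_weak_deriv_0[OF absolutely_integrable_imp_locally[OF L2_on_absolutely_integrable]] by auto

lemma sobolev_Suc_rep: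
  assumes ab: "a < b" and f: "sobolev (Suc k) a b f"
  obtains F g where "ac_on a b F g" "ae_eq_on a b f F" "sobolev k a b g"
proof -
  obtain g where g: "L2_on a b g" "is_weak_deriv 1 a b f g"
    using f unfolding sobolev_def by force
  obtain F where F: "ac_on a b F g" "ae_eq_on a b f F"
    using weak_deriv_ac_rep[OF ab g(2) L2_on_absolutely_integrable[OF g(1)]] .
  have "\<exists>h. L2_on a b h \<and> is_weak_deriv j a b g h" if "j \<le> k" for j
  proof -
    from f that have "\<exists>h. L2_on a b h \<and> is_weak_deriv (1 + j) a b f h"
      unfolding sobolev_def by simp
    then show ?thesis using is_weak_deriv_shift[OF g(2)] by blast
  qed
  then have "sobolev k a b g" using g by (simp add: sobolev_def)
  with F show thesis by (rule that)
qed

lemma sobolev_SucI: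
  assumes ab: "a < b" and F: "ac_on a b F g" and g: "sobolev k a b g"
  shows "sobolev (Suc k) a b F"
  unfolding sobolev_def
proof (intro conjI allI impI)
  show L2: "L2_on a b F" by (rule L2_on_continuous[OF ac_on_continuous[OF F]])
  fix j assume j: "j \<le> Suc k"
  show "\<exists>h. L2_on a b h \<and> is_weak_deriv j a b F h"
  proof (cases j)
    case 0
    then show ?thesis using L2 sobolev_0_iff[of a b F] by (auto simp: sobolev_def)
  next
    case (Suc i)
    then have "i \<le> k" using j by simp
    then obtain h where h: "L2_on a b h" "is_weak_deriv i a b g h" using g unfolding sobolev_def by blast
    then have "is_weak_deriv (1 + i) a b F h" using is_weak_deriv_shift[OF ac_on_weak_deriv[OF ab F]] by blast
    then show ?thesis using h Suc by auto
  qed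
qed

lemma sobolev_Suc_Suc_rep:
  assumes ab: "a < b" and f: "sobolev (Suc (Suc k)) a b f"
  obtains F F' where "has_deriv_on a b F F'" "continuous_on {a..b} F'" "ae_eq_on a b f F" "sobolev (Suc k) a b F'"
proof -
  obtain F g where 1: "ac_on a b F g" "ae_eq_on a b f F" "sobolev (Suc k) a b g"
    using sobolev_Suc_rep[OF ab f] .
  obtain G h where 2: "ac_on a b G h" "ae_eq_on a b g G" using sobolev_Suc_rep[OF ab 1(3)] .
  have G: "continuous_on {a..b} G" by (rule ac_on_continuous[OF 2(1)])
  have "ac_on a b F G" by (rule ac_on_cong[OF 1(1) _ 2(2)]) simp
  from that[OF ac_on_deriv[OF this G] G 1(2) sobolev_cong[OF 1(3) 2(2)]] show thesis .
qed

lemma sobolev_1_rep: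
  assumes ab: "a < b" and f: "sobolev 1 a b f"
  obtains F g where "ac_on a b F g" "ae_eq_on a b f F" "L2_on a b g"
  using sobolev_Suc_rep[of a b 0 f] assms sobolev_0_iff by (metis One_nat_def)

lemma sobolev_2_rep:
  assumes ab: "a < b" and f: "sobolev 2 a b f"
  obtains F F' g where "has_deriv_on a b F F'" "ac_on a b F' g" "L2_on a b g" "ae_eq_on a b f F"
proof -
  have f: "sobolev (Suc (Suc 0)) a b f" using f by (simp add: numeral_2_eq_2)
  obtain F F' where 1: "has_deriv_on a b F F'" "continuous_on {a..b} F'" "ae_eq_on a b f F" "sobolev (Suc 0) a b F'"
    using sobolev_Suc_Suc_rep[OF ab f] .
  obtain G g where 2: "ac_on a b G g" "ae_eq_on a b F' G" "L2_on a b g"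
    using sobolev_1_rep[OF ab] 1(4) by (metis One_nat_def)
  have "G x = F' x" if "x \<in> {a..b}" for x
    using ae_eq_on_continuous_imp_eq[OF ab ac_on_continuous[OF 2(1)] 1(2) ae_eq_on_sym[OF 2(2)] that] .
  then have "ac_on a b F' g" by (rule ac_on_cong[OF 2(1)]) auto
  then show thesis using that 1 2 by blast
qed

text \<open>
  An \<open>H\<^sup>4\<close> function is of class \<open>C\<^sup>3\<close>, and only its fourth derivative is a genuinely weak one.
\<close>

lemma sobolev_4_rep:
  assumes ab: "a < b" and f: "sobolev 4 a b f"
  obtains U0 U1 U2 U3 u4 where "has_deriv_on a b U0 U1" "has_deriv_on a b U1 U2" "has_deriv_on a b U2 U3"
    "ac_on a b U3 u4" "L2_on a b u4" "ae_eq_on a b f U0"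
proof -
  have f: "sobolev (Suc (Suc (Suc (Suc 0)))) a b f" using f by (simp add: numeral_eq_Suc)
  obtain U0 V1 where 0: "has_deriv_on a b U0 V1" "continuous_on {a..b} V1" "ae_eq_on a b f U0"
    "sobolev (Suc (Suc (Suc 0))) a b V1" using sobolev_Suc_Suc_rep[OF ab f] .
  obtain U1 V2 where 1: "has_deriv_on a b U1 V2" "continuous_on {a..b} V2" "ae_eq_on a b V1 U1"
    "sobolev (Suc (Suc 0)) a b V2" using sobolev_Suc_Suc_rep[OF ab 0(4)] .
  have 2: "sobolev 2 a b V2" using 1(4) by (simp add: numeral_2_eq_2)
  obtain U2 U3 u4 where 2: "has_deriv_on a b U2 U3" "ac_on a b U3 u4" "L2_on a b u4" "ae_eq_on a b V2 U2"
    using sobolev_2_rep[OF ab 2] .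
  have e1: "V1 x = U1 x" if "x \<in> {a..b}" for x
    using ae_eq_on_continuous_imp_eq[OF ab 0(2) has_deriv_on_continuous[OF 1(1)] 1(3) that] .
  have e2: "V2 x = U2 x" if "x \<in> {a..b}" for x
    using ae_eq_on_continuous_imp_eq[OF ab 1(2) has_deriv_on_continuous[OF 2(1)] 2(4) that] .
  have "has_deriv_on a b U0 U1" "has_deriv_on a b U1 U2"
    using 0(1) 1(1) e1 e2 by (simp_all add: has_deriv_on_def)
  then show thesis using that 2 0(3) by blast
qed

lemma has_deriv_on_weak_deriv:
  assumes "a < b" "has_deriv_on a b F f" "continuous_on {a..b} f"
  shows "is_weak_deriv 1 a b F f"
  using ac_on_weak_deriv[OF assms(1) ac_on_C1[OF assms(2,3)]] .

lemma is_weak_deriv_2I: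
  assumes "is_weak_deriv 1 a b f g" "is_weak_deriv 1 a b g h" shows "is_weak_deriv 2 a b f h"
  using is_weak_deriv_shift[OF assms(1), of 1 h] assms(2) by (simp add: numeral_2_eq_2)

lemma has_deriv_on_scaleR:
  assumes "has_deriv_on a b S S'" "has_deriv_on a b m m'"
  shows "has_deriv_on a b (\<lambda>x. S x *\<^sub>R m x) (\<lambda>x. S' x *\<^sub>R m x + S x *\<^sub>R m' x)"
  unfolding has_deriv_on_def
proof
  fix x assume "x \<in> {a..b}"
  then have "(S has_vector_derivative S' x) (at x within {a..b})" "(m has_vector_derivative m' x) (at x within {a..b})"
    using assms by (auto simp: has_deriv_on_def)
  from bounded_bilinear.has_vector_derivative[OF bounded_bilinear_scaleR this]
  show "((\<lambda>x. S x *\<^sub>R m x) has_vector_derivative S' x *\<^sub>R m x + S x *\<^sub>R m' x) (at x within {a..b})"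
    by (simp add: add.commute)
qed

lemma ac_on_scaleR_right:
  assumes "has_deriv_on a b S S'" "continuous_on {a..b} S'" "ac_on a b m m'"
  shows "ac_on a b (\<lambda>x. S x *\<^sub>R m x) (\<lambda>x. S' x *\<^sub>R m x + S x *\<^sub>R m' x)"
  using ac_on_prod[OF bounded_bilinear_scaleR assms] .

lemma ac_on_scaleR_left:
  assumes "ac_on a b S S'" "has_deriv_on a b m m'" "continuous_on {a..b} m'"
  shows "ac_on a b (\<lambda>x. S x *\<^sub>R m x) (\<lambda>x. S x *\<^sub>R m' x + S' x *\<^sub>R m x)"
  using ac_on_prod[OF bounded_bilinear.flip[OF bounded_bilinear_scaleR] assms(2,3,1)] .

lemma L2_on_scaleR:
  "continuous_on {a..b} p \<Longrightarrow> L2_on a b f \<Longrightarrow> L2_on a b (\<lambda>x. p x *\<^sub>R f x)"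
  "L2_on a b p \<Longrightarrow> continuous_on {a..b} f \<Longrightarrow> L2_on a b (\<lambda>x. p x *\<^sub>R f x)"
  using L2_on_bilinear[OF bounded_bilinear_scaleR] L2_on_bilinear[OF bounded_bilinear.flip[OF bounded_bilinear_scaleR]]
  by auto

text \<open>
  One beam, with continuous representatives \<open>S\<close> of \<open>\<sigma> \<in> H\<^sup>2\<close> and \<open>Q\<close> of \<open>q \<in> H\<^sup>1\<close> together with their
  derivatives.
\<close>

locale beam_coeff =
  fixes a b :: real and \<sigma> q S S1 s2 Q q1 :: "real \<Rightarrow> real"
  assumes ab: "a < b"
    and S: "has_deriv_on a b S S1" "ac_on a b S1 s2" "L2_on a b s2" "ae_eq_on a b \<sigma> S"
    and pos: "\<And>x. x \<in> {a..b} \<Longrightarrow> S x > 0"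
    and Q: "ac_on a b Q q1" "L2_on a b q1" "ae_eq_on a b q Q"
begin

lemma contS: "continuous_on {a..b} S" "continuous_on {a..b} S1" "continuous_on {a..b} Q"
  using has_deriv_on_continuous[OF S(1)] ac_on_continuous[OF S(2)] ac_on_continuous[OF Q(1)] by auto

text \<open>
  The derivatives in \<open>beam_op\<close> and \<open>T_op\<close> are chosen by \<open>SOME\<close>; they take the expected values once
  weak derivatives are known to exist. The functions \<open>\<sigma> f''\<close> and \<open>q f'\<close> have them by the product rule,
  and the derivative \<open>k\<close> of \<open>q f'\<close> cancels in \<open>beam_op\<close>, leaving the derivative of \<open>T\<close>.
\<close>

lemma beam_op_eq:
  fixes f :: "real \<Rightarrow> 'a::euclidean_space"
  assumes f: "ae_eq_on a b f U" and U: "has_deriv_on a b U \<Theta>" and \<Theta>: "has_deriv_on a b \<Theta> (\<lambda>x. (1 / S x) *\<^sub>R m x)"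
    and m: "has_deriv_on a b m (\<lambda>x. T x + Q x *\<^sub>R \<Theta> x)" and T: "ac_on a b T g"
  shows "ae_eq_on a b (wderiv 1 a b f) \<Theta>" "ae_eq_on a b (wderiv 2 a b f) (\<lambda>x. (1 / S x) *\<^sub>R m x)"
    "ae_eq_on a b (T_op a b \<sigma> q f) T" "ae_eq_on a b (beam_op a b \<sigma> q f) g"
proof -
  have c: "continuous_on {a..b} \<Theta>" "continuous_on {a..b} m" "continuous_on {a..b} T"
    using \<Theta> m T has_deriv_on_continuous ac_on_continuous by blast+
  have c2: "continuous_on {a..b} (\<lambda>x. (1 / S x) *\<^sub>R m x)"
    using c contS pos by (intro continuous_intros) force+
  have c3: "continuous_on {a..b} (\<lambda>x. T x + Q x *\<^sub>R \<Theta> x)"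
    using c contS by (intro continuous_intros)
  define k where "k = (\<lambda>x. Q x *\<^sub>R ((1 / S x) *\<^sub>R m x) + q1 x *\<^sub>R \<Theta> x)"
  have Q\<Theta>: "ac_on a b (\<lambda>x. Q x *\<^sub>R \<Theta> x) k"
    unfolding k_def by (rule ac_on_scaleR_left[OF Q(1) \<Theta> c2])
  have w1: "is_weak_deriv 1 a b U \<Theta>" by (rule has_deriv_on_weak_deriv[OF ab U c(1)])
  have w2: "is_weak_deriv 2 a b U (\<lambda>x. (1 / S x) *\<^sub>R m x)"
    by (rule is_weak_deriv_2I[OF w1 has_deriv_on_weak_deriv[OF ab \<Theta> c2]])
  have f': "ae_eq_on a b U f" by (rule ae_eq_on_sym[OF f])
  show 1: "ae_eq_on a b (wderiv 1 a b f) \<Theta>"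
    by (rule wderiv_weak_deriv[OF is_weak_deriv_cong[OF w1 f' ae_eq_on_refl]])
  show 2: "ae_eq_on a b (wderiv 2 a b f) (\<lambda>x. (1 / S x) *\<^sub>R m x)"
    by (rule wderiv_weak_deriv[OF is_weak_deriv_cong[OF w2 f' ae_eq_on_refl]])
  have "ae_eq_on a b (\<lambda>x. \<sigma> x *\<^sub>R wderiv 2 a b f x) (\<lambda>x. S x *\<^sub>R ((1 / S x) *\<^sub>R m x))"
    by (rule ae_eq_on_map2[OF S(4) 2])
  also have "ae_eq_on a b (\<lambda>x. S x *\<^sub>R ((1 / S x) *\<^sub>R m x)) m"
  proof (rule ae_eq_onI)
    fix x assume "x \<in> {a<..<b}"
    then have "S x \<noteq> 0" using pos[of x] by simp
    then show "S x *\<^sub>R ((1 / S x) *\<^sub>R m x) = m x" by simp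
  qed
  finally have me: "ae_eq_on a b m (\<lambda>x. \<sigma> x *\<^sub>R wderiv 2 a b f x)" by (rule ae_eq_on_sym)
  have wm1: "is_weak_deriv 1 a b m (\<lambda>x. T x + Q x *\<^sub>R \<Theta> x)"
    by (rule has_deriv_on_weak_deriv[OF ab m c3])
  have wm2: "is_weak_deriv 2 a b m (\<lambda>x. g x + k x)"
    by (rule is_weak_deriv_2I[OF wm1 ac_on_weak_deriv[OF ab ac_on_add[OF T Q\<Theta>]]])
  have m1: "ae_eq_on a b (wderiv 1 a b (\<lambda>x. \<sigma> x *\<^sub>R wderiv 2 a b f x)) (\<lambda>x. T x + Q x *\<^sub>R \<Theta> x)"
    by (rule wderiv_weak_deriv[OF is_weak_deriv_cong[OF wm1 me ae_eq_on_refl]])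
  have m2: "ae_eq_on a b (wderiv 2 a b (\<lambda>x. \<sigma> x *\<^sub>R wderiv 2 a b f x)) (\<lambda>x. g x + k x)"
    by (rule wderiv_weak_deriv[OF is_weak_deriv_cong[OF wm2 me ae_eq_on_refl]])
  have qe: "ae_eq_on a b (\<lambda>x. Q x *\<^sub>R \<Theta> x) (\<lambda>x. q x *\<^sub>R wderiv 1 a b f x)"
    by (rule ae_eq_on_map2[OF ae_eq_on_sym[OF Q(3)] ae_eq_on_sym[OF 1]])
  have q1: "ae_eq_on a b (wderiv 1 a b (\<lambda>x. q x *\<^sub>R wderiv 1 a b f x)) k"
    by (rule wderiv_weak_deriv[OF is_weak_deriv_cong[OF ac_on_weak_deriv[OF ab Q\<Theta>] qe ae_eq_on_refl]])
  show "ae_eq_on a b (T_op a b \<sigma> q f) T"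
    using m1 qe unfolding T_op_def ae_eq_on_def by eventually_elim simp
  show "ae_eq_on a b (beam_op a b \<sigma> q f) g"
    using m2 q1 unfolding beam_op_def ae_eq_on_def by eventually_elim simp
qed

lemma traces_eq:
  fixes f :: "real \<Rightarrow> 'a::euclidean_space"
  assumes f: "ae_eq_on a b f U" and U: "has_deriv_on a b U \<Theta>" and \<Theta>: "has_deriv_on a b \<Theta> (\<lambda>x. (1 / S x) *\<^sub>R m x)"
    and m: "has_deriv_on a b m (\<lambda>x. T x + Q x *\<^sub>R \<Theta> x)" and T: "ac_on a b T g" and x: "x \<in> {a..b}"
  shows "trace_at a b f x = U x" "trace_at a b (wderiv 1 a b f) x = \<Theta> x"
    "trace_at a b (wderiv 2 a b f) x = (1 / S x) *\<^sub>R m x" "trace_at a b (T_op a b \<sigma> q f) x = T x"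
proof -
  note eqs = beam_op_eq[OF f U \<Theta> m T]
  have "continuous_on {a..b} (\<lambda>x. (1 / S x) *\<^sub>R m x)"
    using contS pos has_deriv_on_continuous[OF m] by (intro continuous_intros) force+
  then show "trace_at a b (wderiv 2 a b f) x = (1 / S x) *\<^sub>R m x"
    by (rule trace_at_eqI[OF ab _ eqs(2) x])
  show "trace_at a b f x = U x" "trace_at a b (wderiv 1 a b f) x = \<Theta> x" "trace_at a b (T_op a b \<sigma> q f) x = T x"
    using trace_at_eqI[OF ab _ f x] trace_at_eqI[OF ab _ eqs(1) x] trace_at_eqI[OF ab _ eqs(3) x]
      has_deriv_on_continuous[OF U] has_deriv_on_continuous[OF \<Theta>] ac_on_continuous[OF T] by auto
qed

lemma trace_\<sigma>: "x \<in> {a..b} \<Longrightarrow> trace_at a b \<sigma> x = S x"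
  by (rule trace_at_eqI[OF ab contS(1) S(4)])

text \<open>
  \<open>T\<close> is a combination of \<open>\<sigma>' u''\<close>, \<open>\<sigma> u'''\<close> and \<open>q u'\<close>. In each product one factor is of class \<open>C\<^sup>1\<close> and the
  other absolutely continuous, so \<open>T\<close> is absolutely continuous.
\<close>

lemma sobolev_4_classical:
  fixes f :: "real \<Rightarrow> 'a::euclidean_space"
  assumes "sobolev 4 a b f"
  obtains U \<Theta> m T g where "ae_eq_on a b f U" "has_deriv_on a b U \<Theta>" "has_deriv_on a b \<Theta> (\<lambda>x. (1 / S x) *\<^sub>R m x)"
    "has_deriv_on a b m (\<lambda>x. T x + Q x *\<^sub>R \<Theta> x)" "ac_on a b T g"
proof -
  obtain U0 U1 U2 U3 u4 where U: "has_deriv_on a b U0 U1" "has_deriv_on a b U1 U2" "has_deriv_on a b U2 U3"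
    "ac_on a b U3 u4" "L2_on a b u4" "ae_eq_on a b f U0" using sobolev_4_rep[OF ab assms] .
  have c: "continuous_on {a..b} U2" "continuous_on {a..b} U3"
    using has_deriv_on_continuous[OF U(3)] ac_on_continuous[OF U(4)] by auto
  define m where "m = (\<lambda>x. S x *\<^sub>R U2 x)"
  define m1 where "m1 = (\<lambda>x. S1 x *\<^sub>R U2 x + S x *\<^sub>R U3 x)"
  define T where "T = (\<lambda>x. m1 x - Q x *\<^sub>R U1 x)"
  have m: "has_deriv_on a b m m1"
    unfolding m_def m1_def by (rule has_deriv_on_scaleR[OF S(1) U(3)])
  have T: "\<exists>g. ac_on a b T g"
    unfolding T_def m1_def
    using ac_on_diff[OF ac_on_add[OF ac_on_scaleR_left[OF S(2) U(3) c(2)] ac_on_scaleR_right[OF S(1) contS(2) U(4)]]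
      ac_on_scaleR_left[OF Q(1) U(2) c(1)]] by blast
  have "has_deriv_on a b U1 (\<lambda>x. (1 / S x) *\<^sub>R m x)"
    using U(2) pos unfolding has_deriv_on_def m_def by (force simp: less_le)
  moreover have "has_deriv_on a b m (\<lambda>x. T x + Q x *\<^sub>R U1 x)"
    using m by (simp add: T_def)
  ultimately show thesis using that U(1,6) T by blast
qed

text \<open>
  Conversely \<open>u'' = m / S\<close>, and \<open>u''' = V / S\<close> with \<open>V = T + Q u' - S' u''\<close> absolutely continuous with
  square-integrable derivative. The form \<open>R V\<close> with \<open>R = 1 / S\<close> of class \<open>C\<^sup>1\<close> avoids a product of two
  functions that are merely absolutely continuous.
\<close>

lemma classical_sobolev_4:
  fixes U :: "real \<Rightarrow> 'a::euclidean_space"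
  assumes U: "has_deriv_on a b U \<Theta>" and \<Theta>: "has_deriv_on a b \<Theta> (\<lambda>x. (1 / S x) *\<^sub>R m x)"
    and m: "has_deriv_on a b m (\<lambda>x. T x + Q x *\<^sub>R \<Theta> x)" and T: "has_deriv_on a b T g" "continuous_on {a..b} g"
  shows "sobolev 4 a b U"
proof -
  have c: "continuous_on {a..b} \<Theta>" "continuous_on {a..b} m" "continuous_on {a..b} T"
    using \<Theta> m T has_deriv_on_continuous by blast+
  define R where "R = (\<lambda>x. 1 / S x)"
  define R1 where "R1 = (\<lambda>x. - (S1 x / (S x)\<^sup>2))"
  have R: "has_deriv_on a b R R1"
    unfolding has_deriv_on_def R_def R1_def
  proof
    fix x assume x: "x \<in> {a..b}"
    have "(S has_real_derivative S1 x) (at x within {a..b})"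
      using S(1) x by (simp add: has_deriv_on_def has_real_derivative_iff_has_vector_derivative)
    then have "((\<lambda>x. 1 / S x) has_real_derivative - (S1 x / (S x)\<^sup>2)) (at x within {a..b})"
      using pos[OF x] by (auto intro!: derivative_eq_intros simp: power2_eq_square)
    then show "((\<lambda>x. 1 / S x) has_vector_derivative - (S1 x / (S x)\<^sup>2)) (at x within {a..b})"
      by (simp add: has_real_derivative_iff_has_vector_derivative)
  qed
  have nz: "S x \<noteq> 0" if "x \<in> {a..b}" for x using pos[OF that] by simp
  have cR: "continuous_on {a..b} R" "continuous_on {a..b} R1"
    unfolding R_def R1_def using contS nz by (auto intro!: continuous_intros)
  define U2 where "U2 = (\<lambda>x. R x *\<^sub>R m x)"
  define V where "V = (\<lambda>x. T x + Q x *\<^sub>R \<Theta> x - S1 x *\<^sub>R U2 x)"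
  have \<Theta>2: "has_deriv_on a b \<Theta> U2" using \<Theta> by (simp add: U2_def R_def)
  have "has_deriv_on a b U2 (\<lambda>x. R1 x *\<^sub>R m x + R x *\<^sub>R (T x + Q x *\<^sub>R \<Theta> x))"
    unfolding U2_def by (rule has_deriv_on_scaleR[OF R m])
  moreover have "R1 x *\<^sub>R m x + R x *\<^sub>R (T x + Q x *\<^sub>R \<Theta> x) = R x *\<^sub>R V x" for x
    by (simp add: V_def U2_def R1_def R_def scaleR_diff_right power2_eq_square)
  ultimately have U2: "has_deriv_on a b U2 (\<lambda>x. R x *\<^sub>R V x)" by simp
  have cU2: "continuous_on {a..b} U2" by (rule has_deriv_on_continuous[OF U2])
  have cV: "continuous_on {a..b} V" unfolding V_def using c contS cU2 by (intro continuous_intros)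
  define v where "v = (\<lambda>x. g x + (Q x *\<^sub>R U2 x + q1 x *\<^sub>R \<Theta> x) - (S1 x *\<^sub>R (R x *\<^sub>R V x) + s2 x *\<^sub>R U2 x))"
  have cRV: "continuous_on {a..b} (\<lambda>x. R x *\<^sub>R V x)" using cR cV by (intro continuous_intros)
  have "ac_on a b (\<lambda>x. T x + Q x *\<^sub>R \<Theta> x - S1 x *\<^sub>R U2 x) v"
    unfolding v_def
    by (rule ac_on_diff[OF ac_on_add[OF ac_on_C1[OF T] ac_on_scaleR_left[OF Q(1) \<Theta>2 cU2]]
          ac_on_scaleR_left[OF S(2) U2 cRV]])
  then have V: "ac_on a b V v" by (subst V_def)
  have U3: "ac_on a b (\<lambda>x. R x *\<^sub>R V x) (\<lambda>x. R1 x *\<^sub>R V x + R x *\<^sub>R v x)"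
    by (rule ac_on_scaleR_right[OF R cR(2) V])
  have L2m: "L2_on a b (\<lambda>x. - f x)" if "L2_on a b f" for f :: "real \<Rightarrow> 'a"
    using L2_on_scaleR(1)[OF continuous_on_const that, of "-1"] by simp
  have Lv: "L2_on a b v"
  proof -
    have A: "L2_on a b (\<lambda>x. g x + Q x *\<^sub>R U2 x - S1 x *\<^sub>R (R x *\<^sub>R V x))"
      using T(2) contS cU2 cR cV by (intro L2_on_continuous continuous_intros)
    have B: "L2_on a b (\<lambda>x. q1 x *\<^sub>R \<Theta> x)" by (rule L2_on_scaleR(2)[OF Q(2) c(1)])
    have C: "L2_on a b (\<lambda>x. - (s2 x *\<^sub>R U2 x))" by (rule L2m[OF L2_on_scaleR(2)[OF S(3) cU2]])
    have "v = (\<lambda>x. g x + Q x *\<^sub>R U2 x - S1 x *\<^sub>R (R x *\<^sub>R V x) + (q1 x *\<^sub>R \<Theta> x + - (s2 x *\<^sub>R U2 x)))"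
      by (simp add: v_def fun_eq_iff algebra_simps)
    then show ?thesis using L2_on_add[OF A L2_on_add[OF B C]] by simp
  qed
  have "L2_on a b (\<lambda>x. R1 x *\<^sub>R V x + R x *\<^sub>R v x)"
    by (rule L2_on_add[OF L2_on_scaleR(1)[OF cR(2) L2_on_continuous[OF cV]] L2_on_scaleR(1)[OF cR(1) Lv]])
  then have "sobolev 1 a b (\<lambda>x. R x *\<^sub>R V x)"
    using sobolev_SucI[OF ab U3] sobolev_0_iff by auto
  then have "sobolev (Suc 1) a b U2"
    using sobolev_SucI[OF ab ac_on_C1[OF U2]] cR cV by (auto intro: continuous_intros)
  then have "sobolev (Suc (Suc 1)) a b \<Theta>"
    by (rule sobolev_SucI[OF ab ac_on_C1[OF \<Theta>2 cU2]])
  then have "sobolev (Suc (Suc (Suc 1))) a b U"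
    by (rule sobolev_SucI[OF ab ac_on_C1[OF U c(1)]])
  then show ?thesis by (simp add: numeral_eq_Suc)
qed

end

section \<open>Initial value problems\<close>

text \<open>
  Picard iteration in the weighted norm \<open>sup \<bar>exp (- k (x - a)) y(x)\<bar>\<close>. With \<open>k = 2 L + 1\<close> the integral
  operator contracts by the factor \<open>1/2\<close> on the whole interval at once. The fixed point \<open>w\<close> is the weighted solution.
\<close>

lemma lipschitz_ivp_exists:
  fixes F :: "real \<Rightarrow> 'e::euclidean_space \<Rightarrow> 'e"
  assumes ab: "a \<le> b" and L: "L \<ge> 0"
    and lip: "\<And>t x y. t \<in> {a..b} \<Longrightarrow> norm (F t x - F t y) \<le> L * norm (x - y)"
    and cont: "\<And>y. continuous_on {a..b} y \<Longrightarrow> continuous_on {a..b} (\<lambda>t. F t (y t))"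
  obtains y where "y a = y0" "has_deriv_on a b y (\<lambda>t. F t (y t))"
proof -
  define k where "k = 2 * L + 1"
  have k: "k > 0" using L by (simp add: k_def)
  define \<Phi>0 where "\<Phi>0 = (\<lambda>w x. exp (- k * (x - a)) *\<^sub>R (y0 + integral {a..x} (\<lambda>t. F t (exp (k * (t - a)) *\<^sub>R w t))))"
  have wc: "continuous_on S (apply_bcontfun w)" for w :: "real \<Rightarrow>\<^sub>C 'e" and S
    by (rule continuous_on_subset[of UNIV]) (auto intro: continuous_on_apply_bcontfun)
  have Fc: "continuous_on {a..b} (\<lambda>t. F t (exp (k * (t - a)) *\<^sub>R apply_bcontfun w t))" for w
    by (intro cont continuous_intros wc)
  have \<Phi>c: "continuous_on (cbox a b) (\<Phi>0 (apply_bcontfun w))" for w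
    unfolding \<Phi>0_def by (intro continuous_intros) (auto intro!: indefinite_integral_continuous_1 integrable_continuous_real Fc)
  have "\<exists>g::real \<Rightarrow>\<^sub>C 'e. (\<forall>x\<in>cbox a b. g x = \<Phi>0 w x) \<and> (\<forall>x. g x = \<Phi>0 w (clamp a b x))" for w :: "real \<Rightarrow>\<^sub>C 'e"
    by (rule continuous_on_cbox_bcontfunE[OF \<Phi>c[of w]]) blast
  then obtain \<Phi> :: "(real \<Rightarrow>\<^sub>C 'e) \<Rightarrow> (real \<Rightarrow>\<^sub>C 'e)" where
    \<Phi>: "\<And>w x. x \<in> {a..b} \<Longrightarrow> \<Phi> w x = \<Phi>0 w x" "\<And>w x. \<Phi> w x = \<Phi>0 w (clamp a b x)"
    by (auto simp: box_real) metis
  have "dist (\<Phi> w) (\<Phi> v) \<le> (1/2) * dist w v" for w v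
  proof (rule dist_bound)
    fix x0 :: real
    define x where "x = clamp a b x0"
    have x: "x \<in> {a..b}" using ab clamp_in_interval[of a b x0] by (simp add: x_def)
    let ?w = "\<lambda>t. F t (exp (k * (t - a)) *\<^sub>R apply_bcontfun w t)"
    let ?v = "\<lambda>t. F t (exp (k * (t - a)) *\<^sub>R apply_bcontfun v t)"
    have i: "?w integrable_on {a..x}" "?v integrable_on {a..x}"
      using x by (auto intro!: integrable_continuous_real continuous_on_subset[OF Fc])
    have ei: "((\<lambda>t. exp (k * (t - a))) has_integral (exp (k * (x - a)) / k - exp (k * (a - a)) / k)) {a..x}"
      using x k by (intro fundamental_theorem_of_calculus)
        (auto intro!: derivative_eq_intros simp: has_real_derivative_iff_has_vector_derivative[symmetric])
    have ei': "((\<lambda>t. L * dist w v * exp (k * (t - a))) has_integral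
        (L * dist w v * (exp (k * (x - a)) / k - exp (k * (a - a)) / k))) {a..x}"
      by (rule has_integral_mult_right[OF ei])
    have "norm (integral {a..x} ?w - integral {a..x} ?v) = norm (integral {a..x} (\<lambda>t. ?w t - ?v t))"
      using i by (simp add: integral_diff)
    also have "\<dots> \<le> integral {a..x} (\<lambda>t. L * dist w v * exp (k * (t - a)))"
    proof (rule integral_norm_bound_integral)
      show "(\<lambda>t. ?w t - ?v t) integrable_on {a..x}" using i by (rule integrable_diff)
      show "(\<lambda>t. L * dist w v * exp (k * (t - a))) integrable_on {a..x}" using ei' by blast
      fix t assume t: "t \<in> {a..x}"
      have "norm (?w t - ?v t) \<le> L * norm (exp (k * (t - a)) *\<^sub>R w t - exp (k * (t - a)) *\<^sub>R v t)"
        using t x by (intro lip) auto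
      also have "norm (exp (k * (t - a)) *\<^sub>R w t - exp (k * (t - a)) *\<^sub>R v t) = exp (k * (t - a)) * dist (w t) (v t)"
        by (simp add: dist_norm scaleR_diff_right[symmetric])
      also have "L * (exp (k * (t - a)) * dist (w t) (v t)) \<le> L * (exp (k * (t - a)) * dist w v)"
        using L by (intro mult_left_mono dist_bounded) auto
      finally show "norm (?w t - ?v t) \<le> L * dist w v * exp (k * (t - a))" by (simp add: mult_ac)
    qed
    also have "\<dots> = L * dist w v * (exp (k * (x - a)) / k - exp (k * (a - a)) / k)"
      using ei' by (rule integral_unique)
    also have "\<dots> \<le> L * dist w v * (exp (k * (x - a)) / k)"
      using L k by (intro mult_left_mono) auto
    finally have *: "norm (integral {a..x} ?w - integral {a..x} ?v) \<le> L * dist w v * (exp (k * (x - a)) / k)" .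
    have "dist (\<Phi> w x0) (\<Phi> v x0) = exp (- k * (x - a)) * norm (integral {a..x} ?w - integral {a..x} ?v)"
      unfolding \<Phi>(2) x_def[symmetric] \<Phi>0_def dist_norm scaleR_diff_right[symmetric] by simp
    also have "\<dots> \<le> exp (- k * (x - a)) * (L * dist w v * (exp (k * (x - a)) / k))"
      using * by (intro mult_left_mono) auto
    also have "\<dots> = (exp (- k * (x - a)) * exp (k * (x - a))) * (L / k * dist w v)" by simp
    also have "exp (- k * (x - a)) * exp (k * (x - a)) = 1" by (simp flip: exp_add)
    also have "1 * (L / k * dist w v) \<le> 1/2 * dist w v"
      using k L by (simp add: k_def mult_right_mono field_simps)
    finally show "dist (\<Phi> w x0) (\<Phi> v x0) \<le> (1/2) * dist w v" .
  qed
  then obtain w where w: "\<Phi> w = w"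
    using banach_fix_type[of "1/2" \<Phi>] by auto
  define y where "y = (\<lambda>t. exp (k * (t - a)) *\<^sub>R apply_bcontfun w t)"
  have y: "y x = y0 + integral {a..x} (\<lambda>t. F t (y t))" if "x \<in> {a..b}" for x
  proof -
    have "y x = exp (k * (x - a)) *\<^sub>R \<Phi> w x" by (simp add: y_def w)
    also have "\<dots> = (exp (k * (x - a)) * exp (- k * (x - a))) *\<^sub>R (y0 + integral {a..x} (\<lambda>t. F t (y t)))"
      unfolding \<Phi>(1)[OF that] \<Phi>0_def y_def by simp
    also have "exp (k * (x - a)) * exp (- k * (x - a)) = 1" by (simp flip: exp_add)
    finally show ?thesis by simp
  qed
  have yc: "continuous_on {a..b} (\<lambda>t. F t (y t))" unfolding y_def by (rule Fc)
  have ya: "y a = y0" using y[of a] ab by simp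
  have "ac_on a b y (\<lambda>t. F t (y t))"
    unfolding ac_on_def ya using y absolutely_integrable_continuous_real[OF yc] by blast
  then show thesis using that[OF ya ac_on_deriv[OF _ yc]] by blast
qed

text \<open>
  The equation \<open>(\<sigma> u'')'' - (q u')' = g\<close> as a first-order system, with \<open>s = 1 / \<sigma>\<close>, bending moment \<open>m\<close> and
  shear force \<open>T\<close>.
\<close>

definition beam_sys ::
  "real \<Rightarrow> real \<Rightarrow> (real \<Rightarrow> real) \<Rightarrow> (real \<Rightarrow> real) \<Rightarrow> (real \<Rightarrow> 'a::euclidean_space) \<Rightarrow> (real \<Rightarrow> 'a) \<Rightarrow>
    (real \<Rightarrow> 'a) \<Rightarrow> (real \<Rightarrow> 'a) \<Rightarrow> (real \<Rightarrow> 'a) \<Rightarrow> bool" where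
  "beam_sys a b s q u \<theta> m T g \<longleftrightarrow>
     has_deriv_on a b u \<theta> \<and> has_deriv_on a b \<theta> (\<lambda>x. s x *\<^sub>R m x) \<and>
     has_deriv_on a b m (\<lambda>x. T x + q x *\<^sub>R \<theta> x) \<and> has_deriv_on a b T g"

lemma has_deriv_on_linear:
  assumes "has_deriv_on a b f f'" "bounded_linear h"
  shows "has_deriv_on a b (\<lambda>x. h (f x)) (\<lambda>x. h (f' x))"
  using assms bounded_linear.has_vector_derivative[OF assms(2)] by (auto simp: has_deriv_on_def)

lemma beam_ivp_exists:
  fixes s q g :: "real \<Rightarrow> real"
  assumes ab: "a \<le> b" and c: "continuous_on {a..b} s" "continuous_on {a..b} q" "continuous_on {a..b} g"
  obtains u \<theta> m T where "beam_sys a b s q u \<theta> m T g" "u a = u0" "\<theta> a = \<theta>0" "m a = m0" "T a = T0"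
proof -
  define F where "F = (\<lambda>t (u::real, \<theta>, m, T). (\<theta>, s t * m, T + q t * \<theta>, g t) :: real \<times> real \<times> real \<times> real)"
  have bnd: "\<exists>B\<ge>0. \<forall>t\<in>{a..b}. \<bar>h t\<bar> \<le> B" if "continuous_on {a..b} h" for h :: "real \<Rightarrow> real"
  proof -
    have "bounded (h ` {a..b})" using that by (intro compact_imp_bounded compact_continuous_image) auto
    then obtain B where "\<forall>y\<in>h ` {a..b}. norm y \<le> B" unfolding bounded_iff by blast
    then show ?thesis by (intro exI[of _ "max B 0"]) auto
  qed
  obtain s0 q0 where s0: "s0 \<ge> 0" "\<And>t. t \<in> {a..b} \<Longrightarrow> \<bar>s t\<bar> \<le> s0"
    and q0: "q0 \<ge> 0" "\<And>t. t \<in> {a..b} \<Longrightarrow> \<bar>q t\<bar> \<le> q0"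
    using bnd[OF c(1)] bnd[OF c(2)] by blast
  have n4: "norm (w, x, y, z) \<le> \<bar>w\<bar> + (\<bar>x\<bar> + (\<bar>y\<bar> + \<bar>z\<bar>))" for w x y z :: real
    using norm_Pair_le[of w "(x, y, z)"] norm_Pair_le[of x "(y, z)"] norm_Pair_le[of y z] by simp
  have c4: "\<bar>w\<bar> \<le> norm (w, x, y, z)" "\<bar>x\<bar> \<le> norm (w, x, y, z)" "\<bar>y\<bar> \<le> norm (w, x, y, z)" "\<bar>z\<bar> \<le> norm (w, x, y, z)"
    for w x y z :: real
    using norm_fst_le[of w "(x, y, z)"] norm_snd_le[of "(x, y, z)" w] norm_fst_le[of x "(y, z)"]
      norm_snd_le[of "(y, z)" x] norm_fst_le[of y z] norm_snd_le[of z y] by simp_all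
  have lip: "norm (F t x - F t y) \<le> (2 + s0 + q0) * norm (x - y)" if t: "t \<in> {a..b}" for t and x y :: "real \<times> real \<times> real \<times> real"
  proof -
    obtain x1 x2 x3 x4 y1 y2 y3 y4 where xy: "x = (x1, x2, x3, x4)" "y = (y1, y2, y3, y4)"
      by (metis prod_cases4)
    let ?n = "norm (x - y)"
    have n: "\<bar>x2 - y2\<bar> \<le> ?n" "\<bar>x3 - y3\<bar> \<le> ?n" "\<bar>x4 - y4\<bar> \<le> ?n"
      using c4[where w = "x1 - y1" and x = "x2 - y2" and y = "x3 - y3" and z = "x4 - y4"] by (simp_all add: xy)
    have "norm (F t x - F t y) \<le> \<bar>x2 - y2\<bar> + (\<bar>s t * x3 - s t * y3\<bar> + (\<bar>x4 + q t * x2 - (y4 + q t * y2)\<bar> + 0))"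
      unfolding xy F_def using n4[of "x2 - y2" "s t * x3 - s t * y3" "x4 + q t * x2 - (y4 + q t * y2)" 0] by simp
    also have "\<bar>s t * x3 - s t * y3\<bar> = \<bar>s t\<bar> * \<bar>x3 - y3\<bar>" by (simp flip: right_diff_distrib abs_mult)
    also have "\<dots> \<le> s0 * ?n" using s0 t n by (intro mult_mono) auto
    also have "\<bar>x4 + q t * x2 - (y4 + q t * y2)\<bar> \<le> \<bar>x4 - y4\<bar> + \<bar>q t\<bar> * \<bar>x2 - y2\<bar>"
    proof -
      have "x4 + q t * x2 - (y4 + q t * y2) = (x4 - y4) + q t * (x2 - y2)" by (simp add: algebra_simps)
      then show ?thesis using abs_triangle_ineq[of "x4 - y4" "q t * (x2 - y2)"] by (simp add: abs_mult)
    qed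
    also have "\<bar>q t\<bar> * \<bar>x2 - y2\<bar> \<le> q0 * ?n" using q0 t n by (intro mult_mono) auto
    finally show ?thesis using n by (simp add: algebra_simps)
  qed
  have cF: "continuous_on {a..b} (\<lambda>t. F t (y t))" if "continuous_on {a..b} y" for y
    unfolding F_def case_prod_beta using that c by (intro continuous_intros)
  obtain y where y: "y a = (u0, \<theta>0, m0, T0)" "has_deriv_on a b y (\<lambda>t. F t (y t))"
    using lipschitz_ivp_exists[OF ab _ lip cF, of "(u0, \<theta>0, m0, T0)"] s0 q0 by auto
  have "beam_sys a b s q (\<lambda>t. fst (y t)) (\<lambda>t. fst (snd (y t))) (\<lambda>t. fst (snd (snd (y t))))
      (\<lambda>t. snd (snd (snd (y t)))) g"
    using has_deriv_on_linear[OF y(2) bounded_linear_fst]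
      has_deriv_on_linear[OF y(2) bounded_linear_compose[OF bounded_linear_fst bounded_linear_snd]]
      has_deriv_on_linear[OF y(2) bounded_linear_compose[OF bounded_linear_fst
        bounded_linear_compose[OF bounded_linear_snd bounded_linear_snd]]]
      has_deriv_on_linear[OF y(2) bounded_linear_compose[OF bounded_linear_snd
        bounded_linear_compose[OF bounded_linear_snd bounded_linear_snd]]]
    unfolding beam_sys_def F_def case_prod_beta by simp
  then show thesis by (rule that) (simp_all add: y)
qed

section \<open>Nonnegative solutions\<close>

lemma has_deriv_on_mono:
  fixes f :: "real \<Rightarrow> real"
  assumes f: "has_deriv_on a b f f'" and nn: "\<And>t. t \<in> {a..b} \<Longrightarrow> 0 \<le> f' t"
    and xy: "a \<le> x" "x \<le> y" "y \<le> b"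
  shows "f x \<le> f y"
proof -
  have "\<exists>t\<in>{x..y}. f y - f x = (\<lambda>h. h *\<^sub>R f' t) (y - x)"
  proof (rule mvt_very_simple[OF xy(2)])
    fix t assume t: "x \<le> t" "t \<le> y"
    then have "(f has_vector_derivative f' t) (at t within {a..b})"
      using f xy by (simp add: has_deriv_on_def)
    then have "(f has_vector_derivative f' t) (at t within {x..y})"
      by (rule has_vector_derivative_within_subset) (use xy in auto)
    then show "(f has_derivative (\<lambda>h. h *\<^sub>R f' t)) (at t within {x..y})"
      by (simp add: has_vector_derivative_def)
  qed
  then obtain t where t: "t \<in> {x..y}" "f y - f x = (y - x) * f' t" by auto
  have "0 \<le> (y - x) * f' t" using nn[of t] t(1) xy by (intro mult_nonneg_nonneg) auto
  then show ?thesis using t(2) by simp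
qed

text \<open>
  \<open>exp (- K x) \<integral>\<^sub>a\<^sup>x n\<close> is nonincreasing and starts at \<open>0\<close>.
\<close>

lemma gronwall_zero:
  fixes n :: "real \<Rightarrow> real"
  assumes c: "continuous_on {a..b} n" and nn: "\<And>x. x \<in> {a..b} \<Longrightarrow> 0 \<le> n x"
    and le: "\<And>x. x \<in> {a..b} \<Longrightarrow> n x \<le> K * integral {a..x} n" and x: "x \<in> {a..b}"
  shows "n x = 0"
proof -
  define h where "h = (\<lambda>x. - (exp (- K * x) * integral {a..x} n))"
  have d: "has_deriv_on a b h (\<lambda>t. exp (- K * t) * (K * integral {a..t} n - n t))"
    unfolding has_deriv_on_def
  proof
    fix t assume t: "t \<in> {a..b}"
    have "((\<lambda>x. integral {a..x} n) has_real_derivative n t) (at t within {a..b})"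
      using integral_has_real_derivative[OF c t] .
    then have "(h has_real_derivative exp (- K * t) * (K * integral {a..t} n - n t)) (at t within {a..b})"
      unfolding h_def by (auto intro!: derivative_eq_intros simp: algebra_simps)
    then show "(h has_vector_derivative exp (- K * t) * (K * integral {a..t} n - n t)) (at t within {a..b})"
      by (simp add: has_real_derivative_iff_has_vector_derivative)
  qed
  have "h a \<le> h x"
    by (rule has_deriv_on_mono[OF d]) (use le x in auto)
  then have "integral {a..x} n \<le> 0" by (simp add: h_def mult_le_0_iff)
  moreover have "integral {a..x} n \<ge> 0"
    using x by (intro integral_nonneg integrable_continuous_real continuous_on_subset[OF c] nn) auto
  ultimately show ?thesis using le[OF x] nn[OF x] by simp
qed

lemma continuous_on_bounded_abs:
  fixes h :: "real \<Rightarrow> real"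
  assumes "continuous_on {a..b} h"
  obtains B where "B \<ge> 0" "\<And>t. t \<in> {a..b} \<Longrightarrow> \<bar>h t\<bar> \<le> B"
proof -
  have "bounded (h ` {a..b})" using assms by (intro compact_imp_bounded compact_continuous_image) auto
  then obtain B where B: "\<forall>y\<in>h ` {a..b}. norm y \<le> B" unfolding bounded_iff by blast
  have "\<bar>h t\<bar> \<le> max B 0" if "t \<in> {a..b}" for t using B that by (intro order_trans[OF _ max.cobounded1]) auto
  then show thesis by (intro that[of "max B 0"]) auto
qed

lemma neg_part_le_integral:
  fixes y f n :: "real \<Rightarrow> real"
  assumes d: "has_deriv_on a b y f" and c: "continuous_on {a..b} f" "continuous_on {a..b} n"
    and y: "0 \<le> y a" and f: "\<And>t. t \<in> {a..b} \<Longrightarrow> f t \<ge> - (k * n t)" and x: "x \<in> {a..b}"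
    and k: "0 \<le> k" "\<And>t. t \<in> {a..b} \<Longrightarrow> 0 \<le> n t"
  shows "max 0 (- y x) \<le> k * integral {a..x} n"
proof -
  have i: "f integrable_on {a..x}" "n integrable_on {a..x}"
    using x by (auto intro!: integrable_continuous_real continuous_on_subset[OF c(1)] continuous_on_subset[OF c(2)])
  have "integral {a..x} (\<lambda>t. - k * n t) \<le> integral {a..x} f"
    using i f x integrable_cmul[OF i(2), of "- k"] by (intro integral_le) auto
  moreover have "y x = y a + integral {a..x} f" by (rule ac_onD[OF ac_on_C1[OF d c(1)] x])
  moreover have "0 \<le> k * integral {a..x} n"
    using k i x by (intro mult_nonneg_nonneg integral_nonneg) auto
  ultimately show ?thesis using y by simp
qed

text \<open>
  Let \<open>n\<close> be the sum of the negative parts of the four components. Since the coefficients are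
  nonnegative, each derivative is bounded below by a multiple of \<open>- n\<close>, which bounds \<open>n\<close> by a multiple of
  its own integral.
\<close>

lemma beam_sys_nonneg:
  fixes u \<theta> m T s q c :: "real \<Rightarrow> real"
  assumes sys: "beam_sys a b s q u \<theta> m T (\<lambda>x. c x * u x)"
    and cont: "continuous_on {a..b} s" "continuous_on {a..b} q" "continuous_on {a..b} c"
    and nn: "\<And>x. x \<in> {a..b} \<Longrightarrow> 0 \<le> s x" "\<And>x. x \<in> {a..b} \<Longrightarrow> 0 \<le> q x" "\<And>x. x \<in> {a..b} \<Longrightarrow> 0 \<le> c x"
    and init: "0 \<le> u a" "0 \<le> \<theta> a" "0 \<le> m a" "0 \<le> T a" and x: "x \<in> {a..b}"
  shows "0 \<le> u x" "0 \<le> \<theta> x" "0 \<le> m x" "0 \<le> T x"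
proof -
  have d: "has_deriv_on a b u \<theta>" "has_deriv_on a b \<theta> (\<lambda>x. s x * m x)"
    "has_deriv_on a b m (\<lambda>x. T x + q x * \<theta> x)" "has_deriv_on a b T (\<lambda>x. c x * u x)"
    using sys by (auto simp: beam_sys_def)
  note co = d[THEN has_deriv_on_continuous]
  define n where "n = (\<lambda>x. max 0 (- u x) + max 0 (- \<theta> x) + max 0 (- m x) + max 0 (- T x))"
  have cn: "continuous_on {a..b} n" unfolding n_def using co by (intro continuous_intros)
  have n0: "0 \<le> n x" for x by (simp add: n_def)
  have ng: "\<theta> x \<ge> - n x" "m x \<ge> - n x" "T x \<ge> - n x" "u x \<ge> - n x" for x by (auto simp: n_def)
  obtain s0 q0 c0 where B: "0 \<le> s0" "\<And>t. t \<in> {a..b} \<Longrightarrow> \<bar>s t\<bar> \<le> s0" "0 \<le> q0" "\<And>t. t \<in> {a..b} \<Longrightarrow> \<bar>q t\<bar> \<le> q0"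
    "0 \<le> c0" "\<And>t. t \<in> {a..b} \<Longrightarrow> \<bar>c t\<bar> \<le> c0"
    using continuous_on_bounded_abs[OF cont(1)] continuous_on_bounded_abs[OF cont(2)]
      continuous_on_bounded_abs[OF cont(3)] by metis
  have mul: "h * z \<ge> - (B * w)" if "0 \<le> h" "\<bar>h\<bar> \<le> B" "z \<ge> - w" "0 \<le> w" for h z B w :: real
  proof -
    have "- (h * w) \<le> h * z" using that mult_left_mono[of "-w" z h] by simp
    moreover have "h * w \<le> B * w" using that by (intro mult_right_mono) auto
    ultimately show ?thesis by linarith
  qed
  have e: "n x \<le> (1 + s0 + (1 + q0) + c0) * integral {a..x} n" if x: "x \<in> {a..b}" for x
  proof -
    have "max 0 (- u x) \<le> 1 * integral {a..x} n"
      by (rule neg_part_le_integral[OF d(1)]) (use co cn init x ng n0 in auto)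
    moreover have "max 0 (- \<theta> x) \<le> s0 * integral {a..x} n"
      by (rule neg_part_le_integral[OF d(2)])
        (use co cn init x ng n0 cont B nn in \<open>auto intro!: continuous_intros mul\<close>)
    moreover have "max 0 (- m x) \<le> (1 + q0) * integral {a..x} n"
    proof (rule neg_part_le_integral[OF d(3)])
      fix t assume t: "t \<in> {a..b}"
      have "q t * \<theta> t \<ge> - (q0 * n t)" using t ng n0 B nn by (intro mul) auto
      then show "T t + q t * \<theta> t \<ge> - ((1 + q0) * n t)" using ng(3)[of t] by (simp add: algebra_simps)
    qed (use co cn init x n0 cont B in \<open>auto intro!: continuous_intros\<close>)
    moreover have "max 0 (- T x) \<le> c0 * integral {a..x} n"
      by (rule neg_part_le_integral[OF d(4)])
        (use co cn init x ng n0 cont B nn in \<open>auto intro!: continuous_intros mul\<close>)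
    moreover have "n x = max 0 (- u x) + max 0 (- \<theta> x) + max 0 (- m x) + max 0 (- T x)" by (simp add: n_def)
    ultimately show ?thesis unfolding distrib_right by linarith
  qed
  have "n x = 0" by (rule gronwall_zero[OF cn n0 e x])
  then show "0 \<le> u x" "0 \<le> \<theta> x" "0 \<le> m x" "0 \<le> T x" by (auto simp: n_def max_def split: if_splits)
qed

section \<open>Linearity, reflection and Green's identity for a single beam\<close>

lemma has_deriv_on_lincomb:
  fixes f g :: "real \<Rightarrow> 'a::euclidean_space"
  assumes "has_deriv_on a b f f'" "has_deriv_on a b g g'"
  shows "has_deriv_on a b (\<lambda>x. f x + c *\<^sub>R g x) (\<lambda>x. f' x + c *\<^sub>R g' x)"
  using assms unfolding has_deriv_on_def by (auto intro!: derivative_eq_intros)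

lemma has_deriv_on_cong:
  assumes "has_deriv_on a b f f'" "\<And>x. x \<in> {a..b} \<Longrightarrow> f x = g x" "\<And>x. x \<in> {a..b} \<Longrightarrow> f' x = g' x"
  shows "has_deriv_on a b g g'"
  unfolding has_deriv_on_def
proof
  fix x assume x: "x \<in> {a..b}"
  have "(f has_vector_derivative g' x) (at x within {a..b})"
    using assms(1,3) x by (auto simp: has_deriv_on_def)
  then show "(g has_vector_derivative g' x) (at x within {a..b})"
    by (rule has_vector_derivative_transform[OF x, rotated]) (simp add: assms(2))
qed

lemma has_deriv_on_reflect:
  fixes f :: "real \<Rightarrow> 'a::euclidean_space"
  assumes "has_deriv_on a b f f'"
  shows "has_deriv_on (- b) (- a) (\<lambda>x. f (- x)) (\<lambda>x. - f' (- x))"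
  unfolding has_deriv_on_def
proof
  fix x assume x: "x \<in> {- b..- a}"
  then have "(f has_vector_derivative f' (- x)) (at (- x) within {a..b})"
    using assms by (auto simp: has_deriv_on_def)
  moreover have "uminus ` {- b..- a} = {a..b}" by simp
  ultimately have "(f has_vector_derivative f' (- x)) (at (- x) within uminus ` {- b..- a})" by simp
  then have "((f \<circ> uminus) has_vector_derivative (- 1) *\<^sub>R f' (- x)) (at x within {- b..- a})"
    by (intro vector_diff_chain_within) (auto intro!: derivative_eq_intros)
  then show "((\<lambda>x. f (- x)) has_vector_derivative - f' (- x)) (at x within {- b..- a})"
    by (simp add: o_def)
qed

lemma has_deriv_on_unique:
  assumes "a < b" "has_deriv_on a b f f'" "has_deriv_on a b f g'" "x \<in> {a..b}"
  shows "f' x = g' x"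
  using assms vector_derivative_unique_within_closed_interval[of a b x f "f' x" "g' x"]
  by (auto simp: has_deriv_on_def)

lemma beam_sys_lincomb:
  fixes u v :: "real \<Rightarrow> 'a::euclidean_space"
  assumes "beam_sys a b s q u \<theta> m T g" "beam_sys a b s q v \<phi> n R h"
  shows "beam_sys a b s q (\<lambda>x. u x + c *\<^sub>R v x) (\<lambda>x. \<theta> x + c *\<^sub>R \<phi> x) (\<lambda>x. m x + c *\<^sub>R n x)
    (\<lambda>x. T x + c *\<^sub>R R x) (\<lambda>x. g x + c *\<^sub>R h x)"
proof -
  have d: "has_deriv_on a b u \<theta>" "has_deriv_on a b \<theta> (\<lambda>x. s x *\<^sub>R m x)"
    "has_deriv_on a b m (\<lambda>x. T x + q x *\<^sub>R \<theta> x)" "has_deriv_on a b T g"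
    "has_deriv_on a b v \<phi>" "has_deriv_on a b \<phi> (\<lambda>x. s x *\<^sub>R n x)"
    "has_deriv_on a b n (\<lambda>x. R x + q x *\<^sub>R \<phi> x)" "has_deriv_on a b R h"
    using assms by (auto simp: beam_sys_def)
  show ?thesis
    unfolding beam_sys_def
    using has_deriv_on_lincomb[OF d(1,5), of c] has_deriv_on_lincomb[OF d(2,6), of c]
      has_deriv_on_lincomb[OF d(3,7), of c] has_deriv_on_lincomb[OF d(4,8), of c]
    by (simp add: algebra_simps)
qed

text \<open>
  Under \<open>x \<mapsto> -x\<close> the odd-order quantities \<open>\<theta>\<close> and \<open>T\<close> change sign and the system keeps its form.
\<close>

lemma beam_sys_reflect:
  fixes u :: "real \<Rightarrow> 'a::euclidean_space"
  assumes "beam_sys a b s q u \<theta> m T g"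
  shows "beam_sys (- b) (- a) (\<lambda>x. s (- x)) (\<lambda>x. q (- x)) (\<lambda>x. u (- x)) (\<lambda>x. - \<theta> (- x)) (\<lambda>x. m (- x))
    (\<lambda>x. - T (- x)) (\<lambda>x. g (- x))"
proof -
  have d: "has_deriv_on a b u \<theta>" "has_deriv_on a b \<theta> (\<lambda>x. s x *\<^sub>R m x)"
    "has_deriv_on a b m (\<lambda>x. T x + q x *\<^sub>R \<theta> x)" "has_deriv_on a b T g"
    using assms by (auto simp: beam_sys_def)
  have neg: "has_deriv_on a b (\<lambda>x. - f x) (\<lambda>x. - f' x)" if "has_deriv_on a b f f'" for f f' :: "real \<Rightarrow> 'a"
    using has_deriv_on_linear[OF that bounded_linear_minus[OF bounded_linear_ident]] .
  show ?thesis
    unfolding beam_sys_def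
    using has_deriv_on_reflect[OF d(1)] has_deriv_on_reflect[OF neg[OF d(2)]]
      has_deriv_on_reflect[OF d(3)] has_deriv_on_reflect[OF neg[OF d(4)]]
    by simp
qed

lemma beam_sys_linear:
  assumes "beam_sys a b s q u \<theta> m T g" "bounded_linear h"
  shows "beam_sys a b s q (\<lambda>x. h (u x)) (\<lambda>x. h (\<theta> x)) (\<lambda>x. h (m x)) (\<lambda>x. h (T x)) (\<lambda>x. h (g x))"
proof -
  interpret bounded_linear h by fact
  have d: "has_deriv_on a b u \<theta>" "has_deriv_on a b \<theta> (\<lambda>x. s x *\<^sub>R m x)"
    "has_deriv_on a b m (\<lambda>x. T x + q x *\<^sub>R \<theta> x)" "has_deriv_on a b T g"
    using assms by (auto simp: beam_sys_def)
  show ?thesis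
    unfolding beam_sys_def using d[THEN has_deriv_on_linear, OF assms(2)] by (simp add: add scaleR)
qed

lemma beam_sys_cong:
  assumes "beam_sys a b s q u \<theta> m T g" "\<And>x. x \<in> {a..b} \<Longrightarrow> u x = u' x" "\<And>x. x \<in> {a..b} \<Longrightarrow> \<theta> x = \<theta>' x"
    "\<And>x. x \<in> {a..b} \<Longrightarrow> m x = m' x" "\<And>x. x \<in> {a..b} \<Longrightarrow> T x = T' x" "\<And>x. x \<in> {a..b} \<Longrightarrow> g x = g' x"
  shows "beam_sys a b s q u' \<theta>' m' T' g'"
proof -
  have d: "has_deriv_on a b u \<theta>" "has_deriv_on a b \<theta> (\<lambda>x. s x *\<^sub>R m x)"
    "has_deriv_on a b m (\<lambda>x. T x + q x *\<^sub>R \<theta> x)" "has_deriv_on a b T g"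
    using assms(1) by (auto simp: beam_sys_def)
  show ?thesis
    unfolding beam_sys_def
  proof (intro conjI)
    show "has_deriv_on a b u' \<theta>'" by (rule has_deriv_on_cong[OF d(1)]) (simp_all add: assms)
    show "has_deriv_on a b \<theta>' (\<lambda>x. s x *\<^sub>R m' x)"
      by (rule has_deriv_on_cong[OF d(2)]) (simp_all add: assms)
    show "has_deriv_on a b m' (\<lambda>x. T' x + q x *\<^sub>R \<theta>' x)"
      by (rule has_deriv_on_cong[OF d(3)]) (simp_all add: assms)
    show "has_deriv_on a b T' g'" by (rule has_deriv_on_cong[OF d(4)]) (simp_all add: assms)
  qed
qed

lemma beam_sys_continuous:
  assumes "beam_sys a b s q u \<theta> m T g"
  shows "continuous_on {a..b} u" "continuous_on {a..b} \<theta>" "continuous_on {a..b} m" "continuous_on {a..b} T"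
  using assms has_deriv_on_continuous unfolding beam_sys_def by blast+

text \<open>
  \<open>(T v - m \<phi>)' = g v - s m n - q \<theta> \<phi>\<close>: the terms \<open>T \<phi>\<close> cancel.
\<close>

lemma beam_sys_green:
  fixes u v s q g h :: "real \<Rightarrow> real"
  assumes ab: "a \<le> b" and u: "beam_sys a b s q u \<theta> m T g" and v: "beam_sys a b s q v \<phi> n R h"
    and c: "continuous_on {a..b} s" "continuous_on {a..b} q" "continuous_on {a..b} g"
  shows "integral {a..b} (\<lambda>x. g x * v x) - integral {a..b} (\<lambda>x. s x * m x * n x + q x * \<theta> x * \<phi> x)
    = (T b * v b - m b * \<phi> b) - (T a * v a - m a * \<phi> a)"
proof -
  have i: "(\<lambda>x. g x * v x) integrable_on {a..b}" "(\<lambda>x. s x * m x * n x + q x * \<theta> x * \<phi> x) integrable_on {a..b}"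
    using c beam_sys_continuous[OF u] beam_sys_continuous[OF v]
    by (auto intro!: integrable_continuous_real continuous_intros)
  have "((\<lambda>x. g x * v x - (s x * m x * n x + q x * \<theta> x * \<phi> x)) has_integral
      ((T b * v b - m b * \<phi> b) - (T a * v a - m a * \<phi> a))) {a..b}"
  proof (rule fundamental_theorem_of_calculus[OF ab])
    fix x assume x: "x \<in> {a..b}"
    have "(T has_real_derivative g x) (at x within {a..b})" "(v has_real_derivative \<phi> x) (at x within {a..b})"
      "(m has_real_derivative T x + q x * \<theta> x) (at x within {a..b})" "(\<phi> has_real_derivative s x * n x) (at x within {a..b})"
      using u v x by (auto simp: beam_sys_def has_deriv_on_def has_real_derivative_iff_has_vector_derivative)
    then have "((\<lambda>x. T x * v x - m x * \<phi> x) has_real_derivative (g x * v x - (s x * m x * n x + q x * \<theta> x * \<phi> x))) (at x within {a..b})"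
      by (auto intro!: derivative_eq_intros simp: algebra_simps)
    then show "((\<lambda>x. T x * v x - m x * \<phi> x) has_vector_derivative (g x * v x - (s x * m x * n x + q x * \<theta> x * \<phi> x))) (at x within {a..b})"
      by (simp add: has_real_derivative_iff_has_vector_derivative)
  qed
  then show ?thesis using i by (simp add: integral_unique integral_diff[symmetric])
qed

lemma quadratic_nonneg_imp_square_le:
  fixes A B C :: real
  assumes A: "0 \<le> A" and q: "\<And>z. 0 \<le> z\<^sup>2 * A - 2 * z * B + C"
  shows "B\<^sup>2 \<le> A * C"
proof (cases "A = 0")
  case True
  have "B = 0"
  proof (rule ccontr)
    assume "B \<noteq> 0"
    then show False using q[of "(C + 1) / (2 * B)"] True by simp
  qed
  then show ?thesis using True by simp
next
  case False
  have "(B / A)\<^sup>2 * A - 2 * (B / A) * B + C = C - B\<^sup>2 / A"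
    using False by (simp add: field_simps power2_eq_square)
  then have "B\<^sup>2 / A \<le> C" using q[of "B / A"] by simp
  then show ?thesis using A False by (simp add: field_simps)
qed

lemma weighted_integral_cauchy_schwarz:
  fixes s m :: "real \<Rightarrow> real"
  assumes c: "continuous_on {x..y} s" "continuous_on {x..y} m" and nn: "\<And>t. t \<in> {x..y} \<Longrightarrow> 0 \<le> s t"
  shows "(integral {x..y} (\<lambda>t. s t * m t))\<^sup>2 \<le> integral {x..y} s * integral {x..y} (\<lambda>t. s t * (m t)\<^sup>2)"
proof -
  let ?A = "integral {x..y} s" and ?B = "integral {x..y} (\<lambda>t. s t * m t)" and ?C = "integral {x..y} (\<lambda>t. s t * (m t)\<^sup>2)"
  have i: "s integrable_on {x..y}" "(\<lambda>t. s t * m t) integrable_on {x..y}" "(\<lambda>t. s t * (m t)\<^sup>2) integrable_on {x..y}"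
    using c by (auto intro!: integrable_continuous_real continuous_intros)
  have q: "0 \<le> z\<^sup>2 * ?A - 2 * z * ?B + ?C" for z
  proof -
    have "0 \<le> integral {x..y} (\<lambda>t. s t * (z - m t)\<^sup>2)"
      using c nn by (intro integral_nonneg integrable_continuous_real continuous_intros) auto
    also have "(\<lambda>t. s t * (z - m t)\<^sup>2) = (\<lambda>t. z\<^sup>2 * s t - 2 * z * (s t * m t) + s t * (m t)\<^sup>2)"
      by (simp add: fun_eq_iff power2_eq_square algebra_simps)
    also have "integral {x..y} (\<lambda>t. z\<^sup>2 * s t - 2 * z * (s t * m t) + s t * (m t)\<^sup>2) = z\<^sup>2 * ?A - 2 * z * ?B + ?C"
      using i integrable_cmul[OF i(1), of "z\<^sup>2"] integrable_cmul[OF i(2), of "2 * z"]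
      by (simp add: integral_add integral_diff integrable_diff)
    finally show ?thesis .
  qed
  have "0 \<le> ?A" using i nn by (intro integral_nonneg) auto
  then show ?thesis using q by (rule quadratic_nonneg_imp_square_le)
qed

section \<open>The coupled boundary value problem\<close>

text \<open>
  Here \<open>s1\<close>, \<open>s2\<close> stand for \<open>1 / \<sigma>\<^sub>1\<close>, \<open>1 / \<sigma>\<^sub>2\<close> and \<open>r1\<close>, \<open>r2\<close> for the densities.
\<close>

locale two_beams =
  fixes M :: real and s1 s2 q1 q2 r1 r2 :: "real \<Rightarrow> real"
  assumes M: "M > 0"
    and cs: "continuous_on {-1..0} s1" "continuous_on {0..1} s2"
    and cq: "continuous_on {-1..0} q1" "continuous_on {0..1} q2"
    and cr: "continuous_on {-1..0} r1" "continuous_on {0..1} r2"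
    and s: "\<And>x. x \<in> {-1..0} \<Longrightarrow> 0 < s1 x" "\<And>x. x \<in> {0..1} \<Longrightarrow> 0 < s2 x"
    and q: "\<And>x. x \<in> {-1..0} \<Longrightarrow> 0 \<le> q1 x" "\<And>x. x \<in> {0..1} \<Longrightarrow> 0 \<le> q2 x"
    and r: "\<And>x. x \<in> {-1..0} \<Longrightarrow> 0 < r1 x" "\<And>x. x \<in> {0..1} \<Longrightarrow> 0 < r2 x"
begin

text \<open>
  Solutions for the load \<open>f\<close> that satisfy the conditions at \<open>-1\<close> and \<open>0\<close>, but not necessarily those at
  \<open>1\<close>. Using the same \<open>u\<close>, \<open>\<theta>\<close>, \<open>m\<close> on both intervals encodes their continuity at \<open>0\<close>; the two shear forces
  differ there by the force of the point mass.
\<close>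

definition shoot :: "(real \<Rightarrow> 'a::euclidean_space) \<Rightarrow> (real \<Rightarrow> 'a) \<Rightarrow> (real \<Rightarrow> 'a) \<Rightarrow> (real \<Rightarrow> 'a) \<Rightarrow> (real \<Rightarrow> 'a) \<Rightarrow> (real \<Rightarrow> 'a) \<Rightarrow> bool" where
  "shoot f u \<theta> m T1 T2 \<longleftrightarrow>
     beam_sys (-1) 0 s1 q1 u \<theta> m T1 (\<lambda>x. r1 x *\<^sub>R f x) \<and> beam_sys 0 1 s2 q2 u \<theta> m T2 (\<lambda>x. r2 x *\<^sub>R f x) \<and>
     u (-1) = 0 \<and> m (-1) = 0 \<and> T1 0 - T2 0 = - (M *\<^sub>R f 0)"

text \<open>
  The spectral problem is the case \<open>f = \<lambda> u\<close>; a general load is needed for the solution operator and for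
  Jordan chains.
\<close>

definition bvp :: "(real \<Rightarrow> 'a::euclidean_space) \<Rightarrow> (real \<Rightarrow> 'a) \<Rightarrow> (real \<Rightarrow> 'a) \<Rightarrow> (real \<Rightarrow> 'a) \<Rightarrow> (real \<Rightarrow> 'a) \<Rightarrow> (real \<Rightarrow> 'a) \<Rightarrow> bool" where
  "bvp f u \<theta> m T1 T2 \<longleftrightarrow>
     beam_sys (-1) 0 s1 q1 u \<theta> m T1 (\<lambda>x. r1 x *\<^sub>R f x) \<and> beam_sys 0 1 s2 q2 u \<theta> m T2 (\<lambda>x. r2 x *\<^sub>R f x) \<and>
     u (-1) = 0 \<and> m (-1) = 0 \<and> u 1 = 0 \<and> m 1 = 0 \<and> T1 0 - T2 0 = - (M *\<^sub>R f 0)"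

definition mass_inner :: "(real \<Rightarrow> real) \<Rightarrow> (real \<Rightarrow> real) \<Rightarrow> real" where
  "mass_inner f g = integral {-1..0} (\<lambda>x. r1 x * f x * g x) + integral {0..1} (\<lambda>x. r2 x * f x * g x) + M * f 0 * g 0"

definition energy :: "(real \<Rightarrow> real) \<Rightarrow> (real \<Rightarrow> real) \<Rightarrow> (real \<Rightarrow> real) \<Rightarrow> (real \<Rightarrow> real) \<Rightarrow> real" where
  "energy \<theta> m \<phi> n = integral {-1..0} (\<lambda>x. s1 x * m x * n x + q1 x * \<theta> x * \<phi> x)
     + integral {0..1} (\<lambda>x. s2 x * m x * n x + q2 x * \<theta> x * \<phi> x)"

lemma split_interval: "{-1..1::real} = {-1..0} \<union> {0..1}" by auto

lemma continuous_on_glue: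
  fixes f :: "real \<Rightarrow> 'a::euclidean_space"
  shows "continuous_on {-1..1} f \<longleftrightarrow> continuous_on {-1..0} f \<and> continuous_on {0..1} f"
proof
  assume "continuous_on {-1..0} f \<and> continuous_on {0..1} f"
  then show "continuous_on {-1..1} f" unfolding split_interval by (intro continuous_on_closed_Un) auto
qed (auto intro: continuous_on_subset)

lemma bvp_continuous:
  fixes u :: "real \<Rightarrow> 'a::euclidean_space"
  assumes "bvp f u \<theta> m T1 T2"
  shows "continuous_on {-1..1} u" "continuous_on {-1..1} \<theta>" "continuous_on {-1..1} m"
proof -
  have 1: "beam_sys (-1) 0 s1 q1 u \<theta> m T1 (\<lambda>x. r1 x *\<^sub>R f x)" and 2: "beam_sys 0 1 s2 q2 u \<theta> m T2 (\<lambda>x. r2 x *\<^sub>R f x)"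
    using assms by (auto simp: bvp_def)
  show "continuous_on {-1..1} u" "continuous_on {-1..1} \<theta>" "continuous_on {-1..1} m"
    unfolding continuous_on_glue using beam_sys_continuous[OF 1] beam_sys_continuous[OF 2] by auto
qed

lemma bvp_iff_shoot: "bvp f u \<theta> m T1 T2 \<longleftrightarrow> shoot f u \<theta> m T1 T2 \<and> u 1 = 0 \<and> m 1 = 0"
  by (auto simp: bvp_def shoot_def)

lemma shoot_lincomb:
  fixes u v :: "real \<Rightarrow> 'a::euclidean_space"
  assumes u: "shoot f u \<theta> m T1 T2" and v: "shoot g v \<phi> n R1 R2"
  shows "shoot (\<lambda>x. f x + c *\<^sub>R g x) (\<lambda>x. u x + c *\<^sub>R v x) (\<lambda>x. \<theta> x + c *\<^sub>R \<phi> x) (\<lambda>x. m x + c *\<^sub>R n x)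
    (\<lambda>x. T1 x + c *\<^sub>R R1 x) (\<lambda>x. T2 x + c *\<^sub>R R2 x)"
proof -
  have "beam_sys (-1) 0 s1 q1 (\<lambda>x. u x + c *\<^sub>R v x) (\<lambda>x. \<theta> x + c *\<^sub>R \<phi> x) (\<lambda>x. m x + c *\<^sub>R n x)
    (\<lambda>x. T1 x + c *\<^sub>R R1 x) (\<lambda>x. r1 x *\<^sub>R f x + c *\<^sub>R (r1 x *\<^sub>R g x))"
    using u v by (intro beam_sys_lincomb) (auto simp: shoot_def)
  moreover have "beam_sys 0 1 s2 q2 (\<lambda>x. u x + c *\<^sub>R v x) (\<lambda>x. \<theta> x + c *\<^sub>R \<phi> x) (\<lambda>x. m x + c *\<^sub>R n x)
    (\<lambda>x. T2 x + c *\<^sub>R R2 x) (\<lambda>x. r2 x *\<^sub>R f x + c *\<^sub>R (r2 x *\<^sub>R g x))"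
    using u v by (intro beam_sys_lincomb) (auto simp: shoot_def)
  moreover have "T1 0 + c *\<^sub>R R1 0 - (T2 0 + c *\<^sub>R R2 0) = - (M *\<^sub>R (f 0 + c *\<^sub>R g 0))"
  proof -
    have T: "T1 0 = T2 0 - M *\<^sub>R f 0" "R1 0 = R2 0 - M *\<^sub>R g 0"
      using u v by (auto simp: shoot_def algebra_simps)
    show ?thesis unfolding T by (simp add: algebra_simps)
  qed
  ultimately show ?thesis using u v by (simp add: shoot_def algebra_simps)
qed

lemma bvp_lincomb:
  fixes u v :: "real \<Rightarrow> 'a::euclidean_space"
  assumes "bvp f u \<theta> m T1 T2" "bvp g v \<phi> n R1 R2"
  shows "bvp (\<lambda>x. f x + c *\<^sub>R g x) (\<lambda>x. u x + c *\<^sub>R v x) (\<lambda>x. \<theta> x + c *\<^sub>R \<phi> x) (\<lambda>x. m x + c *\<^sub>R n x)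
    (\<lambda>x. T1 x + c *\<^sub>R R1 x) (\<lambda>x. T2 x + c *\<^sub>R R2 x)"
  using assms shoot_lincomb[of f u \<theta> m T1 T2 g v \<phi> n R1 R2 c] by (simp add: bvp_iff_shoot)

lemma bvp_linear:
  assumes "bvp f u \<theta> m T1 T2" "bounded_linear h"
  shows "bvp (\<lambda>x. h (f x)) (\<lambda>x. h (u x)) (\<lambda>x. h (\<theta> x)) (\<lambda>x. h (m x)) (\<lambda>x. h (T1 x)) (\<lambda>x. h (T2 x))"
proof -
  interpret bounded_linear h by fact
  have "h (T1 0) - h (T2 0) = - (M *\<^sub>R h (f 0))"
    using assms(1) arg_cong[of _ _ h] unfolding bvp_def by (metis diff neg scaleR)
  then show ?thesis
    using beam_sys_linear[OF _ assms(2), of "-1" 0 s1 q1 u \<theta> m T1 "\<lambda>x. r1 x *\<^sub>R f x"]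
      beam_sys_linear[OF _ assms(2), of 0 1 s2 q2 u \<theta> m T2 "\<lambda>x. r2 x *\<^sub>R f x"] assms(1)
    by (simp add: bvp_def scaleR zero)
qed

text \<open>
  The boundary terms at the ends vanish, and those at \<open>0\<close> combine into \<open>(T1 0 - T2 0) v 0\<close>, which is
  minus the point-mass part of the inner product.
\<close>

lemma bvp_green:
  assumes u: "bvp f u \<theta> m T1 T2" and v: "bvp g v \<phi> n R1 R2" and f: "continuous_on {-1..1} f"
  shows "mass_inner f v = energy \<theta> m \<phi> n"
proof -
  have fc: "continuous_on {-1..0} f" "continuous_on {0..1} f" using f by (auto simp: continuous_on_glue)
  have 1: "integral {-1..0} (\<lambda>x. r1 x * f x * v x) - integral {-1..0} (\<lambda>x. s1 x * m x * n x + q1 x * \<theta> x * \<phi> x)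
    = (T1 0 * v 0 - m 0 * \<phi> 0) - (T1 (-1) * v (-1) - m (-1) * \<phi> (-1))"
    using u v by (intro beam_sys_green) (auto simp: bvp_def intro!: continuous_intros cs cq cr fc)
  have 2: "integral {0..1} (\<lambda>x. r2 x * f x * v x) - integral {0..1} (\<lambda>x. s2 x * m x * n x + q2 x * \<theta> x * \<phi> x)
    = (T2 1 * v 1 - m 1 * \<phi> 1) - (T2 0 * v 0 - m 0 * \<phi> 0)"
    using u v by (intro beam_sys_green) (auto simp: bvp_def intro!: continuous_intros cs cq cr fc)
  have T: "T1 0 = T2 0 - M * f 0" using u by (simp add: bvp_def)
  have "T1 0 * v 0 = T2 0 * v 0 - M * f 0 * v 0" unfolding T by (simp add: algebra_simps)
  then show ?thesis using 1 2 u v by (simp add: mass_inner_def energy_def bvp_def)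
qed

lemma energy_commute: "energy \<theta> m \<phi> n = energy \<phi> n \<theta> m"
  by (simp add: energy_def mult_ac)

lemma mass_inner_commute: "mass_inner f g = mass_inner g f"
  by (simp add: mass_inner_def mult_ac)

lemma bvp_symmetric:
  assumes "bvp f u \<theta> m T1 T2" "bvp g v \<phi> n R1 R2" "continuous_on {-1..1} f" "continuous_on {-1..1} g"
  shows "mass_inner f v = mass_inner g u"
  using bvp_green[OF assms(1,2,3)] bvp_green[OF assms(2,1,4)] energy_commute by metis

end

section \<open>Integral estimates\<close>

lemma beam_sys_slope_diff:
  fixes u \<theta> m T s q g :: "real \<Rightarrow> real"
  assumes sys: "beam_sys a b s q u \<theta> m T g" and c: "continuous_on {a..b} s" "continuous_on {a..b} q"
    and nn: "\<And>x. x \<in> {a..b} \<Longrightarrow> 0 \<le> s x" "\<And>x. x \<in> {a..b} \<Longrightarrow> 0 \<le> q x"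
    and xy: "a \<le> x" "x \<le> y" "y \<le> b"
  shows "(\<theta> y - \<theta> x)\<^sup>2 \<le> integral {a..b} s * integral {a..b} (\<lambda>x. s x * m x * m x + q x * \<theta> x * \<theta> x)"
proof -
  note co = beam_sys_continuous[OF sys]
  have sub: "{x..y} \<subseteq> {a..b}" using xy by auto
  have ac: "ac_on a b \<theta> (\<lambda>x. s x * m x)"
    using sys by (intro ac_on_C1) (auto simp: beam_sys_def intro!: continuous_intros c co)
  have i: "s integrable_on {a..b}" "(\<lambda>x. s x * m x * m x + q x * \<theta> x * \<theta> x) integrable_on {a..b}"
    "(\<lambda>x. s x * (m x)\<^sup>2) integrable_on {a..b}"
    using c co by (auto intro!: integrable_continuous_real continuous_intros)
  have "(\<theta> y - \<theta> x)\<^sup>2 = (integral {x..y} (\<lambda>t. s t * m t))\<^sup>2"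
    using ac_on_diff_integral[OF ac, of x y] xy by simp
  also have "\<dots> \<le> integral {x..y} s * integral {x..y} (\<lambda>t. s t * (m t)\<^sup>2)"
    using sub nn by (intro weighted_integral_cauchy_schwarz continuous_on_subset[OF c(1)] continuous_on_subset[OF co(3)]) auto
  also have "\<dots> \<le> integral {a..b} s * integral {a..b} (\<lambda>x. s x * m x * m x + q x * \<theta> x * \<theta> x)"
  proof (rule mult_mono)
    show "integral {x..y} s \<le> integral {a..b} s"
      using i nn sub by (intro integral_subset_le) (auto intro: integrable_on_subinterval)
    have "integral {x..y} (\<lambda>t. s t * (m t)\<^sup>2) \<le> integral {a..b} (\<lambda>t. s t * (m t)\<^sup>2)"
      using i nn sub by (intro integral_subset_le) (auto intro: integrable_on_subinterval)
    also have "\<dots> \<le> integral {a..b} (\<lambda>x. s x * m x * m x + q x * \<theta> x * \<theta> x)"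
      using i nn by (intro integral_le) (auto simp: power2_eq_square mult.assoc)
    finally show "integral {x..y} (\<lambda>t. s t * (m t)\<^sup>2) \<le> integral {a..b} (\<lambda>x. s x * m x * m x + q x * \<theta> x * \<theta> x)" .
    show "0 \<le> integral {a..b} s" using i nn by (intro integral_nonneg) auto
    show "0 \<le> integral {x..y} (\<lambda>t. s t * (m t)\<^sup>2)"
      using i nn sub by (intro integral_nonneg) (auto intro: integrable_on_subinterval)
  qed
  finally show ?thesis .
qed

lemma has_deriv_on_diff_bound:
  fixes u :: "real \<Rightarrow> real"
  assumes "has_deriv_on a b u \<theta>" "continuous_on {a..b} \<theta>" "\<And>x. x \<in> {a..b} \<Longrightarrow> \<bar>\<theta> x\<bar> \<le> D"
    and xy: "a \<le> x" "x \<le> y" "y \<le> b"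
  shows "\<bar>u y - u x\<bar> \<le> D * (y - x)"
proof -
  have "u y - u x = integral {x..y} \<theta>"
    using ac_on_diff_integral[OF ac_on_C1[OF assms(1,2)], of x y] xy by simp
  also have "norm \<dots> \<le> integral {x..y} (\<lambda>_. D)"
    using xy assms(3) by (intro integral_norm_bound_integral)
      (auto intro!: integrable_continuous_real continuous_on_subset[OF assms(2)])
  finally show ?thesis using xy by (simp add: mult.commute)
qed

lemma weighted_square_integral_nonneg:
  fixes r f :: "real \<Rightarrow> real"
  assumes "continuous_on {a..b} r" "continuous_on {a..b} f" "\<And>x. x \<in> {a..b} \<Longrightarrow> 0 \<le> r x"
  shows "0 \<le> integral {a..b} (\<lambda>x. r x * f x * f x)"
proof (rule integral_nonneg)
  show "(\<lambda>x. r x * f x * f x) integrable_on {a..b}"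
    by (intro integrable_continuous_real continuous_intros assms)
qed (simp add: mult.assoc assms(3))

lemma weighted_integral_lincomb:
  fixes r f g h :: "real \<Rightarrow> real"
  assumes "continuous_on {a..b} r" "continuous_on {a..b} f" "continuous_on {a..b} g" "continuous_on {a..b} h"
  shows "integral {a..b} (\<lambda>x. r x * (f x + c * g x) * h x) =
    integral {a..b} (\<lambda>x. r x * f x * h x) + c * integral {a..b} (\<lambda>x. r x * g x * h x)"
proof -
  have "integral {a..b} (\<lambda>x. r x * (f x + c * g x) * h x) =
      integral {a..b} (\<lambda>x. r x * f x * h x + c * (r x * g x * h x))"
    by (rule integral_cong) (simp add: algebra_simps)
  also have "\<dots> = integral {a..b} (\<lambda>x. r x * f x * h x) + c * integral {a..b} (\<lambda>x. r x * g x * h x)"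
    by (subst integral_add) (auto intro!: integrable_continuous_real continuous_intros assms)
  finally show ?thesis .
qed

lemma weighted_square_integral_le:
  fixes r f :: "real \<Rightarrow> real"
  assumes "continuous_on {a..b} r" "continuous_on {a..b} f" "\<And>x. x \<in> {a..b} \<Longrightarrow> 0 \<le> r x"
    and "\<And>x. x \<in> {a..b} \<Longrightarrow> f x * f x \<le> B"
  shows "integral {a..b} (\<lambda>x. r x * f x * f x) \<le> integral {a..b} r * B"
proof -
  have "integral {a..b} (\<lambda>x. r x * f x * f x) \<le> integral {a..b} (\<lambda>x. r x * B)"
  proof (rule integral_le)
    show "r x * f x * f x \<le> r x * B" if "x \<in> {a..b}" for x
      unfolding mult.assoc by (intro mult_left_mono assms that)
  qed (auto intro!: integrable_continuous_real continuous_intros assms)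
  then show ?thesis by simp
qed

lemma beam_energy_nonneg:
  fixes s q \<theta> m :: "real \<Rightarrow> real"
  assumes "continuous_on {a..b} s" "continuous_on {a..b} q" "continuous_on {a..b} \<theta>" "continuous_on {a..b} m"
    and "\<And>x. x \<in> {a..b} \<Longrightarrow> 0 \<le> s x" "\<And>x. x \<in> {a..b} \<Longrightarrow> 0 \<le> q x"
  shows "0 \<le> integral {a..b} (\<lambda>x. s x * m x * m x + q x * \<theta> x * \<theta> x)"
proof (rule integral_nonneg)
  show "(\<lambda>x. s x * m x * m x + q x * \<theta> x * \<theta> x) integrable_on {a..b}"
    by (intro integrable_continuous_real continuous_intros assms)
qed (simp add: mult.assoc assms(5,6))

context two_beams
begin

section \<open>Signs at the ends and simplicity of eigenvalues\<close>

lemma bvp_uminus: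
  fixes u :: "real \<Rightarrow> real"
  assumes "bvp f u \<theta> m T1 T2"
  shows "bvp (\<lambda>x. - f x) (\<lambda>x. - u x) (\<lambda>x. - \<theta> x) (\<lambda>x. - m x) (\<lambda>x. - T1 x) (\<lambda>x. - T2 x)"
  using bvp_linear[OF assms bounded_linear_minus[OF bounded_linear_ident]] .

text \<open>
  All four components stay nonnegative: on \<open>[-1, 0]\<close> by assumption on the data at \<open>-1\<close>, on \<open>[0, 1]\<close> because
  \<open>T2 0 = T1 0 + M l u 0 \<ge> 0\<close>. Hence \<open>u\<close> is nondecreasing from \<open>u (-1) = 0\<close> to \<open>u 1 = 0\<close>.
\<close>

lemma bvp_nonneg_end_zero:
  fixes u :: "real \<Rightarrow> real"
  assumes u: "bvp (\<lambda>x. l * u x) u \<theta> m T1 T2" and l: "0 \<le> l"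
    and init: "0 \<le> \<theta> (-1)" "0 \<le> T1 (-1)" and x: "x \<in> {-1..1}"
  shows "u x = 0"
proof -
  have sys1: "beam_sys (-1) 0 s1 q1 u \<theta> m T1 (\<lambda>x. (l * r1 x) * u x)"
    and sys2: "beam_sys 0 1 s2 q2 u \<theta> m T2 (\<lambda>x. (l * r2 x) * u x)"
    and bc: "u (-1) = 0" "m (-1) = 0" "u 1 = 0" "T2 0 = T1 0 + M * (l * u 0)"
    using u by (simp_all add: bvp_def mult_ac)
  have nn1: "0 \<le> u x \<and> 0 \<le> \<theta> x \<and> 0 \<le> m x \<and> 0 \<le> T1 x" if "x \<in> {-1..0}" for x
    using beam_sys_nonneg[OF sys1 cs(1) cq(1) continuous_on_mult[OF continuous_on_const cr(1)] _ _ _ _ _ _ _ that]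
      s(1) q(1) r(1) l bc init by (simp add: less_imp_le)
  have "0 \<le> T2 0" using nn1[of 0] M l bc by simp
  then have nn2: "0 \<le> u x \<and> 0 \<le> \<theta> x \<and> 0 \<le> m x \<and> 0 \<le> T2 x" if "x \<in> {0..1}" for x
    using beam_sys_nonneg[OF sys2 cs(2) cq(2) continuous_on_mult[OF continuous_on_const cr(2)] _ _ _ _ _ _ _ that]
      s(2) q(2) r(2) l bc nn1[of 0] by (simp add: less_imp_le)
  have d: "has_deriv_on (-1) 0 u \<theta>" "has_deriv_on 0 1 u \<theta>" using sys1 sys2 by (auto simp: beam_sys_def)
  have m1: "u x \<le> u y" if "-1 \<le> x" "x \<le> y" "y \<le> 0" for x y
    by (rule has_deriv_on_mono[OF d(1) _ that]) (use nn1 in auto)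
  have m2: "u x \<le> u y" if "0 \<le> x" "x \<le> y" "y \<le> 1" for x y
    by (rule has_deriv_on_mono[OF d(2) _ that]) (use nn2 in auto)
  show ?thesis
  proof (cases "x \<le> 0")
    case True
    then show ?thesis using m1[of x 0] m2[of 0 1] nn1[of x] bc x by auto
  next
    case False
    then show ?thesis using m2[of x 1] nn2[of x] bc x by auto
  qed
qed

lemma bvp_sign_left:
  fixes u :: "real \<Rightarrow> real"
  assumes u: "bvp (\<lambda>x. l * u x) u \<theta> m T1 T2" and l: "0 \<le> l" and x: "x \<in> {-1..1}" "u x \<noteq> 0"
  shows "\<theta> (-1) * T1 (-1) < 0"
proof (rule ccontr)
  assume "\<not> ?thesis"
  then consider "0 \<le> \<theta> (-1)" "0 \<le> T1 (-1)" | "0 \<le> - \<theta> (-1)" "0 \<le> - T1 (-1)"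
    by (auto simp: not_less zero_le_mult_iff)
  then show False
  proof cases
    case 1
    then show False using bvp_nonneg_end_zero[OF u l _ _ x(1)] x by simp
  next
    case 2
    have "bvp (\<lambda>x. l * - u x) (\<lambda>x. - u x) (\<lambda>x. - \<theta> x) (\<lambda>x. - m x) (\<lambda>x. - T1 x) (\<lambda>x. - T2 x)"
      using bvp_uminus[OF u] by simp
    from bvp_nonneg_end_zero[OF this l 2 x(1)] show False using x by simp
  qed
qed

lemma two_beams_reflect: "two_beams M (\<lambda>x. s2 (- x)) (\<lambda>x. s1 (- x)) (\<lambda>x. q2 (- x)) (\<lambda>x. q1 (- x)) (\<lambda>x. r2 (- x)) (\<lambda>x. r1 (- x))"
proof -
  have c1: "continuous_on {-1..0} (\<lambda>x. f (- x))" if "continuous_on {0..1} f" for f :: "real \<Rightarrow> real"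
    by (rule continuous_on_compose2[OF that]) (auto intro: continuous_intros)
  have c2: "continuous_on {0..1} (\<lambda>x. f (- x))" if "continuous_on {-1..0} f" for f :: "real \<Rightarrow> real"
    by (rule continuous_on_compose2[OF that]) (auto intro: continuous_intros)
  show ?thesis
    by unfold_locales (use M c1 c2 cs cq cr s q r in auto)
qed

lemma bvp_sign_right:
  fixes u :: "real \<Rightarrow> real"
  assumes u: "bvp (\<lambda>x. l * u x) u \<theta> m T1 T2" and l: "0 \<le> l" and x: "x \<in> {-1..1}" "u x \<noteq> 0"
  shows "\<theta> 1 * T2 1 < 0"
proof -
  interpret R: two_beams M "\<lambda>x. s2 (- x)" "\<lambda>x. s1 (- x)" "\<lambda>x. q2 (- x)" "\<lambda>x. q1 (- x)" "\<lambda>x. r2 (- x)" "\<lambda>x. r1 (- x)"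
    by (rule two_beams_reflect)
  have "R.bvp (\<lambda>x. l * u (- x)) (\<lambda>x. u (- x)) (\<lambda>x. - \<theta> (- x)) (\<lambda>x. m (- x)) (\<lambda>x. - T2 (- x)) (\<lambda>x. - T1 (- x))"
    using u beam_sys_reflect[of "-1" 0 s1 q1 u \<theta> m T1 "\<lambda>x. r1 x * (l * u x)"]
      beam_sys_reflect[of 0 1 s2 q2 u \<theta> m T2 "\<lambda>x. r2 x * (l * u x)"]
    by (simp add: bvp_def R.bvp_def)
  from R.bvp_sign_left[OF this l, of "- x"] x show ?thesis by simp
qed

text \<open>
  By \<open>bvp_sign_left\<close> a solution is determined by its slope at \<open>-1\<close>, so subtracting the multiple of \<open>u\<close> with
  the same slope as \<open>v\<close> leaves zero.
\<close>

lemma bvp_simple: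
  fixes u v :: "real \<Rightarrow> real"
  assumes u: "bvp (\<lambda>x. l * u x) u \<theta> m T1 T2" and v: "bvp (\<lambda>x. l * v x) v \<phi> n R1 R2" and l: "0 \<le> l"
    and x0: "x0 \<in> {-1..1}" "u x0 \<noteq> 0"
  obtains c where "\<And>x. x \<in> {-1..1} \<Longrightarrow> v x = c * u x"
proof -
  have nz: "\<theta> (-1) \<noteq> 0" using bvp_sign_left[OF u l x0] by auto
  define c where "c = \<phi> (-1) / \<theta> (-1)"
  have w: "bvp (\<lambda>x. l * (v x + (- c) * u x)) (\<lambda>x. v x + (- c) * u x) (\<lambda>x. \<phi> x + (- c) * \<theta> x) (\<lambda>x. n x + (- c) * m x)
      (\<lambda>x. R1 x + (- c) * T1 x) (\<lambda>x. R2 x + (- c) * T2 x)"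
    using bvp_lincomb[OF v u, of "- c"] by (simp add: algebra_simps)
  have "\<phi> (-1) + (- c) * \<theta> (-1) = 0" using nz by (simp add: c_def)
  then have "v x + (- c) * u x = 0" if "x \<in> {-1..1}" for x
    using bvp_sign_left[OF w l that] by (cases "v x + (- c) * u x = 0") auto
  then show thesis by (intro that[of c]) simp
qed

section \<open>A priori bounds\<close>

definition total_compliance :: real where "total_compliance = integral {-1..0} s1 + integral {0..1} s2"
definition total_mass :: real where "total_mass = integral {-1..0} r1 + integral {0..1} r2 + M"

lemma integral_pieces_nonneg: "0 \<le> integral {-1..0} s1" "0 \<le> integral {0..1} s2"
  "0 \<le> integral {-1..0} r1" "0 \<le> integral {0..1} r2"
  by (auto intro!: integral_nonneg integrable_continuous_real cs cr
      simp: s[THEN less_imp_le] r[THEN less_imp_le])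

lemma total_compliance_nonneg: "0 \<le> total_compliance" and total_mass_nonneg: "0 \<le> total_mass"
  using integral_pieces_nonneg M by (auto simp: total_compliance_def total_mass_def)

lemma energy_pieces_nonneg:
  assumes "continuous_on {-1..1} \<theta>" "continuous_on {-1..1} m"
  shows "0 \<le> integral {-1..0} (\<lambda>x. s1 x * m x * m x + q1 x * \<theta> x * \<theta> x)"
    "0 \<le> integral {0..1} (\<lambda>x. s2 x * m x * m x + q2 x * \<theta> x * \<theta> x)"
  using assms s q by (auto simp: continuous_on_glue less_imp_le intro!: beam_energy_nonneg cs cq)

lemma energy_nonneg: "continuous_on {-1..1} \<theta> \<Longrightarrow> continuous_on {-1..1} m \<Longrightarrow> 0 \<le> energy \<theta> m \<theta> m"
  using energy_pieces_nonneg[of \<theta> m] by (simp add: energy_def)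

text \<open>
  The slope oscillates by at most \<open>D\<close>, by the Cauchy-Schwarz inequality for \<open>\<theta>' = s m\<close> on each side of \<open>0\<close>.
  It has a zero because \<open>u\<close> vanishes at both ends. So the energy controls the slope, and with it \<open>u\<close>.
\<close>

lemma bvp_bounds:
  fixes u :: "real \<Rightarrow> real"
  assumes u: "bvp f u \<theta> m T1 T2"
  defines "D \<equiv> 2 * sqrt (total_compliance * energy \<theta> m \<theta> m)"
  shows "x \<in> {-1..1} \<Longrightarrow> \<bar>\<theta> x\<bar> \<le> D" "x \<in> {-1..1} \<Longrightarrow> \<bar>u x\<bar> \<le> D"
    "x \<in> {-1..1} \<Longrightarrow> y \<in> {-1..1} \<Longrightarrow> \<bar>u x - u y\<bar> \<le> D * \<bar>x - y\<bar>"
proof -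
  note co = bvp_continuous[OF u]
  have sys: "beam_sys (-1) 0 s1 q1 u \<theta> m T1 (\<lambda>x. r1 x * f x)" "beam_sys 0 1 s2 q2 u \<theta> m T2 (\<lambda>x. r2 x * f x)"
    and bc: "u (-1) = 0" "u 1 = 0" using u by (auto simp: bvp_def)
  have d: "has_deriv_on (-1) 0 u \<theta>" "has_deriv_on 0 1 u \<theta>" using sys by (auto simp: beam_sys_def)
  have ct: "continuous_on {-1..0} \<theta>" "continuous_on {0..1} \<theta>" using co by (auto simp: continuous_on_glue)
  note en = energy_pieces_nonneg[OF co(2,3)]
  let ?E1 = "integral {-1..0} (\<lambda>x. s1 x * m x * m x + q1 x * \<theta> x * \<theta> x)"
  let ?E2 = "integral {0..1} (\<lambda>x. s2 x * m x * m x + q2 x * \<theta> x * \<theta> x)"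
  have b1: "\<bar>\<theta> 0 - \<theta> x\<bar> \<le> D / 2" if "x \<in> {-1..0}" for x
  proof -
    have "(\<theta> 0 - \<theta> x)\<^sup>2 \<le> integral {-1..0} s1 * ?E1"
      using beam_sys_slope_diff[OF sys(1) cs(1) cq(1), of x 0] s(1) q(1) that by (simp add: less_imp_le)
    also have "\<dots> \<le> total_compliance * energy \<theta> m \<theta> m"
      using integral_pieces_nonneg en by (intro mult_mono) (auto simp: total_compliance_def energy_def)
    finally show ?thesis by (simp add: D_def real_le_rsqrt)
  qed
  have b2: "\<bar>\<theta> x - \<theta> 0\<bar> \<le> D / 2" if "x \<in> {0..1}" for x
  proof -
    have "(\<theta> x - \<theta> 0)\<^sup>2 \<le> integral {0..1} s2 * ?E2"
      using beam_sys_slope_diff[OF sys(2) cs(2) cq(2), of 0 x] s(2) q(2) that by (simp add: less_imp_le)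
    also have "\<dots> \<le> total_compliance * energy \<theta> m \<theta> m"
      using integral_pieces_nonneg en by (intro mult_mono) (auto simp: total_compliance_def energy_def)
    finally show ?thesis by (simp add: D_def real_le_rsqrt)
  qed
  have b: "\<bar>\<theta> x - \<theta> 0\<bar> \<le> D / 2" if "x \<in> {-1..1}" for x
    using b1[of x] b2[of x] that by (cases "x \<le> 0") (auto simp: abs_minus_commute)
  obtain \<xi> where \<xi>: "\<xi> \<in> {-1..1}" "\<theta> \<xi> = 0"
  proof -
    \<comment> \<open>The mean slopes on the two unit intervals are \<open>u 0\<close> and \<open>- u 0\<close>, so the slope changes sign in between.\<close>
    have "\<exists>t\<in>{-1..0}. u 0 - u (-1) = (\<lambda>h. h *\<^sub>R \<theta> t) (0 - (-1))"
      using d(1) by (intro mvt_very_simple) (auto simp: has_deriv_on_def has_vector_derivative_def)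
    then obtain t1 where t1: "t1 \<in> {-1..0}" "\<theta> t1 = u 0" using bc by auto
    have "\<exists>t\<in>{0..1}. u 1 - u 0 = (\<lambda>h. h *\<^sub>R \<theta> t) (1 - 0)"
      using d(2) by (intro mvt_very_simple) (auto simp: has_deriv_on_def has_vector_derivative_def)
    then obtain t2 where t2: "t2 \<in> {0..1}" "\<theta> t2 = - u 0" using bc by auto
    have c: "continuous_on {t1..t2} \<theta>" by (rule continuous_on_subset[OF co(2)]) (use t1 t2 in auto)
    obtain t where "t1 \<le> t" "t \<le> t2" "\<theta> t = 0"
      using IVT'[of \<theta> t1 0 t2] IVT2'[of \<theta> t2 0 t1] c t1 t2 by (cases "0 \<le> u 0") auto
    then show thesis using that[of t] t1 t2 by simp
  qed
  have th: "\<bar>\<theta> x\<bar> \<le> D" if "x \<in> {-1..1}" for x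
  proof -
    have "\<bar>\<theta> x\<bar> \<le> \<bar>\<theta> x - \<theta> 0\<bar> + \<bar>\<theta> \<xi> - \<theta> 0\<bar>" using \<xi>(2) by simp
    then show ?thesis using b[OF that] b[OF \<xi>(1)] by linarith
  qed
  then show "x \<in> {-1..1} \<Longrightarrow> \<bar>\<theta> x\<bar> \<le> D" by blast
  have l1: "\<bar>u y - u x\<bar> \<le> D * (y - x)" if "-1 \<le> x" "x \<le> y" "y \<le> 0" for x y
    by (rule has_deriv_on_diff_bound[OF d(1) ct(1) _ that]) (use th in auto)
  have l2: "\<bar>u y - u x\<bar> \<le> D * (y - x)" if "0 \<le> x" "x \<le> y" "y \<le> 1" for x y
    by (rule has_deriv_on_diff_bound[OF d(2) ct(2) _ that]) (use th in auto)
  have l: "\<bar>u y - u x\<bar> \<le> D * (y - x)" if "-1 \<le> x" "x \<le> y" "y \<le> 1" for x y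
  proof -
    consider "y \<le> 0" | "0 \<le> x" | "x \<le> 0" "0 \<le> y" by linarith
    then show ?thesis
    proof cases
      case 3
      have "\<bar>u y - u x\<bar> \<le> \<bar>u y - u 0\<bar> + \<bar>u 0 - u x\<bar>" by simp
      also have "\<dots> \<le> D * (y - 0) + D * (0 - x)" using l1[of x 0] l2[of 0 y] that 3 by (intro add_mono) auto
      finally show ?thesis by (simp add: algebra_simps)
    qed (use that l1 l2 in auto)
  qed
  show lip: "\<bar>u x - u y\<bar> \<le> D * \<bar>x - y\<bar>" if "x \<in> {-1..1}" "y \<in> {-1..1}" for x y
    using l[of x y] l[of y x] that by (cases "x \<le> y") (auto simp: abs_minus_commute)
  show "\<bar>u x\<bar> \<le> D" if x: "x \<in> {-1..1}"
  proof -
    have D: "0 \<le> D" using th[of 0] by simp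
    show ?thesis
    proof (cases "x \<le> 0")
      case True
      have "\<bar>u x\<bar> \<le> D * (x + 1)" using l[of "-1" x] x bc by simp
      also have "\<dots> \<le> D * 1" using True D by (intro mult_left_mono) auto
      finally show ?thesis by simp
    next
      case False
      have "\<bar>u x\<bar> \<le> D * (1 - x)" using l[of x 1] x bc by simp
      also have "\<dots> \<le> D * 1" using False D by (intro mult_left_mono) auto
      finally show ?thesis by simp
    qed
  qed
qed

lemma mass_inner_nonneg:
  assumes "continuous_on {-1..1} f" shows "0 \<le> mass_inner f f"
  using assms weighted_square_integral_nonneg[OF cr(1), of f] weighted_square_integral_nonneg[OF cr(2), of f] r M
  by (simp add: mass_inner_def continuous_on_glue less_imp_le mult.assoc)

lemma mass_inner_lincomb:
  assumes "continuous_on {-1..1} f" "continuous_on {-1..1} g" "continuous_on {-1..1} h"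
  shows "mass_inner (\<lambda>x. f x + c * g x) h = mass_inner f h + c * mass_inner g h"
  using assms weighted_integral_lincomb[OF cr(1), of f g h c] weighted_integral_lincomb[OF cr(2), of f g h c]
  by (simp add: mass_inner_def continuous_on_glue algebra_simps)

lemma mass_inner_cauchy_schwarz:
  assumes f: "continuous_on {-1..1} f" and g: "continuous_on {-1..1} g"
  shows "(mass_inner f g)\<^sup>2 \<le> mass_inner f f * mass_inner g g"
proof (rule quadratic_nonneg_imp_square_le[OF mass_inner_nonneg[OF f]])
  fix z
  have fg: "continuous_on {-1..1} (\<lambda>x. g x + (- z) * f x)" using f g by (intro continuous_intros)
  have "0 \<le> mass_inner (\<lambda>x. g x + (- z) * f x) (\<lambda>x. g x + (- z) * f x)" by (rule mass_inner_nonneg[OF fg])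
  also have "\<dots> = mass_inner g (\<lambda>x. g x + (- z) * f x) + (- z) * mass_inner f (\<lambda>x. g x + (- z) * f x)"
    by (rule mass_inner_lincomb[OF g f fg])
  also have "mass_inner g (\<lambda>x. g x + (- z) * f x) = mass_inner g g + (- z) * mass_inner f g"
    by (subst mass_inner_commute) (rule mass_inner_lincomb[OF g f g])
  also have "mass_inner f (\<lambda>x. g x + (- z) * f x) = mass_inner f g + (- z) * mass_inner f f"
    by (subst mass_inner_commute, subst mass_inner_lincomb[OF g f f]) (simp add: mass_inner_commute)
  finally show "0 \<le> z\<^sup>2 * mass_inner f f - 2 * z * mass_inner f g + mass_inner g g"
    by (simp add: power2_eq_square algebra_simps)
qed

lemma mass_inner_le:
  assumes f: "continuous_on {-1..1} f" and B: "\<And>x. x \<in> {-1..1} \<Longrightarrow> \<bar>f x\<bar> \<le> B"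
  shows "mass_inner f f \<le> total_mass * B\<^sup>2"
proof -
  have c: "continuous_on {-1..0} f" "continuous_on {0..1} f" using f by (auto simp: continuous_on_glue)
  have sq: "f x * f x \<le> B\<^sup>2" if "x \<in> {-1..1}" for x
    using power_mono[OF B[OF that] abs_ge_zero, of 2] by (simp add: power2_eq_square)
  have "integral {-1..0} (\<lambda>x. r1 x * f x * f x) \<le> integral {-1..0} r1 * B\<^sup>2"
    by (rule weighted_square_integral_le[OF cr(1) c(1)]) (use sq r in \<open>auto simp: less_imp_le\<close>)
  moreover have "integral {0..1} (\<lambda>x. r2 x * f x * f x) \<le> integral {0..1} r2 * B\<^sup>2"
    by (rule weighted_square_integral_le[OF cr(2) c(2)]) (use sq r in \<open>auto simp: less_imp_le\<close>)
  moreover have "M * f 0 * f 0 \<le> M * B\<^sup>2"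
    unfolding mult.assoc using sq[of 0] M by (intro mult_left_mono) auto
  ultimately show ?thesis by (simp add: mass_inner_def total_mass_def algebra_simps)
qed

text \<open>
  The energy \<open>E\<close> equals the inner product of \<open>f\<close> and \<open>u\<close>, while \<open>u\<close> is bounded by a multiple of the square
  root of \<open>E\<close>. So \<open>E\<close> is at most a multiple of the norm of \<open>f\<close> times that root, and one power of it cancels.
\<close>

lemma bvp_rhs_bounds:
  fixes u :: "real \<Rightarrow> real"
  assumes u: "bvp f u \<theta> m T1 T2" and f: "continuous_on {-1..1} f"
  defines "C \<equiv> 4 * total_compliance * sqrt total_mass * sqrt (mass_inner f f)"
  shows "x \<in> {-1..1} \<Longrightarrow> \<bar>\<theta> x\<bar> \<le> C" "x \<in> {-1..1} \<Longrightarrow> \<bar>u x\<bar> \<le> C"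
    "x \<in> {-1..1} \<Longrightarrow> y \<in> {-1..1} \<Longrightarrow> \<bar>u x - u y\<bar> \<le> C * \<bar>x - y\<bar>"
proof -
  note co = bvp_continuous[OF u]
  define E where "E = energy \<theta> m \<theta> m"
  define D where "D = 2 * sqrt (total_compliance * E)"
  have E0: "0 \<le> E" unfolding E_def by (rule energy_nonneg[OF co(2,3)])
  have uD: "\<bar>u x\<bar> \<le> D" if "x \<in> {-1..1}" for x
    unfolding D_def E_def by (rule bvp_bounds(2)[OF u that])
  have "E = mass_inner f u" unfolding E_def by (rule bvp_green[OF u u f, symmetric])
  then have "E\<^sup>2 \<le> mass_inner f f * mass_inner u u" using mass_inner_cauchy_schwarz[OF f co(1)] by simp
  also have "\<dots> \<le> mass_inner f f * (total_mass * D\<^sup>2)"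
    using mass_inner_le[OF co(1) uD] mass_inner_nonneg[OF f] by (intro mult_left_mono) auto
  also have "D\<^sup>2 = 4 * total_compliance * E" using E0 total_compliance_nonneg by (simp add: D_def power_mult_distrib)
  finally have *: "E * E \<le> (4 * total_compliance * total_mass * mass_inner f f) * E" by (simp add: power2_eq_square mult_ac)
  have E: "E \<le> 4 * total_compliance * total_mass * mass_inner f f"
  proof (cases "E = 0")
    case True
    then show ?thesis using total_compliance_nonneg total_mass_nonneg mass_inner_nonneg[OF f] by simp
  next
    case False
    then show ?thesis using * E0 by (simp add: mult_le_cancel_right)
  qed
  have "D \<le> 2 * sqrt (total_compliance * (4 * total_compliance * total_mass * mass_inner f f))"
    unfolding D_def using E total_compliance_nonneg by (intro mult_left_mono real_sqrt_le_mono) auto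
  also have "\<dots> = C"
  proof -
    have "total_compliance * (4 * total_compliance * total_mass * mass_inner f f) = (2 * total_compliance)\<^sup>2 * (total_mass * mass_inner f f)"
      by (simp add: power2_eq_square)
    then show ?thesis using total_compliance_nonneg by (simp add: C_def real_sqrt_mult)
  qed
  finally have DC: "D \<le> C" .
  show "x \<in> {-1..1} \<Longrightarrow> \<bar>\<theta> x\<bar> \<le> C" "x \<in> {-1..1} \<Longrightarrow> \<bar>u x\<bar> \<le> C"
    using bvp_bounds(1,2)[OF u, of x] DC by (auto simp: D_def E_def)
  show "\<bar>u x - u y\<bar> \<le> C * \<bar>x - y\<bar>" if "x \<in> {-1..1}" "y \<in> {-1..1}"
  proof -
    have "\<bar>u x - u y\<bar> \<le> D * \<bar>x - y\<bar>" unfolding D_def E_def by (rule bvp_bounds(3)[OF u that])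
    also have "\<dots> \<le> C * \<bar>x - y\<bar>" using DC by (intro mult_right_mono) auto
    finally show ?thesis .
  qed
qed

end

section \<open>Solvability of the boundary value problem\<close>

lemma beam_sys_glue_left:
  assumes "beam_sys a c s q u \<theta> m T g" "c \<le> b"
  shows "beam_sys a c s q (\<lambda>x. if x \<le> c then u x else u' x) (\<lambda>x. if x \<le> c then \<theta> x else \<theta>' x)
    (\<lambda>x. if x \<le> c then m x else m' x) T g"
  by (rule beam_sys_cong[OF assms(1)]) auto

lemma beam_sys_glue_right:
  assumes "beam_sys c b s q u' \<theta>' m' T g" "u c = u' c" "\<theta> c = \<theta>' c" "m c = m' c"
  shows "beam_sys c b s q (\<lambda>x. if x \<le> c then u x else u' x) (\<lambda>x. if x \<le> c then \<theta> x else \<theta>' x)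
    (\<lambda>x. if x \<le> c then m x else m' x) T g"
  by (rule beam_sys_cong[OF assms(1)]) (use assms(2-) in \<open>auto simp: antisym_conv\<close>)

lemma has_deriv_on_zero:
  assumes "a < b" "has_deriv_on a b f f'" "\<And>x. x \<in> {a..b} \<Longrightarrow> f x = 0" "x \<in> {a..b}"
  shows "f' x = 0"
proof -
  have "has_deriv_on a b (\<lambda>x. 0) (\<lambda>x. 0 :: 'a)" by (simp add: has_deriv_on_def)
  then have "has_deriv_on a b f (\<lambda>x. 0)" by (rule has_deriv_on_cong) (simp_all add: assms)
  from has_deriv_on_unique[OF assms(1,2) this assms(4)] show ?thesis .
qed

context two_beams
begin

lemma shoot_exists:
  fixes f :: "real \<Rightarrow> real"
  assumes f: "continuous_on {-1..1} f"
  obtains u \<theta> m T1 T2 where "shoot f u \<theta> m T1 T2" "\<theta> (-1) = \<theta>0" "T1 (-1) = T0"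
proof -
  have c: "continuous_on {-1..0} f" "continuous_on {0..1} f" using f by (auto simp: continuous_on_glue)
  have g: "continuous_on {-1..0} (\<lambda>x. r1 x * f x)" "continuous_on {0..1} (\<lambda>x. r2 x * f x)"
    using c cr by (auto intro: continuous_intros)
  obtain u \<theta> m T1 where 1: "beam_sys (-1) 0 s1 q1 u \<theta> m T1 (\<lambda>x. r1 x * f x)" "u (-1) = 0" "\<theta> (-1) = \<theta>0" "m (-1) = 0" "T1 (-1) = T0"
    by (rule beam_ivp_exists[OF _ cs(1) cq(1) g(1), of 0 \<theta>0 0 T0]) auto
  obtain u' \<theta>' m' T2 where 2: "beam_sys 0 1 s2 q2 u' \<theta>' m' T2 (\<lambda>x. r2 x * f x)" "u' 0 = u 0" "\<theta>' 0 = \<theta> 0" "m' 0 = m 0" "T2 0 = T1 0 + M * f 0"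
    by (rule beam_ivp_exists[OF _ cs(2) cq(2) g(2), of "u 0" "\<theta> 0" "m 0" "T1 0 + M * f 0"]) auto
  have "shoot f (\<lambda>x. if x \<le> 0 then u x else u' x) (\<lambda>x. if x \<le> 0 then \<theta> x else \<theta>' x)
    (\<lambda>x. if x \<le> 0 then m x else m' x) T1 T2"
    using beam_sys_glue_left[OF 1(1), of 0 u' \<theta>' m']
      beam_sys_glue_right[OF 2(1), of u \<theta> m] 1 2 by (simp add: shoot_def)
  then show thesis by (rule that) (simp_all add: 1)
qed

text \<open>
  Without load the energy is \<open>0\<close>, so \<open>\<theta>\<close> and \<open>u\<close> vanish; the equations then force \<open>m\<close> and \<open>T1\<close> to vanish
  on \<open>[-1, 0]\<close> as well.
\<close>

lemma bvp_homogeneous: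
  fixes u :: "real \<Rightarrow> real"
  assumes u: "bvp (\<lambda>x. 0) u \<theta> m T1 T2" and x: "x \<in> {-1..1}"
  shows "\<theta> x = 0" "u x = 0" "T1 (-1) = 0"
proof -
  have "mass_inner (\<lambda>x. 0) (\<lambda>x. 0) = 0" by (simp add: mass_inner_def)
  then have *: "\<theta> x = 0" "u x = 0" if "x \<in> {-1..1}" for x
    using bvp_rhs_bounds(1,2)[OF u continuous_on_const that] by auto
  show "\<theta> x = 0" "u x = 0" using * x by auto
  have sys: "has_deriv_on (-1) 0 \<theta> (\<lambda>x. s1 x * m x)" "has_deriv_on (-1) 0 m (\<lambda>x. T1 x + q1 x * \<theta> x)"
    using u by (auto simp: bvp_def beam_sys_def)
  have "s1 x * m x = 0" if "x \<in> {-1..0}" for x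
    by (rule has_deriv_on_zero[OF _ sys(1) _ that]) (use * in auto)
  then have "m x = 0" if "x \<in> {-1..0}" for x using s(1)[OF that] that by force
  then have "T1 (-1) + q1 (-1) * \<theta> (-1) = 0"
    by (intro has_deriv_on_zero[OF _ sys(2)]) auto
  then show "T1 (-1) = 0" using * by simp
qed

text \<open>
  Shooting: correct a particular solution by the two homogeneous ones with \<open>(\<theta>, T)(-1) = (1, 0)\<close> and
  \<open>(0, 1)\<close>. The conditions at \<open>1\<close> are a linear \<open>2 \<times> 2\<close> system whose determinant \<open>D\<close> is nonzero because a
  combination of the homogeneous solutions that satisfies them is zero.
\<close>

lemma bvp_exists:
  fixes f :: "real \<Rightarrow> real"
  assumes f: "continuous_on {-1..1} f"
  obtains u \<theta> m T1 T2 where "bvp f u \<theta> m T1 T2"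
proof -
  have z: "continuous_on {-1..1} (\<lambda>x. 0 :: real)" by simp
  obtain u \<theta> m T1 T2 where h1: "shoot (\<lambda>x. 0) u \<theta> m T1 T2" "\<theta> (-1) = 1" "T1 (-1) = (0::real)"
    using shoot_exists[OF z] .
  obtain v \<phi> n R1 R2 where h2: "shoot (\<lambda>x. 0) v \<phi> n R1 R2" "\<phi> (-1) = 0" "R1 (-1) = (1::real)"
    using shoot_exists[OF z] .
  obtain w \<psi> k P1 P2 where p: "shoot f w \<psi> k P1 P2" using shoot_exists[OF f] .
  have comb: "shoot f (\<lambda>x. (w x + \<alpha> * u x) + \<beta> * v x) (\<lambda>x. (\<psi> x + \<alpha> * \<theta> x) + \<beta> * \<phi> x) (\<lambda>x. (k x + \<alpha> * m x) + \<beta> * n x)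
      (\<lambda>x. (P1 x + \<alpha> * T1 x) + \<beta> * R1 x) (\<lambda>x. (P2 x + \<alpha> * T2 x) + \<beta> * R2 x)"
    if "shoot f w \<psi> k P1 P2" for \<alpha> \<beta> f w \<psi> k P1 P2
    using shoot_lincomb[OF shoot_lincomb[OF that h1(1), of \<alpha>] h2(1), of \<beta>] by simp
  have z0: "shoot (\<lambda>x. 0) (\<lambda>x. 0) (\<lambda>x. 0) (\<lambda>x. 0) (\<lambda>x. 0) (\<lambda>x. 0 :: real)"
    by (simp add: shoot_def beam_sys_def has_deriv_on_def)
  have inj: "\<alpha> = 0 \<and> \<beta> = 0" if "\<alpha> * u 1 + \<beta> * v 1 = 0" "\<alpha> * m 1 + \<beta> * n 1 = 0" for \<alpha> \<beta>
  proof -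
    have b: "bvp (\<lambda>x. 0) (\<lambda>x. (0 + \<alpha> * u x) + \<beta> * v x) (\<lambda>x. (0 + \<alpha> * \<theta> x) + \<beta> * \<phi> x) (\<lambda>x. (0 + \<alpha> * m x) + \<beta> * n x)
      (\<lambda>x. (0 + \<alpha> * T1 x) + \<beta> * R1 x) (\<lambda>x. (0 + \<alpha> * T2 x) + \<beta> * R2 x)"
      using comb[OF z0] that by (simp add: bvp_iff_shoot)
    show ?thesis using bvp_homogeneous(1,3)[OF b, of "-1"] h1 h2 by simp
  qed
  define D where "D = u 1 * n 1 - v 1 * m 1"
  have D: "D \<noteq> 0"
  proof
    assume "D = 0"
    then have e: "u 1 * n 1 = v 1 * m 1" by (simp add: D_def)
    \<comment> \<open>If \<open>D = 0\<close>, then both \<open>(n 1, - m 1)\<close> and \<open>(v 1, - u 1)\<close> lie in the kernel, so the matrix is zero.\<close>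
    have "n 1 = 0 \<and> - m 1 = 0" by (rule inj) (use e in \<open>auto simp: mult_ac\<close>)
    moreover have "v 1 = 0 \<and> - u 1 = 0" by (rule inj) (use e in \<open>auto simp: mult_ac\<close>)
    ultimately show False using inj[of 1 0] by simp
  qed
  define \<alpha> where "\<alpha> = (v 1 * k 1 - w 1 * n 1) / D"
  define \<beta> where "\<beta> = (w 1 * m 1 - u 1 * k 1) / D"
  have "(w 1 + \<alpha> * u 1) + \<beta> * v 1 = 0" "(k 1 + \<alpha> * m 1) + \<beta> * n 1 = 0"
    using D by (simp_all add: \<alpha>_def \<beta>_def field_simps) (simp_all add: D_def algebra_simps)
  then have "bvp f (\<lambda>x. (w x + \<alpha> * u x) + \<beta> * v x) (\<lambda>x. (\<psi> x + \<alpha> * \<theta> x) + \<beta> * \<phi> x) (\<lambda>x. (k x + \<alpha> * m x) + \<beta> * n x)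
      (\<lambda>x. (P1 x + \<alpha> * T1 x) + \<beta> * R1 x) (\<lambda>x. (P2 x + \<alpha> * T2 x) + \<beta> * R2 x)"
    using comb[OF p] by (simp add: bvp_iff_shoot)
  then show thesis by (rule that)
qed

lemma bvp_unique:
  fixes u v :: "real \<Rightarrow> real"
  assumes u: "bvp f u \<theta> m T1 T2" and v: "bvp f v \<phi> n R1 R2" and x: "x \<in> {-1..1}"
  shows "u x = v x"
proof -
  have "bvp (\<lambda>x. 0) (\<lambda>x. u x + (- 1) * v x) (\<lambda>x. \<theta> x + (- 1) * \<phi> x) (\<lambda>x. m x + (- 1) * n x)
      (\<lambda>x. T1 x + (- 1) * R1 x) (\<lambda>x. T2 x + (- 1) * R2 x)"
    using bvp_lincomb[OF u v, of "- 1"] by simp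
  from bvp_homogeneous(2)[OF this x] show ?thesis by simp
qed

lemma mass_inner_zero_imp:
  assumes f: "continuous_on {-1..1} f" and z: "mass_inner f f = 0" and x: "x \<in> {-1..1}"
  shows "f x = 0"
proof -
  have c: "continuous_on {-1..0} f" "continuous_on {0..1} f" using f by (auto simp: continuous_on_glue)
  have n1: "0 \<le> r1 x * f x * f x" if "x \<in> {-1..0}" for x using r(1)[OF that] by (simp add: mult.assoc)
  have n2: "0 \<le> r2 x * f x * f x" if "x \<in> {0..1}" for x using r(2)[OF that] by (simp add: mult.assoc)
  have "0 \<le> M * f 0 * f 0" using M by (simp add: mult.assoc)
  then have e: "integral {-1..0} (\<lambda>x. r1 x * f x * f x) = 0" "integral {0..1} (\<lambda>x. r2 x * f x * f x) = 0"
    using weighted_square_integral_nonneg[OF cr(1) c(1)] weighted_square_integral_nonneg[OF cr(2) c(2)] r z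
    by (auto simp: mass_inner_def less_imp_le)
  have k: "continuous_on {-1..0} (\<lambda>x. r1 x * f x * f x)" "continuous_on {0..1} (\<lambda>x. r2 x * f x * f x)"
    by (intro continuous_intros c cr)+
  have z1: "r1 x * f x * f x = 0" if "x \<in> {-1..0}" for x
    using integral_eq_0_iff[of "-1" 0 "\<lambda>x. r1 x * f x * f x"] e(1) n1 that k by auto
  have z2: "r2 x * f x * f x = 0" if "x \<in> {0..1}" for x
    using integral_eq_0_iff[of 0 1 "\<lambda>x. r2 x * f x * f x"] e(2) n2 that k by auto
  show ?thesis
  proof (cases "x \<le> 0")
    case True
    then have "x \<in> {-1..0}" using x by simp
    then show ?thesis using z1[of x] r(1)[of x] by auto
  next
    case False
    then have "x \<in> {0..1}" using x by simp
    then show ?thesis using z2[of x] r(2)[of x] by auto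
  qed
qed

end

section \<open>Eigenvectors of compact symmetric operators\<close>

text \<open>
  Two norms are in play: the seminorm of the form \<open>B\<close>, and the stronger norm of the space. The operator
  \<open>K\<close> maps sequences bounded in the seminorm to sequences with a subsequence convergent in the norm. This
  smoothing replaces completeness for the seminorm, so that continuous functions suffice as the space.
\<close>

locale compact_psd =
  fixes B :: "'v::real_normed_vector \<Rightarrow> 'v \<Rightarrow> real" and K :: "'v \<Rightarrow> 'v" and b k :: real
  assumes B_sym: "B f g = B g f"
    and B_add: "B (f + g) h = B f h + B g h"
    and B_scale: "B (c *\<^sub>R f) h = c * B f h"
    and B_nonneg: "0 \<le> B f f"
    and B_le: "B f f \<le> b * (norm f)\<^sup>2"
    and K_linear: "linear K"
    and K_sym: "B (K f) g = B f (K g)"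
    and K_nonneg: "0 \<le> B (K f) f"
    and K_le: "norm (K f) \<le> k * sqrt (B f f)"
    and b_nonneg: "0 \<le> b"
    and k_nonneg: "0 \<le> k"
    and K_compact: "\<And>f :: nat \<Rightarrow> 'v. (\<And>n. B (f n) (f n) \<le> 1) \<Longrightarrow>
      \<exists>r h. strict_mono (r :: nat \<Rightarrow> nat) \<and> (\<lambda>n. K (f (r n))) \<longlonglongrightarrow> h"
begin

lemma B_add_right: "B h (f + g) = B h f + B h g"
  using B_add B_sym by metis

lemma B_scale_right: "B h (c *\<^sub>R f) = c * B h f"
  using B_scale B_sym by metis

lemma B_uminus: "B (- f) h = - B f h" "B h (- f) = - B h f"
  using B_scale[of "-1" f h] B_scale_right[of h "-1" f] by simp_all

lemma B_diff: "B (f - g) h = B f h - B g h" "B h (f - g) = B h f - B h g"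
  using B_add[of f "- g" h] B_add_right[of h f "- g"] by (simp_all add: B_uminus)

lemma B_zero [simp]: "B 0 h = 0" "B h 0 = 0"
  using B_scale[of 0 h h] B_scale_right[of h 0 h] by simp_all

lemma B_sum: "B (\<Sum>i\<in>I. f i) h = (\<Sum>i\<in>I. B (f i) h)"
  by (induction I rule: infinite_finite_induct) (auto simp: B_add)

lemma B_cauchy_schwarz: "(B f g)\<^sup>2 \<le> B f f * B g g"
proof (rule quadratic_nonneg_imp_square_le[OF B_nonneg])
  fix z
  show "0 \<le> z\<^sup>2 * B f f - 2 * z * B f g + B g g"
    using B_nonneg[of "g - z *\<^sub>R f"] B_sym[of f g]
    by (simp add: B_diff B_scale B_scale_right power2_eq_square algebra_simps)
qed

lemma K_cauchy_schwarz: "(B (K f) g)\<^sup>2 \<le> B (K f) f * B (K g) g"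
proof (rule quadratic_nonneg_imp_square_le[OF K_nonneg])
  fix z
  have "B (K g) f = B (K f) g" using K_sym[of g f] B_sym by metis
  then show "0 \<le> z\<^sup>2 * B (K f) f - 2 * z * B (K f) g + B (K g) g"
    using K_nonneg[of "g - z *\<^sub>R f"] K_linear
    by (simp add: linear_diff linear_scale B_diff B_scale B_scale_right power2_eq_square algebra_simps)
qed

lemma K_bounded_linear: "bounded_linear K"
proof (rule bounded_linear_intro)
  show "K (f + g) = K f + K g" "K (c *\<^sub>R f) = c *\<^sub>R K f" for f g c
    using K_linear by (auto simp: linear_add linear_scale)
  show "norm (K f) \<le> norm f * (k * sqrt b)" for f
  proof -
    have "sqrt (B f f) \<le> sqrt (b * (norm f)\<^sup>2)" using B_le by (rule real_sqrt_le_mono)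
    then have "k * sqrt (B f f) \<le> k * (sqrt b * norm f)"
      using k_nonneg by (intro mult_left_mono) (auto simp: real_sqrt_mult)
    then show ?thesis using K_le[of f] by (simp add: mult_ac)
  qed
qed

lemma tendsto_B:
  assumes "f \<longlonglongrightarrow> h" shows "(\<lambda>n. B (f n) g) \<longlonglongrightarrow> B h g"
proof -
  have "(\<lambda>n. B (f n - h) g) \<longlonglongrightarrow> 0"
  proof (rule Lim_null_comparison)
    show "\<forall>\<^sub>F n in sequentially. norm (B (f n - h) g) \<le> sqrt (b * (norm (f n - h))\<^sup>2 * B g g)"
    proof (rule always_eventually, rule allI)
      fix n
      have "(B (f n - h) g)\<^sup>2 \<le> b * (norm (f n - h))\<^sup>2 * B g g"
        using B_cauchy_schwarz[of "f n - h" g] mult_right_mono[OF B_le[of "f n - h"] B_nonneg[of g]]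
        by linarith
      then show "norm (B (f n - h) g) \<le> sqrt (b * (norm (f n - h))\<^sup>2 * B g g)"
        by (simp add: real_le_rsqrt)
    qed
    have "(\<lambda>n. f n - h) \<longlonglongrightarrow> 0" using assms by (simp add: LIM_zero)
    then have "(\<lambda>n. sqrt (b * (norm (f n - h))\<^sup>2 * B g g)) \<longlonglongrightarrow> sqrt (b * (norm (0 :: 'v))\<^sup>2 * B g g)"
      by (intro tendsto_intros)
    then show "(\<lambda>n. sqrt (b * (norm (f n - h))\<^sup>2 * B g g)) \<longlonglongrightarrow> 0" by simp
  qed
  then have "(\<lambda>n. B (f n) g - B h g) \<longlonglongrightarrow> 0" by (simp add: B_diff)
  then show ?thesis by (rule LIM_zero_cancel)
qed

lemma B_null: "B f f = 0 \<Longrightarrow> B f g = 0"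
  using B_cauchy_schwarz[of f g] by simp

text \<open>
  Let \<open>\<mu>\<close> be the supremum of the Rayleigh quotient on \<open>W\<close>. Along a maximizing sequence \<open>y\<^sub>n\<close> the seminorm
  of \<open>K y\<^sub>n - \<mu> y\<^sub>n\<close> tends to \<open>0\<close>, hence \<open>K (K y\<^sub>n) - \<mu> K y\<^sub>n\<close> tends to \<open>0\<close> in norm, and a limit of the \<open>K y\<^sub>n\<close>
  is an eigenvector. The argument shows convergence of the \<open>K y\<^sub>n\<close> only, not of the \<open>y\<^sub>n\<close>.
\<close>

lemma eigenvector_exists:
  assumes W_scale: "\<And>c f. f \<in> W \<Longrightarrow> c *\<^sub>R f \<in> W"
    and W_K: "\<And>f. f \<in> W \<Longrightarrow> K f \<in> W"
    and W_closed: "\<And>f h. (\<And>n. f n \<in> W) \<Longrightarrow> f \<longlonglongrightarrow> h \<Longrightarrow> h \<in> W"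
    and g: "g \<in> W" "B (K g) g > 0"
  obtains h \<mu> where "h \<in> W" "\<mu> > 0" "K h = \<mu> *\<^sub>R h" "B h h > 0"
proof -
  define A where "A = {B (K f) f | f. f \<in> W \<and> B f f \<le> 1}"
  define \<mu> where "\<mu> = Sup A"
  have bdd: "bdd_above A"
  proof (rule bdd_aboveI)
    fix t assume "t \<in> A"
    then obtain f where f: "f \<in> W" "B f f \<le> 1" "t = B (K f) f" by (auto simp: A_def)
    have "B (K f) (K f) \<le> b * k\<^sup>2"
    proof -
      have "norm (K f) \<le> k * sqrt (B f f)" by (rule K_le)
      also have "\<dots> \<le> k * 1" using f(2) k_nonneg by (intro mult_left_mono) auto
      finally have "(norm (K f))\<^sup>2 \<le> k\<^sup>2" by (intro power_mono) auto
      then show ?thesis using B_le[of "K f"] b_nonneg mult_left_mono[of "(norm (K f))\<^sup>2" "k\<^sup>2" b] by linarith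
    qed
    then have "B (K f) (K f) * B f f \<le> b * k\<^sup>2 * 1"
      using f(2) B_nonneg b_nonneg by (intro mult_mono) auto
    then have "t\<^sup>2 \<le> b * k\<^sup>2" using B_cauchy_schwarz[of "K f" f] f(3) by simp
    then show "t \<le> sqrt (b * k\<^sup>2)" by (rule real_le_rsqrt)
  qed
  have Bg: "B g g > 0"
  proof (rule ccontr)
    assume "\<not> B g g > 0"
    then have "B g g = 0" using B_nonneg[of g] by simp
    then have "B g (K g) = 0" by (rule B_null)
    then show False using g(2) B_sym[of g "K g"] by simp
  qed
  have scaled: "B (K f) f / B f f \<in> A" if "f \<in> W" "B f f > 0" for f
  proof -
    let ?c = "1 / sqrt (B f f)"
    have cc: "?c * ?c = 1 / B f f" using that(2) by simp
    have 1: "?c *\<^sub>R f \<in> W" by (rule W_scale[OF that(1)])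
    have "B (?c *\<^sub>R f) (?c *\<^sub>R f) = (?c * ?c) * B f f" by (simp only: B_scale B_scale_right mult.assoc)
    then have 2: "B (?c *\<^sub>R f) (?c *\<^sub>R f) \<le> 1" unfolding cc using that(2) by simp
    have "B (K (?c *\<^sub>R f)) (?c *\<^sub>R f) = (?c * ?c) * B (K f) f"
      by (simp only: linear_scale[OF K_linear] B_scale B_scale_right mult.assoc)
    then have "B (K f) f / B f f = B (K (?c *\<^sub>R f)) (?c *\<^sub>R f)" unfolding cc by simp
    with 1 2 show ?thesis unfolding A_def by blast
  qed
  have "0 < B (K g) g / B g g" using g Bg by simp
  also have "\<dots> \<le> \<mu>" unfolding \<mu>_def by (rule cSup_upper[OF scaled[OF g(1) Bg] bdd])
  finally have \<mu>: "\<mu> > 0" .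
  have r1: "B (K f) f \<le> \<mu> * B f f" if "f \<in> W" for f
  proof (cases "B f f > 0")
    case True
    have "B (K f) f / B f f \<le> \<mu>" unfolding \<mu>_def by (rule cSup_upper[OF scaled[OF that True] bdd])
    then show ?thesis using True by (simp add: field_simps)
  next
    case False
    then have "B f f = 0" using B_nonneg[of f] by simp
    then show ?thesis using B_null[of f "K f"] B_sym[of f "K f"] by simp
  qed
  \<comment> \<open>Cauchy-Schwarz for the form \<open>B (K f) g\<close>, applied to \<open>f\<close> and \<open>K f\<close>.\<close>
  have r2: "B (K f) (K f) \<le> \<mu> * B (K f) f" if "f \<in> W" for f
  proof (cases "B (K f) (K f) = 0")
    case True
    then show ?thesis using K_nonneg[of f] \<mu> by simp
  next
    case False
    have "(B (K f) (K f))\<^sup>2 \<le> B (K f) f * B (K (K f)) (K f)" by (rule K_cauchy_schwarz)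
    also have "\<dots> \<le> B (K f) f * (\<mu> * B (K f) (K f))"
      using r1[OF W_K[OF that]] K_nonneg[of f] by (intro mult_left_mono) auto
    finally have "B (K f) (K f) * B (K f) (K f) \<le> (\<mu> * B (K f) f) * B (K f) (K f)"
      by (simp add: power2_eq_square mult_ac)
    then show ?thesis using False B_nonneg[of "K f"] by (simp add: mult_le_cancel_right)
  qed
  have "\<exists>f. f \<in> W \<and> B f f \<le> 1 \<and> B (K f) f > \<mu> - inverse (real (Suc n))" for n
  proof -
    have "\<mu> - inverse (real (Suc n)) < Sup A" by (simp add: \<mu>_def)
    then obtain t where "t \<in> A" "\<mu> - inverse (real (Suc n)) < t"
      using less_cSup_iff[OF _ bdd] scaled[OF g(1) Bg] by blast
    then show ?thesis by (auto simp: A_def)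
  qed
  then obtain f where f: "\<And>n. f n \<in> W" "\<And>n. B (f n) (f n) \<le> 1"
    "\<And>n. B (K (f n)) (f n) > \<mu> - inverse (real (Suc n))" by metis
  obtain r h where r: "strict_mono (r :: nat \<Rightarrow> nat)" and h: "(\<lambda>n. K (f (r n))) \<longlonglongrightarrow> h"
    using K_compact[of f, OF f(2)] by blast
  let ?y = "\<lambda>n. f (r n)"
  let ?e = "\<lambda>n. inverse (real (Suc (r n)))"
  have e0: "?e \<longlonglongrightarrow> 0"
    using LIMSEQ_subseq_LIMSEQ[OF LIMSEQ_inverse_real_of_nat r] by (simp add: o_def)
  have hW: "h \<in> W" by (rule W_closed[OF _ h]) (intro W_K f(1))
  have defect: "B (K (?y n) - \<mu> *\<^sub>R ?y n) (K (?y n) - \<mu> *\<^sub>R ?y n) \<le> \<mu> * ?e n" for n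
  proof -
    let ?q = "B (K (?y n)) (?y n)"
    have "B (K (?y n) - \<mu> *\<^sub>R ?y n) (K (?y n) - \<mu> *\<^sub>R ?y n)
        = B (K (?y n)) (K (?y n)) - 2 * \<mu> * ?q + \<mu> * \<mu> * B (?y n) (?y n)"
      using B_sym[of "?y n" "K (?y n)"] by (simp add: B_diff B_scale B_scale_right algebra_simps)
    also have "\<dots> \<le> \<mu> * ?q - 2 * \<mu> * ?q + \<mu> * \<mu> * 1"
      using r2[OF f(1)] f(2) \<mu> by (intro add_mono diff_mono mult_left_mono) auto
    also have "\<dots> = \<mu> * (\<mu> - ?q)" by (simp add: algebra_simps)
    also have "\<dots> \<le> \<mu> * ?e n" using f(3)[of "r n"] \<mu> by (intro mult_left_mono) auto
    finally show ?thesis .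
  qed
  have "(\<lambda>n. K (K (?y n) - \<mu> *\<^sub>R ?y n)) \<longlonglongrightarrow> 0"
  proof (rule Lim_null_comparison)
    show "\<forall>\<^sub>F n in sequentially. norm (K (K (?y n) - \<mu> *\<^sub>R ?y n)) \<le> k * sqrt (\<mu> * ?e n)"
    proof (rule always_eventually, rule allI)
      fix n
      show "norm (K (K (?y n) - \<mu> *\<^sub>R ?y n)) \<le> k * sqrt (\<mu> * ?e n)"
        using K_le[of "K (?y n) - \<mu> *\<^sub>R ?y n"] mult_left_mono[OF real_sqrt_le_mono[OF defect[of n]] k_nonneg]
        by linarith
    qed
    have "(\<lambda>n. k * sqrt (\<mu> * ?e n)) \<longlonglongrightarrow> k * sqrt (\<mu> * 0)" by (intro tendsto_intros e0)
    then show "(\<lambda>n. k * sqrt (\<mu> * ?e n)) \<longlonglongrightarrow> 0" by simp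
  qed
  moreover have "(\<lambda>n. K (K (?y n) - \<mu> *\<^sub>R ?y n)) \<longlonglongrightarrow> K h - \<mu> *\<^sub>R h"
  proof -
    have "(\<lambda>n. K (K (?y n)) - \<mu> *\<^sub>R K (?y n)) \<longlonglongrightarrow> K h - \<mu> *\<^sub>R h"
      by (intro tendsto_intros h bounded_linear.tendsto[OF K_bounded_linear h])
    then show ?thesis by (simp add: linear_diff[OF K_linear] linear_scale[OF K_linear])
  qed
  ultimately have "K h - \<mu> *\<^sub>R h = 0" using LIMSEQ_unique by blast
  then have Kh: "K h = \<mu> *\<^sub>R h" by simp
  have "B h h \<noteq> 0"
  proof
    assume z: "B h h = 0"
    have hB: "B h g = 0" "B g h = 0" for g using B_null[OF z, of g] B_sym[of g h] by simp_all
    have "(\<lambda>n. K (?y n) - h) \<longlonglongrightarrow> 0" using h by (simp add: LIM_zero)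
    then have n0: "(\<lambda>n. b * (norm (K (?y n) - h))\<^sup>2) \<longlonglongrightarrow> b * (norm (0::'v))\<^sup>2" by (intro tendsto_intros)
    have "(\<mu> - ?e n)\<^sup>2 \<le> b * (norm (K (?y n) - h))\<^sup>2" if "?e n \<le> \<mu>" for n
    proof -
      have "(\<mu> - ?e n)\<^sup>2 \<le> (B (K (?y n)) (?y n))\<^sup>2"
        using f(3)[of "r n"] that by (intro power_mono) auto
      also have "\<dots> \<le> B (K (?y n)) (K (?y n)) * B (?y n) (?y n)" by (rule B_cauchy_schwarz)
      also have "\<dots> \<le> B (K (?y n)) (K (?y n)) * 1" using f(2) B_nonneg by (intro mult_left_mono) auto
      also have "\<dots> = B (K (?y n) - h) (K (?y n) - h)"
        using hB by (simp add: B_diff)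
      also have "\<dots> \<le> b * (norm (K (?y n) - h))\<^sup>2" by (rule B_le)
      finally show ?thesis .
    qed
    moreover have "\<forall>\<^sub>F n in sequentially. ?e n < \<mu>" using order_tendstoD(2)[OF e0 \<mu>] .
    ultimately have ev: "\<forall>\<^sub>F n in sequentially. (\<mu> - ?e n)\<^sup>2 \<le> b * (norm (K (?y n) - h))\<^sup>2"
      by (auto elim!: eventually_mono)
    have "(\<lambda>n. (\<mu> - ?e n)\<^sup>2) \<longlonglongrightarrow> (\<mu> - 0)\<^sup>2" by (intro tendsto_intros e0)
    from tendsto_le[OF sequentially_bot n0 this ev] show False using \<mu> by simp
  qed
  then have "B h h > 0" using B_nonneg[of h] by simp
  with that hW \<mu> Kh show thesis by blast
qed

text \<open>
  Otherwise the images of the orthonormal \<open>e i\<close> would stay at least a fixed distance apart, which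
  compactness forbids.
\<close>

lemma eigenvalues_accumulate_only_at_0:
  assumes orth: "\<And>i j :: nat. i \<noteq> j \<Longrightarrow> B (e i) (e j) = 0" and unit: "\<And>i. B (e i) (e i) = 1"
    and eig: "\<And>i. K (e i) = \<mu> i *\<^sub>R e i" and \<delta>: "\<delta> > 0" "\<And>i. \<mu> i \<ge> \<delta>"
  shows False
proof -
  obtain r h where r: "strict_mono (r :: nat \<Rightarrow> nat)" and h: "(\<lambda>n. K (e (r n))) \<longlonglongrightarrow> h"
    using K_compact[of e] unit by auto
  have d: "2 * \<delta>\<^sup>2 \<le> b * (norm (K (e (r (Suc n))) - K (e (r n))))\<^sup>2" for n
  proof -
    have ne: "r (Suc n) \<noteq> r n" using strict_mono_less[OF r, of n "Suc n"] by simp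
    have "\<delta>\<^sup>2 \<le> (\<mu> i)\<^sup>2" for i using \<delta>(1) \<delta>(2)[of i] by (intro power_mono) auto
    then have "2 * \<delta>\<^sup>2 \<le> (\<mu> (r (Suc n)))\<^sup>2 + (\<mu> (r n))\<^sup>2" by (metis add_mono mult_2)
    also have "\<dots> = B (K (e (r (Suc n))) - K (e (r n))) (K (e (r (Suc n))) - K (e (r n)))"
      using orth[OF ne] orth[OF ne[symmetric]] unit
      by (simp add: eig B_diff B_scale B_scale_right power2_eq_square)
    also have "\<dots> \<le> b * (norm (K (e (r (Suc n))) - K (e (r n))))\<^sup>2" by (rule B_le)
    finally show ?thesis .
  qed
  have "(\<lambda>n. K (e (r (Suc n))) - K (e (r n))) \<longlonglongrightarrow> h - h" by (intro tendsto_diff LIMSEQ_Suc h)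
  then have "(\<lambda>n. b * (norm (K (e (r (Suc n))) - K (e (r n))))\<^sup>2) \<longlonglongrightarrow> b * (norm (h - h))\<^sup>2"
    by (intro tendsto_mult tendsto_const tendsto_power tendsto_norm)
  then have "(\<lambda>n. b * (norm (K (e (r (Suc n))) - K (e (r n))))\<^sup>2) \<longlonglongrightarrow> 0" by simp
  then have "2 * \<delta>\<^sup>2 \<le> 0"
    by (rule LIMSEQ_le_const) (use d in auto)
  then show False using \<delta>(1) by simp
qed

end

context two_beams
begin

section \<open>The solution operator\<close>

definition solves :: "(real \<Rightarrow> 'a::euclidean_space) \<Rightarrow> (real \<Rightarrow> 'a) \<Rightarrow> bool" where
  "solves f u \<longleftrightarrow> (\<exists>\<theta> m T1 T2. bvp f u \<theta> m T1 T2)"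

lemma solves_cong:
  assumes "solves f u" "\<And>x. x \<in> {-1..1} \<Longrightarrow> f x = g x" "\<And>x. x \<in> {-1..1} \<Longrightarrow> u x = v x"
  shows "solves g v"
proof -
  obtain \<theta> m T1 T2 where 1: "bvp f u \<theta> m T1 T2" using assms(1) by (auto simp: solves_def)
  have b: "beam_sys (-1) 0 s1 q1 u \<theta> m T1 (\<lambda>x. r1 x *\<^sub>R f x)" "beam_sys 0 1 s2 q2 u \<theta> m T2 (\<lambda>x. r2 x *\<^sub>R f x)"
    using 1 by (auto simp: bvp_def)
  have "beam_sys (-1) 0 s1 q1 v \<theta> m T1 (\<lambda>x. r1 x *\<^sub>R g x)"
    by (rule beam_sys_cong[OF b(1)]) (simp_all add: assms(2,3))
  moreover have "beam_sys 0 1 s2 q2 v \<theta> m T2 (\<lambda>x. r2 x *\<^sub>R g x)"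
    by (rule beam_sys_cong[OF b(2)]) (simp_all add: assms(2,3))
  ultimately have "bvp g v \<theta> m T1 T2"
    using 1 assms(2)[of 0] assms(3)[of "-1"] assms(3)[of 1] by (simp add: bvp_def)
  then show ?thesis by (auto simp: solves_def)
qed

text \<open>
  Elements of \<open>C[-1, 1]\<close> are represented by bounded continuous functions on the real line. The result
  is extended by constants outside \<open>[-1, 1]\<close>, which makes it unique; the argument matters only on
  \<open>[-1, 1]\<close>.
\<close>

definition K :: "(real \<Rightarrow>\<^sub>C real) \<Rightarrow> (real \<Rightarrow>\<^sub>C real)" where
  "K f = (SOME h. solves (apply_bcontfun f) (apply_bcontfun h) \<and> (\<forall>x. h x = h (clamp (-1) 1 x)))"

lemma clamp_mem: "clamp (-1) 1 x \<in> {-1..1::real}"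
  using clamp_in_interval[of "-1" 1 x] by simp

lemma bcontfun_continuous_on: "continuous_on S (apply_bcontfun (f :: real \<Rightarrow>\<^sub>C real))"
  by (rule continuous_on_subset[of UNIV]) (auto intro: continuous_on_apply_bcontfun)

lemma bcontfun_ext:
  fixes u :: "real \<Rightarrow> real"
  assumes "continuous_on {-1..1} u"
  shows "\<exists>h :: real \<Rightarrow>\<^sub>C real. (\<forall>x\<in>{-1..1}. h x = u x) \<and> (\<forall>x. h x = h (clamp (-1) 1 x))"
proof -
  have "continuous_on (cbox (-1) 1) u" using assms by simp
  then obtain h :: "real \<Rightarrow>\<^sub>C real" where h: "\<And>x. x \<in> cbox (-1) 1 \<Longrightarrow> h x = u x" "\<And>x. h x = u (clamp (-1) 1 x)"
    using continuous_on_cbox_bcontfunE[of "-1" 1 u] by metis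
  have "h x = h (clamp (-1) 1 x)" for x
    using h(1)[of "clamp (-1) 1 x"] h(2)[of x] clamp_mem[of x] by simp
  moreover have "h x = u x" if "x \<in> {-1..1}" for x using h(1)[of x] that by simp
  ultimately show ?thesis by blast
qed

lemma solution_operator_solves: "solves (apply_bcontfun f) (apply_bcontfun (K f))" "K f x = K f (clamp (-1) 1 x)"
proof -
  obtain u \<theta> m T1 T2 where u: "bvp (apply_bcontfun f) u \<theta> m T1 T2"
    using bvp_exists[OF bcontfun_continuous_on] .
  obtain h :: "real \<Rightarrow>\<^sub>C real" where h: "\<And>x. x \<in> {-1..1} \<Longrightarrow> h x = u x" "\<And>x. h x = h (clamp (-1) 1 x)"
    using bcontfun_ext[OF bvp_continuous(1)[OF u]] by blast
  have "solves (apply_bcontfun f) u" using u by (auto simp: solves_def)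
  then have "solves (apply_bcontfun f) (apply_bcontfun h)"
    by (rule solves_cong) (simp_all add: h(1))
  then have "solves (apply_bcontfun f) (apply_bcontfun h) \<and> (\<forall>x. h x = h (clamp (-1) 1 x))" using h(2) by blast
  then have "solves (apply_bcontfun f) (apply_bcontfun (K f)) \<and> (\<forall>x. K f x = K f (clamp (-1) 1 x))"
    unfolding K_def by (rule someI)
  then show "solves (apply_bcontfun f) (apply_bcontfun (K f))" "K f x = K f (clamp (-1) 1 x)" by blast+
qed

lemma solves_unique:
  fixes u v :: "real \<Rightarrow> real"
  shows "solves f u \<Longrightarrow> solves f v \<Longrightarrow> x \<in> {-1..1} \<Longrightarrow> u x = v x"
  unfolding solves_def using bvp_unique by blast

lemma solves_lincomb:
  fixes u v :: "real \<Rightarrow> real"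
  shows "solves f u \<Longrightarrow> solves g v \<Longrightarrow> solves (\<lambda>x. f x + c * g x) (\<lambda>x. u x + c * v x)"
  unfolding solves_def using bvp_lincomb[of f u _ _ _ _ g v _ _ _ _ c] by fastforce

lemma solution_operator_eqI:
  fixes h :: "real \<Rightarrow>\<^sub>C real"
  assumes "solves (apply_bcontfun f) u" "\<And>x. x \<in> {-1..1} \<Longrightarrow> h x = u x" "\<And>x. h x = h (clamp (-1) 1 x)"
  shows "K f = h"
proof (rule bcontfun_eqI)
  fix x
  have "K f x = K f (clamp (-1) 1 x)" by (rule solution_operator_solves(2))
  also have "\<dots> = u (clamp (-1) 1 x)" by (rule solves_unique[OF solution_operator_solves(1) assms(1) clamp_mem])
  also have "\<dots> = h x" using assms(2)[OF clamp_mem[of x]] assms(3)[of x] by simp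
  finally show "K f x = h x" .
qed

abbreviation B :: "(real \<Rightarrow>\<^sub>C real) \<Rightarrow> (real \<Rightarrow>\<^sub>C real) \<Rightarrow> real" where
  "B f g \<equiv> mass_inner (apply_bcontfun f) (apply_bcontfun g)"

lemma solves_energy:
  fixes u :: "real \<Rightarrow> real"
  assumes "solves f u" "continuous_on {-1..1} f"
  shows "0 \<le> mass_inner f u"
proof -
  obtain \<theta> m T1 T2 where u: "bvp f u \<theta> m T1 T2" using assms(1) by (auto simp: solves_def)
  show ?thesis
    using bvp_green[OF u u assms(2)] energy_nonneg[OF bvp_continuous(2,3)[OF u]] by simp
qed

lemma solves_continuous: "solves f u \<Longrightarrow> continuous_on {-1..1} (u :: real \<Rightarrow> real)"
  using bvp_continuous(1) by (auto simp: solves_def)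

lemma solves_symmetric:
  fixes u v :: "real \<Rightarrow> real"
  assumes "solves f u" "solves g v" "continuous_on {-1..1} f" "continuous_on {-1..1} g"
  shows "mass_inner f v = mass_inner g u"
  using bvp_symmetric assms unfolding solves_def by blast

definition Kbound :: real where "Kbound = 4 * total_compliance * sqrt total_mass"

lemma Kbound_nonneg: "0 \<le> Kbound" using total_compliance_nonneg total_mass_nonneg by (simp add: Kbound_def)

lemma solution_operator_bounds:
  "\<bar>K f x\<bar> \<le> Kbound * sqrt (B f f)"
  "x \<in> {-1..1} \<Longrightarrow> y \<in> {-1..1} \<Longrightarrow> \<bar>K f x - K f y\<bar> \<le> Kbound * sqrt (B f f) * \<bar>x - y\<bar>"
proof -
  obtain \<theta> m T1 T2 where u: "bvp (apply_bcontfun f) (apply_bcontfun (K f)) \<theta> m T1 T2"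
    using solution_operator_solves(1)[of f] by (auto simp: solves_def)
  show "\<bar>K f x\<bar> \<le> Kbound * sqrt (B f f)"
    using bvp_rhs_bounds(2)[OF u bcontfun_continuous_on clamp_mem[of x]] solution_operator_solves(2)[of f x] by (simp add: Kbound_def)
  show "x \<in> {-1..1} \<Longrightarrow> y \<in> {-1..1} \<Longrightarrow> \<bar>K f x - K f y\<bar> \<le> Kbound * sqrt (B f f) * \<bar>x - y\<bar>"
    using bvp_rhs_bounds(3)[OF u bcontfun_continuous_on] by (simp add: Kbound_def)
qed

text \<open>
  The images are uniformly bounded and uniformly Lipschitz.
\<close>

lemma solution_operator_compact:
  fixes f :: "nat \<Rightarrow> real \<Rightarrow>\<^sub>C real"
  assumes "\<And>n. B (f n) (f n) \<le> 1"
  shows "\<exists>r h. strict_mono (r :: nat \<Rightarrow> nat) \<and> (\<lambda>n. K (f (r n))) \<longlonglongrightarrow> h"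
proof -
  have le: "Kbound * sqrt (B (f n) (f n)) \<le> Kbound" for n
    using mult_left_mono[of "sqrt (B (f n) (f n))" 1 Kbound] assms[of n] Kbound_nonneg by simp
  have b: "norm (K (f n) x) \<le> Kbound" for n x
    using order_trans[OF solution_operator_bounds(1) le] by simp
  have eq: "\<exists>d. 0 < d \<and> (\<forall>n y. y \<in> {-1..1} \<and> norm (x - y) < d \<longrightarrow> norm (K (f n) x - K (f n) y) < e)"
    if x: "x \<in> {-1..1}" and e: "0 < e" for x e
  proof (intro exI[of _ "e / (Kbound + 1)"] conjI allI impI)
    show "0 < e / (Kbound + 1)" using e Kbound_nonneg by simp
    fix n y assume y: "y \<in> {-1..1} \<and> norm (x - y) < e / (Kbound + 1)"
    have "\<bar>K (f n) x - K (f n) y\<bar> \<le> Kbound * sqrt (B (f n) (f n)) * \<bar>x - y\<bar>"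
      using solution_operator_bounds(2) x y by blast
    also have "\<dots> \<le> Kbound * \<bar>x - y\<bar>" using le by (intro mult_right_mono) auto
    also have "\<dots> \<le> Kbound * (e / (Kbound + 1))" using y Kbound_nonneg by (intro mult_left_mono) auto
    also have "\<dots> < e" using e Kbound_nonneg by (simp add: field_simps)
    finally show "norm (K (f n) x - K (f n) y) < e" by simp
  qed
  obtain g r where g: "continuous_on {-1..1} g" "strict_mono (r :: nat \<Rightarrow> nat)"
    "\<And>e. 0 < e \<Longrightarrow> \<exists>N. \<forall>n x. n \<ge> N \<and> x \<in> {-1..1} \<longrightarrow> norm (K (f (r n)) x - g x) < e"
    using Arzela_Ascoli[of "{-1..1}" "\<lambda>n. apply_bcontfun (K (f n))" Kbound] b eq by auto
  obtain h :: "real \<Rightarrow>\<^sub>C real" where h: "\<And>x. x \<in> {-1..1} \<Longrightarrow> h x = g x" "\<And>x. h x = h (clamp (-1) 1 x)"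
    using bcontfun_ext[OF g(1)] by blast
  have "(\<lambda>n. K (f (r n))) \<longlonglongrightarrow> h"
  proof (rule metric_LIMSEQ_I)
    fix e :: real assume e: "0 < e"
    then obtain N where N: "\<And>n x. n \<ge> N \<Longrightarrow> x \<in> {-1..1} \<Longrightarrow> norm (K (f (r n)) x - g x) < e / 2"
      using g(3)[of "e / 2"] by auto
    show "\<exists>N. \<forall>n\<ge>N. dist (K (f (r n))) h < e"
    proof (intro exI[of _ N] allI impI)
      fix n assume n: "n \<ge> N"
      have "dist (K (f (r n))) h \<le> e / 2"
      proof (rule dist_bound)
        fix x
        have "norm (K (f (r n)) (clamp (-1) 1 x) - g (clamp (-1) 1 x)) < e / 2" by (rule N[OF n clamp_mem])
        then show "dist (K (f (r n)) x) (h x) \<le> e / 2"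
          using solution_operator_solves(2)[of "f (r n)" x] h(2)[of x] h(1)[OF clamp_mem[of x]] by (simp add: dist_norm)
      qed
      then show "dist (K (f (r n))) h < e" using e by linarith
    qed
  qed
  then show ?thesis using g(2) by blast
qed

lemma inner_bcontfun_add: "B (f + g) h = B f h + B g h"
  using mass_inner_lincomb[OF bcontfun_continuous_on bcontfun_continuous_on bcontfun_continuous_on, of f 1 g h]
  by (simp add: plus_bcontfun.rep_eq)

lemma inner_bcontfun_scaleR: "B (c *\<^sub>R f) h = c * B f h"
proof -
  have "mass_inner (\<lambda>x. 0 + c * f x) (apply_bcontfun h) = mass_inner (\<lambda>x. 0) (apply_bcontfun h) + c * B f h"
    by (rule mass_inner_lincomb) (auto intro: bcontfun_continuous_on)
  then show ?thesis by (simp add: scaleR_bcontfun.rep_eq mass_inner_def)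
qed

lemma solution_operator_linear: "linear K"
proof (rule linearI)
  show "K (f + g) = K f + K g" for f g
  proof (rule solution_operator_eqI)
    show "solves (apply_bcontfun (f + g)) (\<lambda>x. K f x + 1 * K g x)"
      using solves_lincomb[OF solution_operator_solves(1)[of f] solution_operator_solves(1)[of g], of 1] by (simp add: plus_bcontfun.rep_eq)
    show "(K f + K g) x = (K f + K g) (clamp (-1) 1 x)" for x
      using solution_operator_solves(2)[of f x] solution_operator_solves(2)[of g x] by (simp add: plus_bcontfun.rep_eq)
  qed (simp add: plus_bcontfun.rep_eq)
  show "K (c *\<^sub>R f) = c *\<^sub>R K f" for c f
  proof (rule solution_operator_eqI)
    show "solves (apply_bcontfun (c *\<^sub>R f)) (\<lambda>x. K f x + (c - 1) * K f x)"
      using solves_lincomb[OF solution_operator_solves(1)[of f] solution_operator_solves(1)[of f], of "c - 1"]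
      by (simp add: scaleR_bcontfun.rep_eq algebra_simps)
    show "(c *\<^sub>R K f) x = (c *\<^sub>R K f) (clamp (-1) 1 x)" for x
      using solution_operator_solves(2)[of f x] by (simp add: scaleR_bcontfun.rep_eq)
  qed (simp add: scaleR_bcontfun.rep_eq algebra_simps)
qed

sublocale S: compact_psd B K total_mass Kbound
proof (rule compact_psd.intro)
  show "B f g = B g f" for f g by (rule mass_inner_commute)
  show "B (f + g) h = B f h + B g h" for f g h by (rule inner_bcontfun_add)
  show "B (c *\<^sub>R f) h = c * B f h" for c f h by (rule inner_bcontfun_scaleR)
  show "0 \<le> B f f" for f by (rule mass_inner_nonneg[OF bcontfun_continuous_on])
  show "B f f \<le> total_mass * (norm f)\<^sup>2" for f
    by (rule mass_inner_le[OF bcontfun_continuous_on]) (metis norm_bounded real_norm_def)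
  show "linear K" by (rule solution_operator_linear)
  show "B (K f) g = B f (K g)" for f g
    using solves_symmetric[OF solution_operator_solves(1) solution_operator_solves(1) bcontfun_continuous_on bcontfun_continuous_on, of f g] mass_inner_commute by metis
  show "0 \<le> B (K f) f" for f
    using solves_energy[OF solution_operator_solves(1) bcontfun_continuous_on] mass_inner_commute by metis
  show "norm (K f) \<le> Kbound * sqrt (B f f)" for f
    by (rule norm_bound) (simp add: solution_operator_bounds(1))
  show "0 \<le> total_mass" "0 \<le> Kbound" by (rule total_mass_nonneg Kbound_nonneg)+
  show "(\<And>n. B (f n) (f n) \<le> 1) \<Longrightarrow> \<exists>r h. strict_mono (r :: nat \<Rightarrow> nat) \<and> (\<lambda>n. K (f (r n))) \<longlonglongrightarrow> h" for f
    by (rule solution_operator_compact)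
qed

end

context two_beams
begin

section \<open>Existence and discreteness of the eigenvalues\<close>

definition eigenvalue :: "real \<Rightarrow> bool" where
  "eigenvalue l \<longleftrightarrow> (\<exists>u. solves (\<lambda>x. l * u x) u \<and> (\<exists>x\<in>{-1..1}. u x \<noteq> (0::real)))"

lemma mass_inner_pos:
  assumes "continuous_on {-1..1} u" "x \<in> {-1..1}" "u x \<noteq> 0"
  shows "0 < mass_inner u u"
  using mass_inner_nonneg[OF assms(1)] mass_inner_zero_imp[OF assms(1) _ assms(2)] assms(3) by fastforce

lemma mass_inner_scale:
  assumes "continuous_on {-1..1} u" "continuous_on {-1..1} v"
  shows "mass_inner (\<lambda>x. l * u x) v = l * mass_inner u v"
proof -
  have "mass_inner (\<lambda>x. 0 + l * u x) v = mass_inner (\<lambda>x. 0) v + l * mass_inner u v"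
    by (rule mass_inner_lincomb) (use assms in auto)
  then show ?thesis by (simp add: mass_inner_def)
qed

lemma eigenvalue_pos:
  fixes u :: "real \<Rightarrow> real"
  assumes u: "solves (\<lambda>x. l * u x) u" and x: "x \<in> {-1..1}" "u x \<noteq> 0"
  shows "0 < l"
proof -
  have c: "continuous_on {-1..1} u" by (rule solves_continuous[OF u])
  have "0 \<le> mass_inner (\<lambda>x. l * u x) u"
    by (rule solves_energy[OF u]) (intro continuous_intros c)
  then have "0 \<le> l * mass_inner u u" by (simp add: mass_inner_scale c)
  then have "0 \<le> l" using mass_inner_pos[OF c x] by (simp add: zero_le_mult_iff)
  moreover have "l \<noteq> 0"
  proof
    assume "l = 0"
    then have "solves (\<lambda>x. 0) u" using u by simp
    then show False using bvp_homogeneous(2)[OF _ x(1)] x(2) unfolding solves_def by blast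
  qed
  ultimately show ?thesis by simp
qed

lemma eigenvalue_K:
  fixes e :: "real \<Rightarrow>\<^sub>C real"
  assumes "l \<noteq> 0" "solves (\<lambda>x. l * e x) e" "\<And>x. e x = e (clamp (-1) 1 x)"
  shows "K e = (1 / l) *\<^sub>R e"
proof (rule solution_operator_eqI)
  show "solves (apply_bcontfun e) (\<lambda>x. e x + (1 / l - 1) * e x)"
  proof (rule solves_cong)
    have z: "solves (\<lambda>x. 0) (\<lambda>x. 0 :: real)"
      unfolding solves_def bvp_def beam_sys_def has_deriv_on_def by (intro exI[of _ "\<lambda>x. 0"]) simp
    show "solves (\<lambda>x. 0 + (1 / l) * (l * e x)) (\<lambda>x. 0 + (1 / l) * e x)"
      by (rule solves_lincomb[OF z assms(2)])
  qed (use assms(1) in \<open>auto simp: algebra_simps\<close>)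
  show "((1 / l) *\<^sub>R e) x = ((1 / l) *\<^sub>R e) (clamp (-1) 1 x)" for x
    using assms(3)[of x] by (simp add: scaleR_bcontfun.rep_eq)
qed (simp add: scaleR_bcontfun.rep_eq algebra_simps)

lemma eigenvalue_unit:
  assumes "eigenvalue l"
  obtains e :: "real \<Rightarrow>\<^sub>C real" where "solves (\<lambda>x. l * e x) e" "B e e = 1" "K e = (1 / l) *\<^sub>R e"
proof -
  obtain u x where u: "solves (\<lambda>x. l * u x) u" and x: "x \<in> {-1..1}" "u x \<noteq> (0::real)"
    using assms by (auto simp: eigenvalue_def)
  have l: "0 < l" by (rule eigenvalue_pos[OF u x])
  have c: "continuous_on {-1..1} u" by (rule solves_continuous[OF u])
  define n where "n = 1 / sqrt (mass_inner u u)"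
  have nn: "n * n * mass_inner u u = 1" using mass_inner_pos[OF c x] by (simp add: n_def)
  define w where "w = (\<lambda>x. n * u x)"
  have z: "solves (\<lambda>x. 0) (\<lambda>x. 0 :: real)"
    unfolding solves_def bvp_def beam_sys_def has_deriv_on_def by (intro exI[of _ "\<lambda>x. 0"]) simp
  have sw: "solves (\<lambda>x. l * w x) w"
    using solves_lincomb[OF z u, of n] by (simp add: w_def mult_ac)
  have cw: "continuous_on {-1..1} w" by (rule solves_continuous[OF sw])
  have ww: "mass_inner w w = 1"
  proof -
    have "mass_inner w w = n * mass_inner u w" unfolding w_def by (rule mass_inner_scale) (intro continuous_intros c)+
    also have "mass_inner u w = n * mass_inner u u"
      unfolding w_def by (subst mass_inner_commute) (rule mass_inner_scale[OF c c])
    finally show ?thesis using nn by simp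
  qed
  obtain e :: "real \<Rightarrow>\<^sub>C real" where e: "\<forall>x\<in>{-1..1}. e x = w x" "\<forall>x. e x = e (clamp (-1) 1 x)"
    using bcontfun_ext[OF cw] by blast
  have se: "solves (\<lambda>x. l * e x) e" by (rule solves_cong[OF sw]) (use e(1) in auto)
  have "B e e = mass_inner w w"
    unfolding mass_inner_def using e(1) by (auto intro!: arg_cong2[where f = "(+)"] integral_cong)
  then have "B e e = 1" using ww by simp
  moreover have "K e = (1 / l) *\<^sub>R e" by (rule eigenvalue_K[OF _ se]) (use l e(2) in auto)
  ultimately show thesis using that[OF se] by blast
qed

lemma eigenvectors_orthogonal:
  assumes "K e = a *\<^sub>R e" "K f = b *\<^sub>R f" "a \<noteq> b"
  shows "B e f = 0"
proof -
  have "B (K e) f = B e (K f)" by (rule S.K_sym)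
  then have "a * B e f = b * B e f" by (simp only: assms(1,2) inner_bcontfun_scaleR S.B_scale_right)
  then show ?thesis using assms(3) by simp
qed

lemma finite_eigenvalues_below: "finite {l. eigenvalue l \<and> l \<le> \<Lambda>}"
proof (rule ccontr)
  assume "infinite {l. eigenvalue l \<and> l \<le> \<Lambda>}"
  then obtain l :: "nat \<Rightarrow> real" where l: "inj l" "range l \<subseteq> {l. eigenvalue l \<and> l \<le> \<Lambda>}"
    using infinite_countable_subset by blast
  then have le: "eigenvalue (l i)" "l i \<le> \<Lambda>" for i by auto
  have pos: "0 < l i" for i using le(1)[of i] eigenvalue_pos by (auto simp: eigenvalue_def)
  have "\<exists>e :: real \<Rightarrow>\<^sub>C real. B e e = 1 \<and> K e = (1 / l i) *\<^sub>R e" for i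
    by (rule eigenvalue_unit[OF le(1)[of i]]) blast
  then obtain e :: "nat \<Rightarrow> real \<Rightarrow>\<^sub>C real" where e: "\<And>i. B (e i) (e i) = 1" "\<And>i. K (e i) = (1 / l i) *\<^sub>R e i"
    by metis
  show False
  proof (rule S.eigenvalues_accumulate_only_at_0[of e "\<lambda>i. 1 / l i" "1 / \<Lambda>"])
    show "B (e i) (e j) = 0" if "i \<noteq> j" for i j
    proof (rule eigenvectors_orthogonal[OF e(2) e(2)])
      have "l i \<noteq> l j" using l(1) that by (auto dest: injD)
      then show "1 / l i \<noteq> 1 / l j" by simp
    qed
    show "0 < 1 / \<Lambda>" using pos[of 0] le(2)[of 0] by simp
    show "1 / \<Lambda> \<le> 1 / l i" for i using pos[of i] le(2)[of i] by (simp add: frac_le)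
  qed (use e in auto)
qed

lemma bvp_zero_slope_imp_zero_rhs:
  fixes f u :: "real \<Rightarrow> real"
  assumes u: "bvp f u \<theta> m T1 T2" and z: "\<And>x. x \<in> {-1..1} \<Longrightarrow> \<theta> x = 0" and x: "x \<in> {-1..0}"
  shows "f x = 0"
proof -
  have sys: "has_deriv_on (-1) 0 \<theta> (\<lambda>x. s1 x * m x)" "has_deriv_on (-1) 0 m (\<lambda>x. T1 x + q1 x * \<theta> x)"
    "has_deriv_on (-1) 0 T1 (\<lambda>x. r1 x * f x)"
    using u by (auto simp: bvp_def beam_sys_def)
  have "s1 x * m x = 0" if "x \<in> {-1..0}" for x
    by (rule has_deriv_on_zero[OF _ sys(1) _ that]) (use z in auto)
  then have "m x = 0" if "x \<in> {-1..0}" for x using s(1)[OF that] that by force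
  then have "T1 x + q1 x * \<theta> x = 0" if "x \<in> {-1..0}" for x
    by (intro has_deriv_on_zero[OF _ sys(2) _ that]) auto
  then have "T1 x = 0" if "x \<in> {-1..0}" for x using that z[of x] by force
  then have "r1 x * f x = 0"
    by (intro has_deriv_on_zero[OF _ sys(3) _ x]) auto
  then show ?thesis using r(1)[OF x] by simp
qed

text \<open>
  Suppose there are finitely many eigenvalues, with normalized eigenfunctions \<open>e l\<close>, and let \<open>g\<close> be the
  component of \<open>\<bar>x + 1/2\<bar>\<close> orthogonal to all of them. If \<open>B (K g) g > 0\<close>, the orthogonal complement \<open>W\<close>
  contains an eigenvector; it is proportional to some \<open>e l\<close> by simplicity and orthogonal to it, which is
  absurd. Otherwise \<open>K g\<close> has energy \<open>0\<close>, hence \<open>g = 0\<close> on \<open>[-1, 0]\<close>, and \<open>\<bar>x + 1/2\<bar>\<close> would be a combination of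
  differentiable functions there.
\<close>

lemma infinite_eigenvalues: "infinite {l. eigenvalue l}"
proof
  assume fin: "finite {l. eigenvalue l}"
  let ?E = "{l. eigenvalue l}"
  have "\<exists>e :: real \<Rightarrow>\<^sub>C real. solves (\<lambda>x. l * apply_bcontfun e x) (apply_bcontfun e) \<and> B e e = 1 \<and> K e = (1 / l) *\<^sub>R e" if "l \<in> ?E" for l
    using eigenvalue_unit[of l] that by (metis mem_Collect_eq)
  then obtain e :: "real \<Rightarrow> real \<Rightarrow>\<^sub>C real" where e: "\<And>l. l \<in> ?E \<Longrightarrow> solves (\<lambda>x. l * e l x) (e l)"
    "\<And>l. l \<in> ?E \<Longrightarrow> B (e l) (e l) = 1" "\<And>l. l \<in> ?E \<Longrightarrow> K (e l) = (1 / l) *\<^sub>R e l"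
    by metis
  have orth: "B (e l) (e k) = 0" if "l \<in> ?E" "k \<in> ?E" "l \<noteq> k" for l k
    by (rule eigenvectors_orthogonal[OF e(3)[OF that(1)] e(3)[OF that(2)]]) (use that(3) in simp)
  define W where "W = {f. \<forall>l\<in>?E. B f (e l) = 0}"
  have "continuous_on {-1..1} (\<lambda>x::real. \<bar>x + 1/2\<bar>)" by (intro continuous_intros)
  then obtain f0 :: "real \<Rightarrow>\<^sub>C real" where f0: "\<forall>x\<in>{-1..1}. f0 x = \<bar>x + 1/2\<bar>"
    using bcontfun_ext by blast
  define p where "p = (\<Sum>l\<in>?E. B f0 (e l) *\<^sub>R e l)"
  define g where "g = f0 - p"
  have gW: "g \<in> W"
    unfolding W_def
  proof (intro CollectI ballI)
    fix k assume k: "k \<in> ?E"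
    have "B p (e k) = (\<Sum>l\<in>?E. B f0 (e l) * B (e l) (e k))" by (simp only: p_def S.B_sum inner_bcontfun_scaleR)
    also have "\<dots> = (\<Sum>l\<in>?E. if l = k then B f0 (e k) else 0)"
      by (rule sum.cong) (use orth e(2) k in auto)
    also have "\<dots> = B f0 (e k)" using fin k by simp
    finally have "B p (e k) = B f0 (e k)" .
    moreover have "B g (e k) = B f0 (e k) - B p (e k)" by (simp only: g_def S.B_diff)
    ultimately show "B g (e k) = 0" by simp
  qed
  show False
  proof (cases "B (K g) g > 0")
    case True
    obtain h \<mu> where h: "h \<in> W" "\<mu> > 0" "K h = \<mu> *\<^sub>R h" "B h h > 0"
    proof (rule S.eigenvector_exists[of W g])
      show "c *\<^sub>R f \<in> W" if "f \<in> W" for c f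
        unfolding W_def
      proof (intro CollectI ballI)
        fix l assume "l \<in> ?E"
        then have "B f (e l) = 0" using that unfolding W_def by blast
        then show "B (c *\<^sub>R f) (e l) = 0" by (simp only: inner_bcontfun_scaleR mult_zero_right)
      qed
      show "K f \<in> W" if "f \<in> W" for f
        unfolding W_def
      proof (intro CollectI ballI)
        fix l assume l: "l \<in> ?E"
        then have "B f (e l) = 0" using that unfolding W_def by blast
        then show "B (K f) (e l) = 0" by (simp only: S.K_sym e(3)[OF l] S.B_scale_right mult_zero_right)
      qed
      show "h \<in> W" if "\<And>n. f n \<in> W" "f \<longlonglongrightarrow> h" for f h
        unfolding W_def
      proof (intro CollectI ballI)
        fix l assume "l \<in> ?E"
        then have "(\<lambda>n. B (f n) (e l)) = (\<lambda>n. 0)" using that(1) by (simp add: W_def)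
        then show "B h (e l) = 0" using S.tendsto_B[OF that(2), of "e l"] by (simp add: LIMSEQ_const_iff)
      qed
    qed (use gW True in auto)
    have sh: "solves (\<lambda>x. (1 / \<mu>) * (\<mu> *\<^sub>R h) x) (\<mu> *\<^sub>R h)"
      using solution_operator_solves(1)[of h] h(2) unfolding h(3) by (simp add: scaleR_bcontfun.rep_eq)
    have "\<exists>x\<in>{-1..1}. (\<mu> *\<^sub>R h) x \<noteq> 0"
    proof (rule ccontr)
      assume "\<not> ?thesis"
      then have "h x = 0" if "x \<in> {-1..1}" for x using h(2) that by (auto simp: scaleR_bcontfun.rep_eq)
      then have "B h h \<le> total_mass * 0\<^sup>2" by (intro mass_inner_le[OF bcontfun_continuous_on]) auto
      then show False using h(4) by simp
    qed
    then obtain x0 where x0: "x0 \<in> {-1..1}" "(\<mu> *\<^sub>R h) x0 \<noteq> 0" by blast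
    define l where "l = 1 / \<mu>"
    have l: "l \<in> ?E" using sh x0 unfolding eigenvalue_def l_def by blast
    obtain \<theta> m T1 T2 where b1: "bvp (\<lambda>x. l * (\<mu> *\<^sub>R h) x) (\<mu> *\<^sub>R h) \<theta> m T1 T2"
      using sh by (auto simp: solves_def l_def)
    obtain \<phi> n R1 R2 where b2: "bvp (\<lambda>x. l * e l x) (e l) \<phi> n R1 R2"
      using e(1)[OF l] by (auto simp: solves_def)
    obtain c where c: "\<And>x. x \<in> {-1..1} \<Longrightarrow> e l x = c * (\<mu> *\<^sub>R h) x"
      by (rule bvp_simple[OF b1 b2 _ x0]) (use h(2) in \<open>auto simp: l_def\<close>)
    have "B (e l) (e l) = mass_inner (\<lambda>x. (c * \<mu>) * h x) (e l)"
      unfolding mass_inner_def using c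
      by (auto intro!: arg_cong2[where f = "(+)"] integral_cong simp: scaleR_bcontfun.rep_eq)
    also have "\<dots> = (c * \<mu>) * B h (e l)" by (rule mass_inner_scale) (rule bcontfun_continuous_on)+
    also have "\<dots> = 0" using h(1) l by (simp add: W_def)
    finally show False using e(2)[OF l] by simp
  next
    case False
    then have Kg: "B (K g) g = 0" using S.K_nonneg[of g] by simp
    obtain \<theta> m T1 T2 where b: "bvp g (K g) \<theta> m T1 T2" using solution_operator_solves(1)[of g] by (auto simp: solves_def)
    have "energy \<theta> m \<theta> m = 0"
      using bvp_green[OF b b bcontfun_continuous_on] Kg mass_inner_commute by simp
    then have "\<theta> x = 0" if "x \<in> {-1..1}" for x using bvp_bounds(1)[OF b that] by simp
    then have "g x = 0" if "x \<in> {-1..0}" for x using bvp_zero_slope_imp_zero_rhs[OF b _ that] by blast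
    then have fp: "f0 x = p x" if "x \<in> {-1..0}" for x
      using that by (simp add: g_def minus_bcontfun.rep_eq)
    have "\<exists>u'. has_deriv_on (-1) 0 (\<lambda>x. \<Sum>l\<in>F. B f0 (e l) * e l x) u'" if "finite F" "F \<subseteq> ?E" for F
      using that
    proof (induction F)
      case empty
      then show ?case by (intro exI[of _ "\<lambda>x. 0"]) (simp add: has_deriv_on_def)
    next
      case (insert l F)
      obtain u' where u': "has_deriv_on (-1) 0 (\<lambda>x. \<Sum>l\<in>F. B f0 (e l) * e l x) u'" using insert by auto
      obtain \<theta> m T1 T2 where "bvp (\<lambda>x. l * e l x) (e l) \<theta> m T1 T2"
        using e(1)[of l] insert by (auto simp: solves_def)
      then have "has_deriv_on (-1) 0 (e l) \<theta>" by (auto simp: bvp_def beam_sys_def)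
      from has_deriv_on_lincomb[OF u' this, of "B f0 (e l)"] show ?case
        using insert by (intro exI[of _ "\<lambda>x. u' x + B f0 (e l) *\<^sub>R \<theta> x"]) (simp add: add.commute)
    qed
    then obtain u' where u': "has_deriv_on (-1) 0 (\<lambda>x. \<Sum>l\<in>?E. B f0 (e l) * e l x) u'" using fin by blast
    have "apply_bcontfun p = (\<lambda>x. \<Sum>l\<in>?E. B f0 (e l) * e l x)"
      unfolding p_def by (induction rule: finite_induct[OF fin])
        (auto simp: fun_eq_iff plus_bcontfun.rep_eq scaleR_bcontfun.rep_eq zero_bcontfun.rep_eq)
    then have "has_deriv_on (-1) 0 p u'" using u' by simp
    then have "has_deriv_on (-1) 0 (\<lambda>x. \<bar>x + 1/2\<bar>) u'"
      by (rule has_deriv_on_cong) (use fp f0 in auto)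
    then have "((\<lambda>x. \<bar>x + 1/2\<bar>) has_vector_derivative u' (-1/2)) (at (-1/2) within {-1..0})"
      by (simp add: has_deriv_on_def)
    then have d: "((\<lambda>x::real. \<bar>x + 1/2\<bar>) has_real_derivative u' (-1/2)) (at (-1/2))"
      by (simp add: has_real_derivative_iff_has_vector_derivative at_within_Icc_at)
    then have L: "((\<lambda>h::real. \<bar>h\<bar> / h) \<longlongrightarrow> u' (-1/2)) (at 0)" by (simp add: DERIV_def)
    have "((\<lambda>h::real. \<bar>h\<bar> / h) \<longlongrightarrow> 1) (at_right 0)"
      by (rule tendsto_eventually) (auto simp: eventually_at_filter)
    then have "u' (-1/2) = 1"
      using L tendsto_unique[OF trivial_limit_at_right_real] by (auto simp: filterlim_at_split)
    moreover have "((\<lambda>h::real. \<bar>h\<bar> / h) \<longlongrightarrow> -1) (at_left 0)"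
      by (rule tendsto_eventually) (auto simp: eventually_at_filter)
    then have "u' (-1/2) = -1"
      using L tendsto_unique[OF trivial_limit_at_left_real] by (auto simp: filterlim_at_split)
    ultimately show False by simp
  qed
qed

end

section \<open>Enumeration of a discrete set of reals\<close>

text \<open>
  The number of smaller elements is a strictly increasing bijection from \<open>E\<close> onto the natural numbers;
  \<open>ev\<close> is its inverse.
\<close>

lemma enumerate_locally_finite:
  fixes E :: "real set"
  assumes inf: "infinite E" and fin: "\<And>x. finite {l \<in> E. l \<le> x}"
  obtains ev :: "nat \<Rightarrow> real" where "strict_mono ev" "range ev = E" "filterlim ev at_top sequentially"
proof -
  define rank where "rank l = card {k \<in> E. k < l}" for l
  have finl: "finite {k \<in> E. k < l}" for l by (rule finite_subset[OF _ fin[of l]]) auto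
  have mono: "rank l < rank l'" if "l \<in> E" "l < l'" for l l'
    unfolding rank_def by (rule psubset_card_mono[OF finl]) (use that in auto)
  have inj: "inj_on rank E"
    by (rule linorder_inj_onI') (use mono in \<open>metis less_irrefl\<close>)
  have surj: "\<exists>l\<in>E. rank l = n" for n
  proof -
    have "infinite (rank ` E)" using inf inj finite_imageD by blast
    then obtain l0 where l0: "l0 \<in> E" "n \<le> rank l0"
      unfolding infinite_nat_iff_unbounded_le by blast
    \<comment> \<open>The least element of rank at least \<open>n\<close> has rank exactly \<open>n\<close>: all smaller ones have distinct ranks below \<open>n\<close>.\<close>
    define A where "A = {k \<in> E. k \<le> l0 \<and> n \<le> rank k}"
    have A: "finite A" "A \<noteq> {}"
      using l0 by (auto simp: A_def intro: finite_subset[OF _ fin[of l0]])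
    define l where "l = Min A"
    have lA: "l \<in> A" unfolding l_def using A by (rule Min_in)
    have "rank ` {k \<in> E. k < l} \<subseteq> {..<n}"
    proof (rule image_subsetI)
      fix k assume k: "k \<in> {k \<in> E. k < l}"
      then have "k \<notin> A" using Min_le[OF A(1), of k] by (auto simp: l_def)
      then show "rank k \<in> {..<n}" using k lA by (auto simp: A_def)
    qed
    then have "card (rank ` {k \<in> E. k < l}) \<le> n" using card_mono[of "{..<n}"] by fastforce
    moreover have "card (rank ` {k \<in> E. k < l}) = rank l"
      unfolding rank_def[of l] by (rule card_image) (rule inj_on_subset[OF inj], auto)
    ultimately have "rank l = n" using lA by (auto simp: A_def)
    then show ?thesis using lA by (auto simp: A_def)
  qed
  then obtain ev where ev: "\<And>n. ev n \<in> E" "\<And>n. rank (ev n) = n" by metis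
  have sm: "strict_mono ev"
  proof (rule strict_monoI)
    fix m n :: nat assume "m < n"
    then show "ev m < ev n"
      using mono[OF ev(1)[of n], of "ev m"] ev(2)[of m] ev(2)[of n] by (cases "ev m" "ev n" rule: linorder_cases) auto
  qed
  have "E \<subseteq> range ev"
  proof
    fix l assume "l \<in> E"
    then have "l = ev (rank l)" using inj ev by (metis inj_onD)
    then show "l \<in> range ev" by blast
  qed
  then have rng: "range ev = E" using ev(1) by blast
  have "filterlim ev at_top sequentially"
    unfolding filterlim_at_top
  proof
    fix Z
    have "finite (ev -` {l \<in> E. l \<le> Z})"
      by (rule finite_vimageI[OF fin strict_mono_imp_inj_on[OF sm]])
    then have "finite {n. \<not> Z \<le> ev n}" by (rule rev_finite_subset) (use ev(1) in auto)
    then show "\<forall>\<^sub>F n in sequentially. Z \<le> ev n"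
      by (simp add: eventually_cofinite flip: cofinite_eq_sequentially)
  qed
  with sm rng show thesis by (rule that)
qed

context beam_coeff
begin

text \<open>
  The term \<open>G\<close> is a continuous load in addition to \<open>l f\<close>; it occurs in Jordan chains.
\<close>

lemma weak_solution_classical:
  fixes f G :: "real \<Rightarrow> 'a::{real_normed_field, euclidean_space}"
  assumes f: "sobolev 4 a b f" and r: "continuous_on {a..b} r" and G: "continuous_on {a..b} G"
    and eq: "ae_eq_on a b (beam_op a b \<sigma> q f) (\<lambda>x. r x *\<^sub>R (l * f x + G x))"
  obtains U \<Theta> m T where "beam_sys a b (\<lambda>x. 1 / S x) Q U \<Theta> m T (\<lambda>x. r x *\<^sub>R (l * U x + G x))" "ae_eq_on a b f U"
    "\<And>x. x \<in> {a..b} \<Longrightarrow> trace_at a b f x = U x" "\<And>x. x \<in> {a..b} \<Longrightarrow> trace_at a b (wderiv 1 a b f) x = \<Theta> x"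
    "\<And>x. x \<in> {a..b} \<Longrightarrow> trace_at a b (wderiv 2 a b f) x = (1 / S x) *\<^sub>R m x"
    "\<And>x. x \<in> {a..b} \<Longrightarrow> trace_at a b (T_op a b \<sigma> q f) x = T x"
proof -
  obtain U \<Theta> m T g where rep: "ae_eq_on a b f U" "has_deriv_on a b U \<Theta>" "has_deriv_on a b \<Theta> (\<lambda>x. (1 / S x) *\<^sub>R m x)"
    "has_deriv_on a b m (\<lambda>x. T x + Q x *\<^sub>R \<Theta> x)" "ac_on a b T g"
    using sobolev_4_classical[OF f] .
  have "ae_eq_on a b g (beam_op a b \<sigma> q f)" by (rule ae_eq_on_sym[OF beam_op_eq(4)[OF rep]])
  also note eq
  also have "ae_eq_on a b (\<lambda>x. r x *\<^sub>R (l * f x + G x)) (\<lambda>x. r x *\<^sub>R (l * U x + G x))"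
    using ae_eq_on_map[OF rep(1), of "\<lambda>x y. r x *\<^sub>R (l * y + G x)"] .
  finally have "ac_on a b T (\<lambda>x. r x *\<^sub>R (l * U x + G x))" by (intro ac_on_cong[OF rep(5)]) auto
  then have "has_deriv_on a b T (\<lambda>x. r x *\<^sub>R (l * U x + G x))"
    by (rule ac_on_deriv) (intro continuous_intros r G has_deriv_on_continuous[OF rep(2)])
  then show thesis using that[OF _ rep(1) traces_eq[OF rep]] rep by (simp add: beam_sys_def)
qed

lemma classical_solution_weak:
  fixes U :: "real \<Rightarrow> 'a::{real_normed_field, euclidean_space}"
  assumes sys: "beam_sys a b (\<lambda>x. 1 / S x) Q U \<Theta> m T (\<lambda>x. r x *\<^sub>R (l * U x))" and r: "continuous_on {a..b} r"
  shows "sobolev 4 a b U" "ae_eq_on a b (beam_op a b \<sigma> q U) (\<lambda>x. l * (r x *\<^sub>R U x))"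
    "x \<in> {a..b} \<Longrightarrow> trace_at a b U x = U x" "x \<in> {a..b} \<Longrightarrow> trace_at a b (wderiv 1 a b U) x = \<Theta> x"
    "x \<in> {a..b} \<Longrightarrow> trace_at a b (wderiv 2 a b U) x = (1 / S x) *\<^sub>R m x"
    "x \<in> {a..b} \<Longrightarrow> trace_at a b (T_op a b \<sigma> q U) x = T x"
proof -
  have d: "has_deriv_on a b U \<Theta>" "has_deriv_on a b \<Theta> (\<lambda>x. (1 / S x) *\<^sub>R m x)"
    "has_deriv_on a b m (\<lambda>x. T x + Q x *\<^sub>R \<Theta> x)" "has_deriv_on a b T (\<lambda>x. r x *\<^sub>R (l * U x))"
    using sys by (auto simp: beam_sys_def)
  have g: "continuous_on {a..b} (\<lambda>x. r x *\<^sub>R (l * U x))"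
    by (intro continuous_intros r has_deriv_on_continuous[OF d(1)])
  note rep = ae_eq_on_refl d(1-3) ac_on_C1[OF d(4) g]
  show "sobolev 4 a b U" by (rule classical_sobolev_4[OF d g])
  show "ae_eq_on a b (beam_op a b \<sigma> q U) (\<lambda>x. l * (r x *\<^sub>R U x))"
    using beam_op_eq(4)[OF rep] by simp
  show "x \<in> {a..b} \<Longrightarrow> trace_at a b U x = U x" "x \<in> {a..b} \<Longrightarrow> trace_at a b (wderiv 1 a b U) x = \<Theta> x"
    "x \<in> {a..b} \<Longrightarrow> trace_at a b (wderiv 2 a b U) x = (1 / S x) *\<^sub>R m x"
    "x \<in> {a..b} \<Longrightarrow> trace_at a b (T_op a b \<sigma> q U) x = T x"
    by (rule traces_eq[OF rep]; assumption)+
qed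

end

section \<open>Equivalence of the weak and the classical spectral problem\<close>

locale beam_problem =
  L: beam_coeff "-1" 0 \<sigma>1 q1 S1 S1' s1' Q1 q1' + R: beam_coeff 0 1 \<sigma>2 q2 S2 S2' s2' Q2 q2' +
  two_beams M "\<lambda>x. 1 / S1 x" "\<lambda>x. 1 / S2 x" Q1 Q2 \<rho>1 \<rho>2
  for M :: real and \<sigma>1 q1 S1 S1' s1' Q1 q1' \<sigma>2 q2 S2 S2' s2' Q2 q2' \<rho>1 \<rho>2 :: "real \<Rightarrow> real"
begin

abbreviation "eigenpair' \<equiv> eigenpair M \<rho>1 \<rho>2 \<sigma>1 \<sigma>2 q1 q2"
abbreviation "A_ker \<equiv> A_ker_pow M \<rho>1 \<rho>2 \<sigma>1 \<sigma>2 q1 q2"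

text \<open>
  On each interval the weak solution has a classical representative. Since \<open>m = \<sigma> u''\<close>, the boundary and
  transmission conditions for traces say exactly that \<open>u\<close>, \<open>\<theta>\<close>, \<open>m\<close> can be glued at \<open>0\<close>.
\<close>

lemma weak_to_bvp:
  fixes u v G :: "real \<Rightarrow> 'a::{real_normed_field, euclidean_space}"
  assumes u: "sobolev 4 (-1) 0 u" and v: "sobolev 4 0 1 v" and bc: "boundary_conditions \<sigma>1 \<sigma>2 u v"
    and G: "continuous_on {-1..1} G"
    and e1: "ae_eq_on (-1) 0 (beam_op (-1) 0 \<sigma>1 q1 u) (\<lambda>x. \<rho>1 x *\<^sub>R (l * u x + G x))"
    and e2: "ae_eq_on 0 1 (beam_op 0 1 \<sigma>2 q2 v) (\<lambda>x. \<rho>2 x *\<^sub>R (l * v x + G x))"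
    and jump: "trace_at (-1) 0 (T_op (-1) 0 \<sigma>1 q1 u) 0 - trace_at 0 1 (T_op 0 1 \<sigma>2 q2 v) 0 =
      - (M *\<^sub>R (l * trace_at (-1) 0 u 0 + G 0))"
  obtains U \<Theta> m T1 T2 where "bvp (\<lambda>x. l * U x + G x) U \<Theta> m T1 T2"
    "ae_eq_on (-1) 0 u U" "ae_eq_on 0 1 v U" "trace_at (-1) 0 u 0 = U 0"
    "trace_at (-1) 0 (wderiv 1 (-1) 0 u) (-1) = \<Theta> (-1)" "trace_at 0 1 (wderiv 1 0 1 v) 1 = \<Theta> 1"
    "trace_at (-1) 0 (T_op (-1) 0 \<sigma>1 q1 u) (-1) = T1 (-1)" "trace_at 0 1 (T_op 0 1 \<sigma>2 q2 v) 1 = T2 1"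
proof -
  have Gc: "continuous_on {-1..0} G" "continuous_on {0..1} G" using G by (auto simp: continuous_on_glue)
  obtain U1 \<Theta>1 m1 T1 where s1: "beam_sys (-1) 0 (\<lambda>x. 1 / S1 x) Q1 U1 \<Theta>1 m1 T1 (\<lambda>x. \<rho>1 x *\<^sub>R (l * U1 x + G x))"
    and 1: "ae_eq_on (-1) 0 u U1"
    and t1: "\<And>x. x \<in> {-1..0} \<Longrightarrow> trace_at (-1) 0 u x = U1 x"
      "\<And>x. x \<in> {-1..0} \<Longrightarrow> trace_at (-1) 0 (wderiv 1 (-1) 0 u) x = \<Theta>1 x"
      "\<And>x. x \<in> {-1..0} \<Longrightarrow> trace_at (-1) 0 (wderiv 2 (-1) 0 u) x = (1 / S1 x) *\<^sub>R m1 x"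
      "\<And>x. x \<in> {-1..0} \<Longrightarrow> trace_at (-1) 0 (T_op (-1) 0 \<sigma>1 q1 u) x = T1 x"
    using L.weak_solution_classical[OF u cr(1) Gc(1) e1] by blast
  obtain U2 \<Theta>2 m2 T2 where s2: "beam_sys 0 1 (\<lambda>x. 1 / S2 x) Q2 U2 \<Theta>2 m2 T2 (\<lambda>x. \<rho>2 x *\<^sub>R (l * U2 x + G x))"
    and 2: "ae_eq_on 0 1 v U2"
    and t2: "\<And>x. x \<in> {0..1} \<Longrightarrow> trace_at 0 1 v x = U2 x"
      "\<And>x. x \<in> {0..1} \<Longrightarrow> trace_at 0 1 (wderiv 1 0 1 v) x = \<Theta>2 x"
      "\<And>x. x \<in> {0..1} \<Longrightarrow> trace_at 0 1 (wderiv 2 0 1 v) x = (1 / S2 x) *\<^sub>R m2 x"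
      "\<And>x. x \<in> {0..1} \<Longrightarrow> trace_at 0 1 (T_op 0 1 \<sigma>2 q2 v) x = T2 x"
    using R.weak_solution_classical[OF v cr(2) Gc(2) e2] by blast
  note tr = t1 t2 L.trace_\<sigma> R.trace_\<sigma>
  have nz: "S1 (-1) \<noteq> 0" "S1 0 \<noteq> 0" "S2 0 \<noteq> 0" "S2 1 \<noteq> 0"
    using L.pos[of "-1"] L.pos[of 0] R.pos[of 0] R.pos[of 1] by auto
  have bc': "U1 (-1) = 0" "m1 (-1) = 0" "U2 1 = 0" "m2 1 = 0" "U1 0 = U2 0" "\<Theta>1 0 = \<Theta>2 0" "m1 0 = m2 0"
    using bc nz unfolding boundary_conditions_def by (auto simp: tr simp del: One_nat_def)
  define U where "U x = (if x \<le> 0 then U1 x else U2 x)" for x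
  define \<Theta> where "\<Theta> x = (if x \<le> 0 then \<Theta>1 x else \<Theta>2 x)" for x
  define m where "m x = (if x \<le> 0 then m1 x else m2 x)" for x
  have "beam_sys (-1) 0 (\<lambda>x. 1 / S1 x) Q1 U \<Theta> m T1 (\<lambda>x. \<rho>1 x *\<^sub>R (l * U x + G x))"
    by (rule beam_sys_cong[OF s1]) (auto simp: U_def \<Theta>_def m_def)
  moreover have "beam_sys 0 1 (\<lambda>x. 1 / S2 x) Q2 U \<Theta> m T2 (\<lambda>x. \<rho>2 x *\<^sub>R (l * U x + G x))"
    by (rule beam_sys_cong[OF s2]) (use bc' in \<open>auto simp: U_def \<Theta>_def m_def antisym_conv\<close>)
  moreover have "T1 0 - T2 0 = - (M *\<^sub>R (l * U 0 + G 0))" using jump by (simp add: tr U_def)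
  ultimately have "bvp (\<lambda>x. l * U x + G x) U \<Theta> m T1 T2"
    using bc' by (simp add: bvp_def U_def m_def)
  moreover have "ae_eq_on (-1) 0 u U"
    by (rule ae_eq_on_trans[OF 1], rule ae_eq_onI) (simp add: U_def)
  moreover have "ae_eq_on 0 1 v U"
    by (rule ae_eq_on_trans[OF 2], rule ae_eq_onI) (simp add: U_def)
  ultimately show thesis
    by (rule that) (simp_all add: tr U_def \<Theta>_def del: One_nat_def)
qed

lemma bvp_to_eigenpair:
  fixes U :: "real \<Rightarrow> 'a::{real_normed_field, euclidean_space}"
  assumes b: "bvp (\<lambda>x. l * U x) U \<Theta> m T1 T2" and nz: "y \<in> {-1..1}" "U y \<noteq> 0"
  shows "eigenpair' l U U"
proof -
  have lt: "(-1::real) < 0" "(0::real) < 1" by auto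
  have sys1: "beam_sys (-1) 0 (\<lambda>x. 1 / S1 x) Q1 U \<Theta> m T1 (\<lambda>x. \<rho>1 x *\<^sub>R (l * U x))"
    and sys2: "beam_sys 0 1 (\<lambda>x. 1 / S2 x) Q2 U \<Theta> m T2 (\<lambda>x. \<rho>2 x *\<^sub>R (l * U x))"
    and bc: "U (-1) = 0" "m (-1) = 0" "U 1 = 0" "m 1 = 0" "T1 0 - T2 0 = - (M *\<^sub>R (l * U 0))"
    using b by (auto simp: bvp_def)
  note w1 = L.classical_solution_weak[OF sys1 cr(1)] and w2 = R.classical_solution_weak[OF sys2 cr(2)]
  note tr = w1(3-6) w2(3-6) L.trace_\<sigma> R.trace_\<sigma>
  have "S1 0 \<noteq> 0" "S2 0 \<noteq> 0" using L.pos[of 0] R.pos[of 0] by auto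
  then have "boundary_conditions \<sigma>1 \<sigma>2 U U"
    unfolding boundary_conditions_def using bc by (simp add: tr del: One_nat_def)
  moreover have "\<not> (ae_eq_on (-1) 0 U (\<lambda>x. 0) \<and> ae_eq_on 0 1 U (\<lambda>x. 0))"
    using ae_eq_on_continuous_imp_eq[OF lt(1) beam_sys_continuous(1)[OF sys1] continuous_on_const, of 0 y]
      ae_eq_on_continuous_imp_eq[OF lt(2) beam_sys_continuous(1)[OF sys2] continuous_on_const, of 0 y] nz
    by (cases "y \<le> 0") auto
  ultimately show ?thesis
    unfolding eigenpair_def using w1(1,2) w2(1,2) bc(5) by (simp add: tr)
qed

lemma eigenpair_to_bvp:
  fixes u v :: "real \<Rightarrow> 'a::{real_normed_field, euclidean_space}"
  assumes e: "eigenpair' l u v"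
  obtains U \<Theta> m T1 T2 x where "bvp (\<lambda>x. l * U x) U \<Theta> m T1 T2" "x \<in> {-1..1}" "U x \<noteq> 0"
    "trace_at (-1) 0 (wderiv 1 (-1) 0 u) (-1) = \<Theta> (-1)" "trace_at 0 1 (wderiv 1 0 1 v) 1 = \<Theta> 1"
    "trace_at (-1) 0 (T_op (-1) 0 \<sigma>1 q1 u) (-1) = T1 (-1)" "trace_at 0 1 (T_op 0 1 \<sigma>2 q2 v) 1 = T2 1"
proof -
  obtain U \<Theta> m T1 T2 where b: "bvp (\<lambda>x. l * U x + 0) U \<Theta> m T1 T2"
    "ae_eq_on (-1) 0 u U" "ae_eq_on 0 1 v U" "trace_at (-1) 0 u 0 = U 0"
    "trace_at (-1) 0 (wderiv 1 (-1) 0 u) (-1) = \<Theta> (-1)" "trace_at 0 1 (wderiv 1 0 1 v) 1 = \<Theta> 1"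
    "trace_at (-1) 0 (T_op (-1) 0 \<sigma>1 q1 u) (-1) = T1 (-1)" "trace_at 0 1 (T_op 0 1 \<sigma>2 q2 v) 1 = T2 1"
    by (rule weak_to_bvp[of u v "\<lambda>x. 0" l]) (use e in \<open>simp_all add: eigenpair_def del: One_nat_def\<close>)
  have "\<exists>x\<in>{-1..1}. U x \<noteq> 0"
  proof (rule ccontr)
    assume "\<not> ?thesis"
    then have "ae_eq_on (-1) 0 U (\<lambda>x. 0)" "ae_eq_on 0 1 U (\<lambda>x. 0)" by (auto intro!: ae_eq_onI)
    then show False using e ae_eq_on_trans b(2,3) unfolding eigenpair_def by blast
  qed
  then show thesis using that b by auto
qed

section \<open>Reality, algebraic simplicity and the spectral theorem\<close>

lemma eigenvalueI: "solves (\<lambda>t. l * u t) u \<Longrightarrow> x \<in> {-1..1} \<Longrightarrow> u x \<noteq> 0 \<Longrightarrow> eigenvalue l"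
  unfolding eigenvalue_def by blast

text \<open>
  For \<open>U = x + i y\<close> and \<open>l = \<alpha> + i \<beta>\<close> the real functions \<open>x\<close>, \<open>y\<close> solve the problem with loads
  \<open>\<alpha> x - \<beta> y\<close> and \<open>\<alpha> y + \<beta> x\<close>. Symmetry turns this into \<open>\<beta> (\<langle>x, x\<rangle> + \<langle>y, y\<rangle>) = 0\<close>.
\<close>

lemma bvp_complex_eigenvalue_real:
  fixes U :: "real \<Rightarrow> complex"
  assumes b: "bvp (\<lambda>x. l * U x) U \<Theta> m T1 T2" and nz: "x \<in> {-1..1}" "U x \<noteq> 0"
  shows "Im l = 0" "eigenvalue (Re l)"
proof -
  let ?x = "\<lambda>t. Re (U t)" and ?y = "\<lambda>t. Im (U t)"
  have c: "continuous_on {-1..1} U" by (rule bvp_continuous(1)[OF b])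
  have cx: "continuous_on {-1..1} ?x" "continuous_on {-1..1} ?y" using c by (auto intro: continuous_intros)
  have bx: "bvp (\<lambda>t. Re l * ?x t + (- Im l) * ?y t) ?x (\<lambda>t. Re (\<Theta> t)) (\<lambda>t. Re (m t)) (\<lambda>t. Re (T1 t)) (\<lambda>t. Re (T2 t))"
    using bvp_linear[OF b bounded_linear_Re] by simp
  have by': "bvp (\<lambda>t. Re l * ?y t + Im l * ?x t) ?y (\<lambda>t. Im (\<Theta> t)) (\<lambda>t. Im (m t)) (\<lambda>t. Im (T1 t)) (\<lambda>t. Im (T2 t))"
    using bvp_linear[OF b bounded_linear_Im] by simp
  have "mass_inner (\<lambda>t. Re l * ?x t + (- Im l) * ?y t) ?y = mass_inner (\<lambda>t. Re l * ?y t + Im l * ?x t) ?x"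
    by (rule bvp_symmetric[OF bx by']) (intro continuous_intros cx)+
  moreover have "mass_inner (\<lambda>t. Re l * ?x t + (- Im l) * ?y t) ?y = Re l * mass_inner ?x ?y + (- Im l) * mass_inner ?y ?y"
    by (subst mass_inner_lincomb) (intro continuous_intros cx | simp add: mass_inner_scale cx)+
  moreover have "mass_inner (\<lambda>t. Re l * ?y t + Im l * ?x t) ?x = Re l * mass_inner ?y ?x + Im l * mass_inner ?x ?x"
    by (subst mass_inner_lincomb) (intro continuous_intros cx | simp add: mass_inner_scale cx)+
  moreover have "mass_inner ?y ?x = mass_inner ?x ?y" by (rule mass_inner_commute)
  ultimately have "Im l * (mass_inner ?x ?x + mass_inner ?y ?y) = 0" by (simp add: algebra_simps)
  moreover have "0 < mass_inner ?x ?x + mass_inner ?y ?y"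
  proof (cases "?x x = 0")
    case True
    then have "?y x \<noteq> 0" using nz(2) by (auto simp: complex_eq_iff)
    then show ?thesis using mass_inner_pos[OF cx(2) nz(1)] mass_inner_nonneg[OF cx(1)] by auto
  next
    case False
    then show ?thesis using mass_inner_pos[OF cx(1) nz(1)] mass_inner_nonneg[OF cx(2)] by auto
  qed
  ultimately show l: "Im l = 0" by auto
  have "solves (\<lambda>t. Re l * ?x t) ?x" "solves (\<lambda>t. Re l * ?y t) ?y"
    using bx by' l by (auto simp: solves_def)
  moreover have "?x x \<noteq> 0 \<or> ?y x \<noteq> 0" using nz(2) by (auto simp: complex_eq_iff)
  ultimately show "eigenvalue (Re l)"
    using nz(1) eigenvalueI[of "Re l" ?x x] eigenvalueI[of "Re l" ?y x] by blast
qed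

lemma eigenvalue_eigenpair:
  assumes "eigenvalue l"
  obtains \<phi> \<theta> m T1 T2 x where "bvp (\<lambda>x. l * \<phi> x) \<phi> \<theta> m T1 T2" "x \<in> {-1..1}" "\<phi> x \<noteq> 0"
    "eigenpair' (complex_of_real l) (\<lambda>x. complex_of_real (\<phi> x)) (\<lambda>x. complex_of_real (\<phi> x))"
proof -
  obtain \<phi> \<theta> m T1 T2 x where 1: "bvp (\<lambda>x. l * \<phi> x) \<phi> \<theta> m T1 T2" "x \<in> {-1..1}" "\<phi> x \<noteq> (0::real)"
    using assms by (auto simp: eigenvalue_def solves_def)
  have "eigenpair' (complex_of_real l) (\<lambda>x. complex_of_real (\<phi> x)) (\<lambda>x. complex_of_real (\<phi> x))"
    using bvp_linear[OF 1(1) bounded_linear_of_real] 1(2,3)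
    by (intro bvp_to_eigenpair[where y = x]) simp_all
  with 1 show thesis by (rule that)
qed

text \<open>
  By induction on \<open>k\<close> every element of \<open>ker (\<A> - l)\<^sup>k\<close> is a multiple of the eigenvector \<open>w\<close>. If \<open>\<A> - l\<close>
  maps \<open>w'\<close> to \<open>c w\<close>, then \<open>w'\<close> solves the problem with load \<open>l U + c \<phi>\<close>; pairing with \<open>\<phi>\<close> gives
  \<open>c \<langle>\<phi>, \<phi>\<rangle> = 0\<close>, so \<open>w'\<close> is itself an eigenvector, and geometric simplicity applies to its real and
  imaginary parts.
\<close>

lemma eigenvalue_algebraically_simple:
  assumes ev: "eigenvalue l"
  shows "algebraically_simple M \<rho>1 \<rho>2 \<sigma>1 \<sigma>2 q1 q2 (complex_of_real l)"
proof -
  obtain \<phi> \<theta> m T1 T2 x where b: "bvp (\<lambda>x. l * \<phi> x) \<phi> \<theta> m T1 T2" "x \<in> {-1..1}" "\<phi> x \<noteq> 0"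
    "eigenpair' (complex_of_real l) (\<lambda>x. complex_of_real (\<phi> x)) (\<lambda>x. complex_of_real (\<phi> x))"
    using eigenvalue_eigenpair[OF ev] .
  have c\<phi>: "continuous_on {-1..1} \<phi>" by (rule bvp_continuous(1)[OF b(1)])
  have "solves (\<lambda>x. l * \<phi> x) \<phi>" using b(1) unfolding solves_def by blast
  then have lpos: "0 < l" using b(2,3) by (rule eigenvalue_pos)
  have in\<phi>: "0 < mass_inner \<phi> \<phi>" by (rule mass_inner_pos[OF c\<phi> b(2,3)])
  let ?P = "\<lambda>x. complex_of_real (\<phi> x)"
  have cP: "continuous_on {-1..1} ?P" using c\<phi> by (intro continuous_intros)
  define w where "w = (?P, ?P, ?P 0)"
  have P0: "trace_at (-1) 0 ?P 0 = ?P 0"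
    using cP by (intro trace_at_eqI) (auto simp: continuous_on_glue)
  have w1: "w \<in> A_ker (complex_of_real l) 1 \<and> w \<notin> H_null"
    unfolding w_def
    by (rule iffD1[OF eigenpair_iff_eigenvector]) (use M r b(4) P0 in auto)
  have w: "w \<in> A_gen_eigenspace M \<rho>1 \<rho>2 \<sigma>1 \<sigma>2 q1 q2 (complex_of_real l)" "w \<notin> H_null"
    unfolding A_gen_eigenspace_def using w1 by (intro UN_I[of 1], blast+)
  have chain_in_span: "\<exists>c. state_minus_mult w' c w \<in> H_null"
    if "w' \<in> A_ker (complex_of_real l) k" for w' k
    using that
  proof (induction k arbitrary: w')
    case 0
    then show ?case by (intro exI[of _ 0]) (auto simp: state_minus_mult_def w_def split: prod.splits)
  next
    case (Suc k)
    obtain u v z where w': "w' = (u, v, z)" by (cases w')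
    have dom: "(u, v, z) \<in> A_dom \<sigma>1 \<sigma>2" using Suc.prems w' by simp
    obtain c where "state_minus_mult (state_minus_mult (A_op M \<rho>1 \<rho>2 \<sigma>1 \<sigma>2 q1 q2 w') (complex_of_real l) w') c w \<in> H_null"
      using Suc.IH Suc.prems unfolding A_ker_pow.simps by blast
    then have n1: "ae_eq_on (-1) 0 (\<lambda>x. (1 / \<rho>1 x) *\<^sub>R beam_op (-1) 0 \<sigma>1 q1 u x - complex_of_real l * u x - c * ?P x) (\<lambda>x. 0)"
      and n2: "ae_eq_on 0 1 (\<lambda>x. (1 / \<rho>2 x) *\<^sub>R beam_op 0 1 \<sigma>2 q2 v x - complex_of_real l * v x - c * ?P x) (\<lambda>x. 0)"
      and n3: "- ((1 / M) *\<^sub>R (trace_at (-1) 0 (T_op (-1) 0 \<sigma>1 q1 u) 0 - trace_at 0 1 (T_op 0 1 \<sigma>2 q2 v) 0))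
        - complex_of_real l * z - c * ?P 0 = 0"
      by (simp_all add: w' w_def A_op_def state_minus_mult_def H_null_def)
    have dd: "sobolev 4 (-1) 0 u" "sobolev 4 0 1 v" "boundary_conditions \<sigma>1 \<sigma>2 u v" "trace_at (-1) 0 u 0 = z"
      using dom by (auto simp: A_dom_def)
    have solve: "y = p *\<^sub>R t" if "(1 / p) *\<^sub>R y - t = 0" "p \<noteq> 0" for y t :: complex and p :: real
    proof -
      have "(1 / p) *\<^sub>R y = t" using that(1) by simp
      then show ?thesis using that(2) by (auto simp: field_simps)
    qed
    have e1: "ae_eq_on (-1) 0 (beam_op (-1) 0 \<sigma>1 q1 u) (\<lambda>x. \<rho>1 x *\<^sub>R (complex_of_real l * u x + c * ?P x))"
      using n1 AE_space[of "lebesgue_on {-1<..<0}"] unfolding ae_eq_on_def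
    proof eventually_elim
      case (elim x)
      then have "\<rho>1 x \<noteq> 0" using r(1)[of x] by simp
      then show ?case using elim(1) by (intro solve) (simp_all add: algebra_simps)
    qed
    have e2: "ae_eq_on 0 1 (beam_op 0 1 \<sigma>2 q2 v) (\<lambda>x. \<rho>2 x *\<^sub>R (complex_of_real l * v x + c * ?P x))"
      using n2 AE_space[of "lebesgue_on {0<..<1}"] unfolding ae_eq_on_def
    proof eventually_elim
      case (elim x)
      then have "\<rho>2 x \<noteq> 0" using r(2)[of x] by simp
      then show ?case using elim(1) by (intro solve) (simp_all add: algebra_simps)
    qed
    have e3: "trace_at (-1) 0 (T_op (-1) 0 \<sigma>1 q1 u) 0 - trace_at 0 1 (T_op 0 1 \<sigma>2 q2 v) 0 =
      - (M *\<^sub>R (complex_of_real l * trace_at (-1) 0 u 0 + c * ?P 0))" (is "?t = _")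
    proof -
      have "(1 / M) *\<^sub>R ?t - (- (complex_of_real l * z + c * ?P 0)) = - (- ((1 / M) *\<^sub>R ?t) - complex_of_real l * z - c * ?P 0)"
        by (simp add: algebra_simps)
      also have "\<dots> = 0" unfolding n3 by simp
      finally have "?t = M *\<^sub>R (- (complex_of_real l * z + c * ?P 0))" by (rule solve) (use M in simp)
      then show ?thesis by (simp only: dd(4) scaleR_minus_right)
    qed
    have cG: "continuous_on {-1..1} (\<lambda>x. c * ?P x)" by (intro continuous_intros cP)
    obtain U \<Theta> n R1 R2 where U: "bvp (\<lambda>x. complex_of_real l * U x + c * ?P x) U \<Theta> n R1 R2"
      "ae_eq_on (-1) 0 u U" "ae_eq_on 0 1 v U" "trace_at (-1) 0 u 0 = U 0"
      by (rule weak_to_bvp[OF dd(1-3) cG e1 e2 e3])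
    have cU: "continuous_on {-1..1} U" by (rule bvp_continuous(1)[OF U(1)])
    have no_jordan_chain: "d = 0" if "bvp (\<lambda>x. l * y x + d * \<phi> x) y \<Theta>' n' R1' R2'" for d y \<Theta>' n' R1' R2'
    proof -
      have cy: "continuous_on {-1..1} y" by (rule bvp_continuous(1)[OF that])
      have "mass_inner (\<lambda>x. l * y x + d * \<phi> x) \<phi> = mass_inner (\<lambda>x. l * \<phi> x) y"
        by (rule bvp_symmetric[OF that b(1)]) (intro continuous_intros cy c\<phi>)+
      moreover have "mass_inner (\<lambda>x. l * y x + d * \<phi> x) \<phi> = l * mass_inner y \<phi> + d * mass_inner \<phi> \<phi>"
        by (subst mass_inner_lincomb) (intro continuous_intros cy c\<phi> | simp add: mass_inner_scale cy c\<phi>)+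
      moreover have "mass_inner (\<lambda>x. l * \<phi> x) y = l * mass_inner y \<phi>"
        using mass_inner_scale[OF c\<phi> cy] mass_inner_commute by metis
      ultimately show ?thesis using in\<phi> by simp
    qed
    have bRe: "bvp (\<lambda>x. l * Re (U x) + Re c * \<phi> x) (\<lambda>x. Re (U x)) (\<lambda>t. Re (\<Theta> t)) (\<lambda>t. Re (n t)) (\<lambda>t. Re (R1 t)) (\<lambda>t. Re (R2 t))"
      using bvp_linear[OF U(1) bounded_linear_Re] by simp
    have bIm: "bvp (\<lambda>x. l * Im (U x) + Im c * \<phi> x) (\<lambda>x. Im (U x)) (\<lambda>t. Im (\<Theta> t)) (\<lambda>t. Im (n t)) (\<lambda>t. Im (R1 t)) (\<lambda>t. Im (R2 t))"
      using bvp_linear[OF U(1) bounded_linear_Im] by simp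
    note c0 = no_jordan_chain[OF bRe] no_jordan_chain[OF bIm]
    obtain \<alpha> where \<alpha>: "\<And>x. x \<in> {-1..1} \<Longrightarrow> Re (U x) = \<alpha> * \<phi> x"
      using bvp_simple[OF b(1) bRe[unfolded c0 mult_zero_left add_0_right] less_imp_le[OF lpos] b(2,3)] by blast
    obtain \<beta> where \<beta>: "\<And>x. x \<in> {-1..1} \<Longrightarrow> Im (U x) = \<beta> * \<phi> x"
      using bvp_simple[OF b(1) bIm[unfolded c0 mult_zero_left add_0_right] less_imp_le[OF lpos] b(2,3)] by blast
    have UP: "U x = Complex \<alpha> \<beta> * ?P x" if "x \<in> {-1..1}" for x
      using \<alpha>[OF that] \<beta>[OF that] by (simp add: complex_eq_iff)
    have "ae_eq_on (-1) 0 u (\<lambda>x. Complex \<alpha> \<beta> * ?P x)"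
      by (rule ae_eq_on_trans[OF U(2)], rule ae_eq_onI) (simp add: UP)
    moreover have "ae_eq_on 0 1 v (\<lambda>x. Complex \<alpha> \<beta> * ?P x)"
      by (rule ae_eq_on_trans[OF U(3)], rule ae_eq_onI) (simp add: UP)
    moreover have "z = Complex \<alpha> \<beta> * ?P 0" using U(4) dd(4) UP[of 0] by simp
    ultimately show ?case
      by (intro exI[of _ "Complex \<alpha> \<beta>"]) (simp add: w' w_def state_minus_mult_def H_null_def ae_eq_on_def)
  qed
  show ?thesis
    unfolding algebraically_simple_def
  proof (intro bexI[OF _ w(1)] conjI w(2) ballI)
    fix w' assume "w' \<in> A_gen_eigenspace M \<rho>1 \<rho>2 \<sigma>1 \<sigma>2 q1 q2 (complex_of_real l)"
    then show "\<exists>c. state_minus_mult w' c w \<in> H_null"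
      unfolding A_gen_eigenspace_def using chain_in_span by blast
  qed
qed

lemma spectral_theorem:
  "\<exists>ev :: nat \<Rightarrow> real.
     0 < ev 0 \<and> strict_mono ev \<and> filterlim ev at_top sequentially \<and>
     {l :: complex. \<exists>u v. eigenpair M \<rho>1 \<rho>2 \<sigma>1 \<sigma>2 q1 q2 l u v} = range (\<lambda>n. complex_of_real (ev n)) \<and>
     (\<forall>n. algebraically_simple M \<rho>1 \<rho>2 \<sigma>1 \<sigma>2 q1 q2 (complex_of_real (ev n))) \<and>
     (\<forall>n. \<forall>u v :: real \<Rightarrow> real. eigenpair M \<rho>1 \<rho>2 \<sigma>1 \<sigma>2 q1 q2 (ev n) u v \<longrightarrow>
        trace_at (-1) 0 (wderiv 1 (-1) 0 u) (-1) * trace_at (-1) 0 (T_op (-1) 0 \<sigma>1 q1 u) (-1) < 0 \<and>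
        trace_at 0 1 (wderiv 1 0 1 v) 1 * trace_at 0 1 (T_op 0 1 \<sigma>2 q2 v) 1 < 0)"
proof -
  have fin: "finite {l \<in> {l. eigenvalue l}. l \<le> x}" for x using finite_eigenvalues_below[of x] by simp
  obtain ev :: "nat \<Rightarrow> real" where ev: "strict_mono ev" "range ev = {l. eigenvalue l}" "filterlim ev at_top sequentially"
    using enumerate_locally_finite[OF infinite_eigenvalues fin] .
  have e: "eigenvalue (ev n)" for n using ev(2) by blast
  have pos: "0 < ev n" for n using e[of n] eigenvalue_pos by (auto simp: eigenvalue_def)
  have "{l :: complex. \<exists>u v. eigenpair' l u v} = range (\<lambda>n. complex_of_real (ev n))"
  proof (intro set_eqI iffI)
    fix l :: complex assume "l \<in> {l. \<exists>u v. eigenpair' l u v}"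
    then obtain u v where uv: "eigenpair' l u v" by blast
    obtain U \<Theta> m T1 T2 x where b: "bvp (\<lambda>x. l * U x) U \<Theta> m T1 T2" "x \<in> {-1..1}" "U x \<noteq> 0"
      by (rule eigenpair_to_bvp[OF uv])
    obtain n where "Re l = ev n" using bvp_complex_eigenvalue_real(2)[OF b] ev(2) by blast
    then have "l = complex_of_real (ev n)" using bvp_complex_eigenvalue_real(1)[OF b] by (simp add: complex_eq_iff)
    then show "l \<in> range (\<lambda>n. complex_of_real (ev n))" by blast
  next
    fix l :: complex assume "l \<in> range (\<lambda>n. complex_of_real (ev n))"
    then obtain n where l: "l = complex_of_real (ev n)" by blast
    show "l \<in> {l. \<exists>u v. eigenpair' l u v}"
      by (rule eigenvalue_eigenpair[OF e[of n]]) (auto simp: l)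
  qed
  moreover have "trace_at (-1) 0 (wderiv 1 (-1) 0 u) (-1) * trace_at (-1) 0 (T_op (-1) 0 \<sigma>1 q1 u) (-1) < 0 \<and>
        trace_at 0 1 (wderiv 1 0 1 v) 1 * trace_at 0 1 (T_op 0 1 \<sigma>2 q2 v) 1 < 0"
    if uv: "eigenpair' (ev n) u v" for n and u v :: "real \<Rightarrow> real"
  proof -
    obtain U \<Theta> m T1 T2 x where b: "bvp (\<lambda>x. ev n * U x) U \<Theta> m T1 T2" "x \<in> {-1..1}" "U x \<noteq> 0"
      and t: "trace_at (-1) 0 (wderiv 1 (-1) 0 u) (-1) = \<Theta> (-1)" "trace_at 0 1 (wderiv 1 0 1 v) 1 = \<Theta> 1"
      "trace_at (-1) 0 (T_op (-1) 0 \<sigma>1 q1 u) (-1) = T1 (-1)" "trace_at 0 1 (T_op 0 1 \<sigma>2 q2 v) 1 = T2 1"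
      by (rule eigenpair_to_bvp[OF uv])
    show ?thesis
      unfolding t using bvp_sign_left[OF b(1) _ b(2,3)] bvp_sign_right[OF b(1) _ b(2,3)] pos[of n] by simp
  qed
  ultimately show ?thesis using ev pos eigenvalue_algebraically_simple[OF e] by blast
qed

end

text \<open>
  \<open>max c g\<close> and \<open>g\<close> are continuous and agree almost everywhere.
\<close>

lemma ae_ge_continuous:
  fixes f g :: "real \<Rightarrow> real"
  assumes ab: "a < b" and ge: "AE x in lebesgue_on {a<..<b}. c \<le> f x" and fg: "ae_eq_on a b f g"
    and g: "continuous_on {a..b} g" and x: "x \<in> {a..b}"
  shows "c \<le> g x"
proof -
  have "ae_eq_on a b (\<lambda>x. max c (g x)) g"
    using ge fg unfolding ae_eq_on_def by eventually_elim auto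
  then have "max c (g x) = g x"
    by (intro ae_eq_on_continuous_imp_eq[OF ab _ g _ x]) (auto intro: continuous_intros g)
  then show ?thesis by simp
qed

lemma continuous_ge_closed:
  fixes f :: "real \<Rightarrow> real"
  assumes ab: "a < b" and f: "continuous_on {a..b} f" and ge: "\<forall>x\<in>{a<..<b}. f x \<ge> c" and x: "x \<in> {a..b}"
  shows "c \<le> f x"
  by (rule ae_ge_continuous[OF ab _ _ f x, of c f]) (use ge in \<open>auto intro!: AE_I2\<close>)

theorem theorem1p1:
  fixes M \<rho>0 \<sigma>0 :: real
    and \<rho>1 \<rho>2 \<sigma>1 \<sigma>2 q1 q2 :: "real \<Rightarrow> real"
  assumes "M > 0"
    and "continuous_on {-1..0} \<rho>1" and "continuous_on {0..1} \<rho>2"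
    and "sobolev 2 (-1) 0 \<sigma>1" and "sobolev 2 0 1 \<sigma>2"
    and "sobolev 1 (-1) 0 q1" and "sobolev 1 0 1 q2"
    and "\<rho>0 > 0" and "\<sigma>0 > 0"
    and "\<forall>x\<in>{-1<..<0}. \<rho>1 x \<ge> \<rho>0" and "\<forall>x\<in>{0<..<1}. \<rho>2 x \<ge> \<rho>0"
    and "AE x in lebesgue_on {-1<..<0}. \<sigma>1 x \<ge> \<sigma>0"
    and "AE x in lebesgue_on {0<..<1}. \<sigma>2 x \<ge> \<sigma>0"
    and "AE x in lebesgue_on {-1<..<0}. q1 x \<ge> 0"
    and "AE x in lebesgue_on {0<..<1}. q2 x \<ge> 0"
  shows "\<exists>ev :: nat \<Rightarrow> real.
     0 < ev 0 \<and> strict_mono ev \<and> filterlim ev at_top sequentially \<and>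
     {l :: complex. \<exists>u v. eigenpair M \<rho>1 \<rho>2 \<sigma>1 \<sigma>2 q1 q2 l u v} = range (\<lambda>n. complex_of_real (ev n)) \<and>
     (\<forall>n. algebraically_simple M \<rho>1 \<rho>2 \<sigma>1 \<sigma>2 q1 q2 (complex_of_real (ev n))) \<and>
     (\<forall>n. \<forall>u v :: real \<Rightarrow> real. eigenpair M \<rho>1 \<rho>2 \<sigma>1 \<sigma>2 q1 q2 (ev n) u v \<longrightarrow>
        trace_at (-1) 0 (wderiv 1 (-1) 0 u) (-1) * trace_at (-1) 0 (T_op (-1) 0 \<sigma>1 q1 u) (-1) < 0 \<and>
        trace_at 0 1 (wderiv 1 0 1 v) 1 * trace_at 0 1 (T_op 0 1 \<sigma>2 q2 v) 1 < 0)"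
proof -
  have lt: "(-1::real) < 0" "(0::real) < 1" by auto
  obtain S1 S1' s1' where S1: "has_deriv_on (-1) 0 S1 S1'" "ac_on (-1) 0 S1' s1'" "L2_on (-1) 0 s1'" "ae_eq_on (-1) 0 \<sigma>1 S1"
    using sobolev_2_rep[OF lt(1) assms(4)] .
  obtain S2 S2' s2' where S2: "has_deriv_on 0 1 S2 S2'" "ac_on 0 1 S2' s2'" "L2_on 0 1 s2'" "ae_eq_on 0 1 \<sigma>2 S2"
    using sobolev_2_rep[OF lt(2) assms(5)] .
  obtain Q1 q1' where Q1: "ac_on (-1) 0 Q1 q1'" "ae_eq_on (-1) 0 q1 Q1" "L2_on (-1) 0 q1'"
    using sobolev_1_rep[OF lt(1) assms(6)] .
  obtain Q2 q2' where Q2: "ac_on 0 1 Q2 q2'" "ae_eq_on 0 1 q2 Q2" "L2_on 0 1 q2'"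
    using sobolev_1_rep[OF lt(2) assms(7)] .
  note cS = has_deriv_on_continuous[OF S1(1)] has_deriv_on_continuous[OF S2(1)]
  note cQ = ac_on_continuous[OF Q1(1)] ac_on_continuous[OF Q2(1)]
  have pS1: "0 < S1 x" if "x \<in> {-1..0}" for x
    using ae_ge_continuous[OF lt(1) assms(12) S1(4) cS(1) that] assms(9) by simp
  have pS2: "0 < S2 x" if "x \<in> {0..1}" for x
    using ae_ge_continuous[OF lt(2) assms(13) S2(4) cS(2) that] assms(9) by simp
  have pQ1: "0 \<le> Q1 x" if "x \<in> {-1..0}" for x
    by (rule ae_ge_continuous[OF lt(1) assms(14) Q1(2) cQ(1) that])
  have pQ2: "0 \<le> Q2 x" if "x \<in> {0..1}" for x
    by (rule ae_ge_continuous[OF lt(2) assms(15) Q2(2) cQ(2) that])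
  have p\<rho>1: "0 < \<rho>1 x" if "x \<in> {-1..0}" for x
    using continuous_ge_closed[OF lt(1) assms(2,10) that] assms(8) by simp
  have p\<rho>2: "0 < \<rho>2 x" if "x \<in> {0..1}" for x
    using continuous_ge_closed[OF lt(2) assms(3,11) that] assms(8) by simp
  have cR: "continuous_on {-1..0} (\<lambda>x. 1 / S1 x)" "continuous_on {0..1} (\<lambda>x. 1 / S2 x)"
    using cS pS1 pS2 by (intro continuous_intros; force)+
  interpret beam_problem M \<sigma>1 q1 S1 S1' s1' Q1 q1' \<sigma>2 q2 S2 S2' s2' Q2 q2' \<rho>1 \<rho>2
  proof (intro beam_problem.intro)
    show "beam_coeff (-1) 0 \<sigma>1 q1 S1 S1' s1' Q1 q1'"
      by (rule beam_coeff.intro) (fact lt S1 Q1 pS1)+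
    show "beam_coeff 0 1 \<sigma>2 q2 S2 S2' s2' Q2 q2'"
      by (rule beam_coeff.intro) (fact lt S2 Q2 pS2)+
    show "two_beams M (\<lambda>x. 1 / S1 x) (\<lambda>x. 1 / S2 x) Q1 Q2 \<rho>1 \<rho>2"
      by (rule two_beams.intro) (use assms(1-3) cR cQ pS1 pS2 pQ1 pQ2 p\<rho>1 p\<rho>2 in auto)
  qed
  show ?thesis by (rule spectral_theorem)
qed

end
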